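(* Let $\Omega\subset\mathbb{C}^2$ be a bounded generic convex domain with piecewise Levi flat boundary, and let $\Omega'\subset\mathbb{C}^2$ be a bounded domain that is biholomorphic to $\Omega$. Then $\partial\Omega'$ is Levi flat at every $C^2$-smooth boundary point of $\Omega'$.
   Context: Piecewise smooth boundary: a bounded domain $\Omega\subset\mathbb{C}^n$ has piecewise $C^r$-smooth boundary if there exist a neighborhood $U$ of $\overline{\Omega}$ and $C^r$-smooth functions $\rho_1,\dots,\rho_k:U\to\mathbb{R}$ such that $\Omega=\{z\in U:\rho_1(z)<0,\dots,\rho_k(z)<0\}$. Such a domain is called generic if for all distinct indices $i_1,\dots,i_l$ one has $d\rho_{i_1}\wedge\cdots\wedge d\rho_{i_l}\neq 0$ at every $z$ with $\rho_{i_1}(z)=\cdots=\rho_{i_l}(z)=0$. Levi flatness: a hypersurface $H=\{\rho=0\}$, with $\rho$ real-valued, $C^2$-smooth and $\operatorname{grad}\rho(p)\ne0$ at $p\in H$, is Levi flat at $p$ if $\sum_{i,j=1}^n\frac{\partial^2\rho}{\partial z_i\partial\overline{z}_j}(p)w_i\overline{w}_j=0$ for every $w=(w_1,\dots,w_n)\in\mathbb{C}^n$ with $\sum_{i=1}^n\frac{\partial\rho}{\partial z_i}(p)w_i=0$. $H$ is Levi flat if it is Levi flat at each of its points. A generic domain $\Omega=\{z\in U:\rho_1<0,\dots,\rho_k<0\}$ with piecewise $C^2$-smooth boundary has piecewise Levi flat boundary if the hypersurface $\{z\in U:\rho_i(z)=0\}$ is Levi flat for each $i=1,\dots,k$. A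 boundary point $p$ of a domain $\Omega'$ is $C^2$-smooth if near $p$ the domain is given by $\{\rho<0\}$ for a real-valued $C^2$-smooth function $\rho$ defined near $p$ with $\rho(p)=0$ and $\operatorname{grad}\rho(p)\neq0$; Levi flatness of $\partial\Omega'$ at $p$ is that of $\{\rho=0\}$ at $p$. *)

theory Defs
  imports "HOL-Analysis.Analysis"
begin

definition is_domain :: "'a::topological_space set \<Rightarrow> bool" where
  "is_domain S \<longleftrightarrow> open S \<and> connected S \<and> S \<noteq> {}"

text \<open>Only used for open \<open>S\<close>; the derivatives are total (real) Frechet derivatives.\<close>

definition C2_on :: "('a::real_normed_vector \<Rightarrow> real) \<Rightarrow> 'a set \<Rightarrow> bool" where
  "C2_on f S \<longleftrightarrow> (\<exists>(f' :: 'a \<Rightarrow> 'a \<Rightarrow>\<^sub>L real) (f'' :: 'a \<Rightarrow> 'a \<Rightarrow>\<^sub>L 'a \<Rightarrow>\<^sub>L real).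
     (\<forall>x\<in>S. (f has_derivative blinfun_apply (f' x)) (at x)) \<and>
     (\<forall>x\<in>S. (f' has_derivative blinfun_apply (f'' x)) (at x)) \<and>
     continuous_on S f'')"

text \<open>With \<open>z\<^sub>j = x\<^sub>j + \<i> y\<^sub>j\<close>, the directions of \<open>\<partial>/\<partial>x\<^sub>j\<close> and \<open>\<partial>/\<partial>y\<^sub>j\<close> are
  \<open>axis j 1\<close> and \<open>axis j \<i>\<close>; the next two are the Wirtinger operators
  \<open>\<partial>/\<partial>z\<^sub>j = (\<partial>/\<partial>x\<^sub>j - \<i> \<partial>/\<partial>y\<^sub>j) / 2\<close> and its conjugate.
  They are meaningful only where \<open>g\<close> is real differentiable.\<close>

definition dz :: "'n::finite \<Rightarrow> (complex^'n \<Rightarrow> complex) \<Rightarrow> complex^'n \<Rightarrow> complex" where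
  "dz j g p = (frechet_derivative g (at p) (axis j 1)
               - \<i> * frechet_derivative g (at p) (axis j \<i>)) / 2"

definition dzbar :: "'n::finite \<Rightarrow> (complex^'n \<Rightarrow> complex) \<Rightarrow> complex^'n \<Rightarrow> complex" where
  "dzbar j g p = (frechet_derivative g (at p) (axis j 1)
                  + \<i> * frechet_derivative g (at p) (axis j \<i>)) / 2"

text \<open>Levi flatness at \<open>p\<close> of the hypersurface \<open>{\<rho> = 0}\<close>. That \<open>\<rho>\<close> is \<open>C\<^sup>2\<close> near \<open>p\<close>,
  \<open>\<rho> p = 0\<close> and \<open>grad \<rho> p \<noteq> 0\<close> is ensured wherever this is used.\<close>

definition levi_flat_at :: "(complex^'n::finite \<Rightarrow> real) \<Rightarrow> complex^'n \<Rightarrow> bool" where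
  "levi_flat_at \<rho> p \<longleftrightarrow>
     (\<forall>w::complex^'n.
        (\<Sum>i\<in>UNIV. dz i (\<lambda>z. complex_of_real (\<rho> z)) p * w $ i) = 0 \<longrightarrow>
        (\<Sum>i\<in>UNIV. \<Sum>j\<in>UNIV.
           dz i (dzbar j (\<lambda>z. complex_of_real (\<rho> z))) p * w $ i * cnj (w $ j)) = 0)"

text \<open>The alternating multilinear form \<open>\<omega>\<^sub>1 \<and> \<dots> \<and> \<omega>\<^sub>l\<close>, as a function of the \<open>l\<close> vectors
  \<open>v 0, \<dots>, v (l - 1)\<close>; the value is \<open>1\<close> for the empty list.\<close>

definition wedge :: "('a \<Rightarrow> real) list \<Rightarrow> (nat \<Rightarrow> 'a) \<Rightarrow> real" where
  "wedge \<omega>s v = (\<Sum>\<sigma> | \<sigma> permutes {..<length \<omega>s}.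
       of_int (sign \<sigma>) * (\<Prod>a<length \<omega>s. (\<omega>s ! a) (v (\<sigma> a))))"

definition pw_C2_presentation ::
  "(complex^'n::finite) set \<Rightarrow> (complex^'n) set \<Rightarrow> nat \<Rightarrow> (nat \<Rightarrow> complex^'n \<Rightarrow> real) \<Rightarrow> bool" where
  "pw_C2_presentation \<Omega> U k \<rho> \<longleftrightarrow>
     open U \<and> closure \<Omega> \<subseteq> U \<and> (\<forall>i<k. C2_on (\<rho> i) U) \<and>
     \<Omega> = {z \<in> U. \<forall>i<k. \<rho> i z < 0}"

definition generic_presentation ::
  "(complex^'n::finite) set \<Rightarrow> nat \<Rightarrow> (nat \<Rightarrow> complex^'n \<Rightarrow> real) \<Rightarrow> bool" where
  "generic_presentation U k \<rho> \<longleftrightarrow>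
     (\<forall>js. distinct js \<and> set js \<subseteq> {..<k} \<longrightarrow>
        (\<forall>z\<in>U. (\<forall>i\<in>set js. \<rho> i z = 0) \<longrightarrow>
           wedge (map (\<lambda>i. frechet_derivative (\<rho> i) (at z)) js) \<noteq> (\<lambda>v. 0)))"

definition generic_pw_levi_flat :: "(complex^'n::finite) set \<Rightarrow> bool" where
  "generic_pw_levi_flat \<Omega> \<longleftrightarrow>
     (\<exists>U k \<rho>. pw_C2_presentation \<Omega> U k \<rho> \<and> generic_presentation U k \<rho> \<and>
        (\<forall>i<k. \<forall>p\<in>U. \<rho> i p = 0 \<longrightarrow> levi_flat_at (\<rho> i) p))"

text \<open>Complex Frechet differentiability at each point; \<open>S\<close> is meant to be open.\<close>

definition holomorphic_map ::
  "(complex^'n::finite \<Rightarrow> complex^'m::finite) \<Rightarrow> (complex^'n) set \<Rightarrow> bool" where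
  "holomorphic_map f S \<longleftrightarrow>
     (\<forall>z\<in>S. \<exists>D. (f has_derivative D) (at z) \<and> Vector_Spaces.linear (*s) (*s) D)"

definition biholomorphic :: "(complex^'n::finite) set \<Rightarrow> (complex^'m::finite) set \<Rightarrow> bool" where
  "biholomorphic S T \<longleftrightarrow>
     (\<exists>f g. holomorphic_map f S \<and> holomorphic_map g T \<and> f ` S = T \<and> g ` T = S \<and>
        (\<forall>z\<in>S. g (f z) = z) \<and> (\<forall>w\<in>T. f (g w) = w))"

definition C2_local_defining ::
  "(complex^'n::finite) set \<Rightarrow> complex^'n \<Rightarrow> (complex^'n) set \<Rightarrow> (complex^'n \<Rightarrow> real) \<Rightarrow> bool" where
  "C2_local_defining \<Omega> p V \<rho> \<longleftrightarrow>
     open V \<and> p \<in> V \<and> C2_on \<rho> V \<and> \<Omega> \<inter> V = {z \<in> V. \<rho> z < 0} \<and>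
     \<rho> p = 0 \<and> (\<exists>D. GDERIV \<rho> p :> D \<and> D \<noteq> 0)"

definition C2_smooth_boundary_point :: "(complex^'n::finite) set \<Rightarrow> complex^'n \<Rightarrow> bool" where
  "C2_smooth_boundary_point \<Omega> p \<longleftrightarrow> p \<in> frontier \<Omega> \<and> (\<exists>V \<rho>. C2_local_defining \<Omega> p V \<rho>)"

text \<open>Levi flatness does not depend on the local defining function, so all of them are required
  to satisfy it. The condition has content only at \<open>C\<^sup>2\<close>-smooth boundary points.\<close>

definition boundary_levi_flat_at :: "(complex^'n::finite) set \<Rightarrow> complex^'n \<Rightarrow> bool" where
  "boundary_levi_flat_at \<Omega> p \<longleftrightarrow> (\<forall>V \<rho>. C2_local_defining \<Omega> p V \<rho> \<longrightarrow> levi_flat_at \<rho> p)"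

end

theory Submission
  imports Defs "HOL-Complex_Analysis.Complex_Analysis"
begin

text \<open>
  A convex Levi flat hypersurface has a Hessian which is positive semidefinite on the tangent space
  and vanishes on the complex tangent space, hence the latter lies in its kernel and the direction of
  the complex tangent space is locally constant. So \<open>\<Omega>\<close> is locally an intersection of finitely many
  cylinders \<open>l\<^sub>s\<^sup>-\<^sup>1(G\<^sub>s)\<close> with \<open>l\<^sub>s\<close> complex linear and \<open>G\<^sub>s\<close> planar and convex.

  Suppose \<open>f : \<Omega> \<rightarrow> \<Omega>'\<close> is biholomorphic and the Levi form at \<open>p \<in> \<partial>\<Omega>'\<close> does not vanish. If it is
  negative, there is a family of discs in \<open>\<Omega>'\<close> with boundaries in a compact set and centres tending
  to \<open>p\<close>, which contradicts the maximum principle for supporting functionals of \<open>\<Omega>\<close>. If it is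
  positive, let \<open>h\<close> be a Levi polynomial at \<open>p\<close>, shifted so that \<open>Re h > 0\<close> only on a small cap of
  \<open>\<Omega>'\<close> at \<open>p\<close>. Near a boundary point of \<open>\<Omega>\<close> that lies on only one cylinder, \<open>\<Omega>\<close> contains discs of fixed
  size parallel to the kernel of \<open>l\<^sub>s\<close>; strict pseudoconvexity makes \<open>f\<close> collapse them wherever \<open>f\<close> tends
  to the cap, so a difference \<open>F(z) = f(z + \<tau> e) - f(z)\<close> tends to zero there, and the maximum principle for
  \<open>exp (N h \<circ> f) F\<close> on slices, for large \<open>N\<close>, forces \<open>limsup (Re h \<circ> f) \<le> 0\<close> at such points. Slices parallel to
  one of the kernels extend this to points on several cylinders, by induction on their number. By
  the maximum principle \<open>Re h \<circ> f \<le> 0\<close> on all of \<open>\<Omega>\<close>, a contradiction.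
\<close>

text \<open>The obstacle is that \<open>f\<close> has no boundary values on the frontier of
  \<open>\<Omega>\<close>, and nothing is known about it away from the cap. So boundary statements
  are limsups along the open set \<open>A\<close> where \<open>f\<close> lands in the cap. The
  factor \<open>exp (N h)\<close> removes any need to know how small \<open>F\<close> is: at a point
  \<open>z1\<close> the maximum principle bounds \<open>exp (N t) |F z1|\<close> by a constant
  independent of \<open>N\<close>, where \<open>t\<close> is \<open>Re h\<close> plus a barrier
  term. Hence \<open>F z1 \<noteq> 0\<close> alone gives \<open>t \<le> 0\<close>. For a difference
  with fixed \<open>\<tau>\<close>, injectivity of \<open>f\<close> provides the nonvanishing.
  Slices are confined to a small ball, and the barrier, built from a complex supporting form, pays
  for the boundary this creates inside \<open>\<Omega>\<close>. Genericity supplies vectors dual to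
  the active differentials, hence a chart in which all active defining functions are linear; in it
  the smooth boundary pieces at a corner are convex, so a zero derivative along segments gives
  constancy. Dimension two enters through kernels of forms on \<open>complex^2\<close>: they are
  lines, so one vector \<open>w\<close> decides the sign of the Levi form on the complex tangent
  space, and each kernel contains a direction for discs.\<close>

subsection \<open>Second derivatives\<close>

text \<open>Continuity of \<open>f''\<close> at \<open>p\<close> makes \<open>f'\<close> strictly
  differentiable there: subtracting the linear map \<open>f'' p\<close> leaves a map whose
  derivative is small on a small ball. Uniformity in both \<open>x\<close> and \<open>y\<close>
  permits Taylor expansions at base points other than \<open>p\<close>.\<close>

lemma C2_derivative_expansion:
  fixes f' :: "'a::real_normed_vector \<Rightarrow> 'a \<Rightarrow>\<^sub>L real"
  assumes V: "open V" "p \<in> V" and d2: "\<forall>x\<in>V. (f' has_derivative blinfun_apply (f'' x)) (at x)"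
    and c: "continuous_on V f''" and e: "\<epsilon> > 0"
  shows "\<exists>s>0. ball p s \<subseteq> V \<and> (\<forall>x\<in>ball p s. \<forall>y\<in>ball p s. norm (f' y - f' x - f'' p (y - x)) \<le> \<epsilon> * norm (y - x))"
proof -
  obtain s1 where s1: "s1 > 0" "ball p s1 \<subseteq> V" using V openE by blast
  have "isCont f'' p" using c V continuous_on_eq_continuous_at by blast
  then obtain s2 where s2: "s2 > 0" "\<And>x. dist x p < s2 \<Longrightarrow> dist (f'' x) (f'' p) < \<epsilon>"
    using e unfolding continuous_at_eps_delta by metis
  define s where "s = min s1 s2"
  have "norm (f' y - f' x - f'' p (y - x)) \<le> \<epsilon> * norm (y - x)" if xy: "x \<in> ball p s" "y \<in> ball p s" for x y
  proof -
    define g where "g = (\<lambda>z. f' z - f'' p z)"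
    have "norm (g y - g x) \<le> \<epsilon> * norm (y - x)"
    proof (rule differentiable_bound[where f' = "\<lambda>z h. (f'' z - f'' p) h" and S = "ball p s"])
      show "convex (ball p s)" by simp
      show "(g has_derivative (\<lambda>h. (f'' z - f'' p) h)) (at z within ball p s)" if "z \<in> ball p s" for z
      proof -
        have "z \<in> V" using that s1 s_def by auto
        then have "(f' has_derivative blinfun_apply (f'' z)) (at z within ball p s)"
          using d2 has_derivative_at_withinI by blast
        then show ?thesis unfolding g_def
          by (auto intro!: derivative_eq_intros simp: blinfun.diff_left)
      qed
      show "onorm (\<lambda>h. (f'' z - f'' p) h) \<le> \<epsilon>" if "z \<in> ball p s" for z
        using s2(2)[of z] that by (simp add: s_def norm_blinfun.rep_eq[symmetric] norm_minus_commute dist_norm less_imp_le)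
    qed (use xy in auto)
    then show ?thesis by (simp add: g_def blinfun.diff_right algebra_simps)
  qed
  then show ?thesis using s1 s2 s_def by (intro exI[of _ s]) auto
qed

text \<open>The Hessian is replaced by one fixed form \<open>B\<close>, whatever the base point
  \<open>x\<close>; the mean value inequality along the segment from \<open>x\<close> to
  \<open>x + h\<close> turns the error of \<open>B\<close> into the \<open>\<epsilon>\<close>
  term.\<close>

lemma C2_taylor:
  fixes f :: "'a::real_normed_vector \<Rightarrow> real" and B :: "'a \<Rightarrow>\<^sub>L 'a \<Rightarrow>\<^sub>L real"
  assumes d1: "\<forall>x\<in>ball p s. (f has_derivative blinfun_apply (f' x)) (at x)"
    and d2: "\<forall>x\<in>ball p s. \<forall>y\<in>ball p s. norm (f' y - f' x - B (y - x)) \<le> \<epsilon> * norm (y - x)"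
    and x: "x \<in> ball p s" and y: "x + h \<in> ball p s" and e: "0 \<le> \<epsilon>"
  shows "\<bar>f (x + h) - f x - f' x h - blinfun_apply (blinfun_apply B h) h / 2\<bar> \<le> \<epsilon> * (norm h)\<^sup>2"
proof -
  define g where "g = (\<lambda>t. f (x + t *\<^sub>R h) - t * f' x h - t\<^sup>2 / 2 * B h h)"
  have seg: "x + t *\<^sub>R h \<in> ball p s" if "t \<in> {0..1}" for t
  proof -
    have "x + t *\<^sub>R h = (1 - t) *\<^sub>R x + t *\<^sub>R (x + h)" by (simp add: algebra_simps)
    then show ?thesis using convexD_alt[OF convex_ball x y, of t] that by (simp add: algebra_simps)
  qed
  have "norm (g 1 - g 0) \<le> (\<epsilon> * (norm h)\<^sup>2) * norm (1 - 0 :: real)"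
  proof (rule differentiable_bound[where S = "{0..1}" and f' = "\<lambda>t k. k * ((f' (x + t *\<^sub>R h) - f' x - B (t *\<^sub>R h)) h)"])
    fix t :: real assume t: "t \<in> {0..1}"
    have "(f has_derivative f' (x + t *\<^sub>R h)) (at (x + t *\<^sub>R h))" using d1 seg[OF t] by blast
    then have "((\<lambda>t. f (x + t *\<^sub>R h)) has_derivative (\<lambda>k. f' (x + t *\<^sub>R h) (k *\<^sub>R h))) (at t within {0..1})"
      by (rule has_derivative_compose[rotated]) (auto intro!: derivative_eq_intros)
    then show "(g has_derivative (\<lambda>k. k * ((f' (x + t *\<^sub>R h) - f' x - B (t *\<^sub>R h)) h))) (at t within {0..1})"
      unfolding g_def
      by (auto intro!: derivative_eq_intros simp: blinfun.diff_left blinfun.add_left blinfun.scaleR_right blinfun.scaleR_left algebra_simps)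
    have "\<bar>(f' (x + t *\<^sub>R h) - f' x - B (t *\<^sub>R h)) h\<bar> \<le> norm (f' (x + t *\<^sub>R h) - f' x - B (t *\<^sub>R h)) * norm h"
      using norm_blinfun by (metis real_norm_def)
    also have "\<dots> \<le> \<epsilon> * norm (t *\<^sub>R h) * norm h"
      using d2[rule_format, OF x seg[OF t]] by (intro mult_right_mono) auto
    also have "\<dots> \<le> \<epsilon> * (norm h)\<^sup>2"
      using t e by (simp add: power2_eq_square mult_left_le_one_le mult.assoc mult_left_mono)
    finally have le: "\<bar>(f' (x + t *\<^sub>R h) - f' x - B (t *\<^sub>R h)) h\<bar> \<le> \<epsilon> * (norm h)\<^sup>2" .
    show "onorm (\<lambda>k. k * ((f' (x + t *\<^sub>R h) - f' x - B (t *\<^sub>R h)) h)) \<le> \<epsilon> * (norm h)\<^sup>2"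
      by (rule onorm_le) (use mult_left_mono[OF le abs_ge_zero] in \<open>simp add: abs_mult mult_ac\<close>)
  qed auto
  then show ?thesis by (simp add: g_def)
qed

text \<open>The second difference of \<open>f\<close> is symmetric in its two increments and is
  approximated by \<open>f'' p\<close> on them in either order. Scaling the increments by a small
  \<open>t\<close> and cancelling \<open>t^2\<close> compares the two values.\<close>

lemma C2_symmetric:
  fixes f :: "'a::real_normed_vector \<Rightarrow> real"
  assumes V: "open V" "p \<in> V" and d1: "\<forall>x\<in>V. (f has_derivative blinfun_apply (f' x)) (at x)"
    and d2: "\<forall>x\<in>V. (f' has_derivative blinfun_apply (f'' x)) (at x)"
    and c: "continuous_on V f''"
  shows "blinfun_apply (blinfun_apply (f'' p) h) k = f'' p k h"
proof -
  have second_difference: "\<bar>(f (p + u + v) - f (p + u) - f (p + v) + f p) - f'' p u v\<bar> \<le> \<epsilon> * norm u * norm v"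
    if e: "\<epsilon> \<ge> 0" and s: "ball p s \<subseteq> V"
      and est: "\<forall>x\<in>ball p s. \<forall>y\<in>ball p s. norm (f' y - f' x - f'' p (y - x)) \<le> \<epsilon> * norm (y - x)"
      and uv: "norm u + norm v < s" for \<epsilon> s u v
  proof -
    define g where "g = (\<lambda>t. f (p + u + t *\<^sub>R v) - f (p + t *\<^sub>R v) - t * f'' p u v)"
    have b: "p + u + t *\<^sub>R v \<in> ball p s" "p + t *\<^sub>R v \<in> ball p s" if "t \<in> {0..1}" for t
    proof -
      have "norm (u + t *\<^sub>R v) \<le> norm u + norm v" "norm (t *\<^sub>R v) \<le> norm u + norm v"
        using that norm_triangle_ineq[of u "t *\<^sub>R v"] mult_left_le_one_le[of "norm v" t] norm_ge_zero[of u]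
        by (simp_all, linarith+)
      then show "p + u + t *\<^sub>R v \<in> ball p s" "p + t *\<^sub>R v \<in> ball p s" using uv
        using norm_minus_cancel[of "u + t *\<^sub>R v"] by (simp_all add: dist_norm)
    qed
    have "norm (g 1 - g 0) \<le> (\<epsilon> * norm u * norm v) * norm (1 - 0 :: real)"
    proof (rule differentiable_bound[where S = "{0..1}" and f' = "\<lambda>t k. k * ((f' (p + u + t *\<^sub>R v) - f' (p + t *\<^sub>R v) - f'' p u) v)"])
      fix t :: real assume t: "t \<in> {0..1}"
      have along: "((\<lambda>t. f (a + t *\<^sub>R v)) has_derivative (\<lambda>k. f' (a + t *\<^sub>R v) (k *\<^sub>R v))) (at t within {0..1})"
        if "a + t *\<^sub>R v \<in> V" for a
        by (rule has_derivative_compose[where f="\<lambda>t. a + t *\<^sub>R v", OF _ d1[rule_format, OF that]]) (auto intro!: derivative_eq_intros)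
      have "((\<lambda>t. f (p + u + t *\<^sub>R v)) has_derivative (\<lambda>k. f' (p + u + t *\<^sub>R v) (k *\<^sub>R v))) (at t within {0..1})"
        "((\<lambda>t. f (p + t *\<^sub>R v)) has_derivative (\<lambda>k. f' (p + t *\<^sub>R v) (k *\<^sub>R v))) (at t within {0..1})"
        using along b[OF t] s by blast+
      then show "(g has_derivative (\<lambda>k. k * ((f' (p + u + t *\<^sub>R v) - f' (p + t *\<^sub>R v) - f'' p u) v))) (at t within {0..1})"
        unfolding g_def
        by (auto intro!: derivative_eq_intros simp: blinfun.diff_left blinfun.add_left blinfun.scaleR_right blinfun.scaleR_left algebra_simps)
      have "\<bar>(f' (p + u + t *\<^sub>R v) - f' (p + t *\<^sub>R v) - f'' p u) v\<bar> \<le> norm (f' (p + u + t *\<^sub>R v) - f' (p + t *\<^sub>R v) - f'' p u) * norm v"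
        using norm_blinfun by (metis real_norm_def)
      also have "\<dots> \<le> \<epsilon> * norm u * norm v"
        using est[rule_format, OF b(2)[OF t] b(1)[OF t]] by (intro mult_right_mono) auto
      finally have le: "\<bar>(f' (p + u + t *\<^sub>R v) - f' (p + t *\<^sub>R v) - f'' p u) v\<bar> \<le> \<epsilon> * norm u * norm v" .
      show "onorm (\<lambda>k. k * ((f' (p + u + t *\<^sub>R v) - f' (p + t *\<^sub>R v) - f'' p u) v)) \<le> \<epsilon> * norm u * norm v"
        by (rule onorm_le) (use mult_left_mono[OF le abs_ge_zero] in \<open>simp add: abs_mult mult_ac\<close>)
    qed auto
    then show ?thesis by (simp add: g_def algebra_simps)
  qed
  have small: "\<bar>f'' p h k - f'' p k h\<bar> \<le> e * (2 * norm h * norm k)" if "e > 0" for e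
  proof -
    obtain s where s: "s > 0" "ball p s \<subseteq> V" "\<forall>x\<in>ball p s. \<forall>y\<in>ball p s. norm (f' y - f' x - f'' p (y - x)) \<le> e * norm (y - x)"
      using C2_derivative_expansion[OF V d2 c \<open>e > 0\<close>] by blast
    define t where "t = s / (norm h + norm k + 1)"
    have t: "t > 0" unfolding t_def using s(1) by (simp add: add_nonneg_pos)
    have ts: "norm (t *\<^sub>R h) + norm (t *\<^sub>R k) < s"
    proof -
      have "norm (t *\<^sub>R h) + norm (t *\<^sub>R k) = t * (norm h + norm k)" using t by (simp add: algebra_simps)
      also have "\<dots> < t * (norm h + norm k + 1)" using t by simp
      also have "\<dots> = s" unfolding t_def by (smt (verit) nonzero_eq_divide_eq norm_ge_zero)
      finally show ?thesis .
    qed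
    have 1: "\<bar>(f (p + t *\<^sub>R h + t *\<^sub>R k) - f (p + t *\<^sub>R h) - f (p + t *\<^sub>R k) + f p) - f'' p (t *\<^sub>R h) (t *\<^sub>R k)\<bar> \<le> e * norm (t *\<^sub>R h) * norm (t *\<^sub>R k)"
      by (rule second_difference[OF _ s(2,3) ts]) (use that in simp)
    have 2: "\<bar>(f (p + t *\<^sub>R k + t *\<^sub>R h) - f (p + t *\<^sub>R k) - f (p + t *\<^sub>R h) + f p) - f'' p (t *\<^sub>R k) (t *\<^sub>R h)\<bar> \<le> e * norm (t *\<^sub>R k) * norm (t *\<^sub>R h)"
      by (rule second_difference[OF _ s(2,3)]) (use that ts in \<open>auto simp: add.commute\<close>)
    have eq: "p + t *\<^sub>R k + t *\<^sub>R h = p + t *\<^sub>R h + t *\<^sub>R k" by (simp add: algebra_simps)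
    have "\<bar>f'' p (t *\<^sub>R h) (t *\<^sub>R k) - f'' p (t *\<^sub>R k) (t *\<^sub>R h)\<bar> \<le> e * (2 * norm (t *\<^sub>R h) * norm (t *\<^sub>R k))"
      using 1 2[unfolded eq] by (simp add: algebra_simps)
    then have "t^2 * \<bar>f'' p h k - f'' p k h\<bar> \<le> t^2 * (e * (2 * norm h * norm k))"
      using t by (simp add: blinfun.scaleR_left blinfun.scaleR_right power2_eq_square right_diff_distrib[symmetric] abs_mult mult_ac)
    then show ?thesis using t by simp
  qed
  have "\<bar>f'' p h k - f'' p k h\<bar> \<le> 0"
  proof (rule field_le_epsilon)
    fix e :: real assume e: "e > 0"
    define D where "D = 2 * norm h * norm k + 1"
    have D: "D > 0" unfolding D_def by (simp add: add_nonneg_pos)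
    have "\<bar>f'' p h k - f'' p k h\<bar> \<le> (e / D) * (2 * norm h * norm k)" using small[of "e / D"] e D by simp
    also have "\<dots> \<le> (e / D) * D" using e D by (intro mult_left_mono) (auto simp: D_def)
    finally show "\<bar>f'' p h k - f'' p k h\<bar> \<le> 0 + e" using D by simp
  qed
  then show ?thesis by simp
qed

subsection \<open>Complex linear forms and the Levi form\<close>

abbreviation clinear_form :: "(complex^'n \<Rightarrow> complex) \<Rightarrow> bool" where
  "clinear_form \<equiv> Vector_Spaces.linear (*s) (*)"

lemma clinear_formI:
  fixes A :: "complex^'n \<Rightarrow> complex"
  assumes "\<And>x y. A (x + y) = A x + A y" "\<And>c x. A (c *s x) = c * A x"
  shows "clinear_form A"
  using assms vec.vector_space_axioms vector_space_over_itself.vector_space_axioms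
  by (auto simp: Vector_Spaces.linear_iff)

lemma
  assumes "clinear_form A"
  shows clinear_form_add: "A (x + y) = A x + A y" and clinear_form_scale: "A (c *s x) = c * A x"
  using assms by (auto simp: Vector_Spaces.linear_iff)

lemma clinear_form_zero: "clinear_form A \<Longrightarrow> A 0 = 0"
  using clinear_form_scale[of A 0 0] by simp

lemma clinear_form_diff:
  assumes "clinear_form A"
  shows "A (x - y) = A x - A y"
  using clinear_form_add[OF assms, of x "- y"] clinear_form_scale[OF assms, of "-1" y] by simp

lemma clinear_form_combination:
  assumes "clinear_form A" "clinear_form B"
  shows "clinear_form (\<lambda>h. a * A h + b * B h)"
  by (rule clinear_formI)
     (simp_all add: clinear_form_add[OF assms(1)] clinear_form_add[OF assms(2)]
       clinear_form_scale[OF assms(1)] clinear_form_scale[OF assms(2)] algebra_simps)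

lemma clinear_form_sum:
  assumes "clinear_form A"
  shows "A (sum f I) = (\<Sum>i\<in>I. A (f i))"
  by (induction I rule: infinite_finite_induct) (simp_all add: clinear_form_zero[OF assms] clinear_form_add[OF assms])

lemma scaleR_vector_scale: "r *\<^sub>R (v :: complex^'n) = complex_of_real r *s v"
  by (simp add: vec_eq_iff complex_eq_iff)

lemma norm_vector_scale: "norm (c *s (v :: complex^'n)) = cmod c * norm v"
proof -
  have "norm (c *s v) = L2_set (\<lambda>i. cmod c * norm (v $ i)) UNIV" by (simp add: norm_vec_def norm_mult)
  then show ?thesis by (simp add: norm_vec_def L2_set_right_distrib)
qed

lemma bounded_linear_vector_scale: "bounded_linear (\<lambda>v :: complex^'n. c *s v)"
  by (rule bounded_linear_intro[where K = "cmod c"])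
     (auto simp: norm_vector_scale vector_add_ldistrib scaleR_vector_scale mult_ac)

lemma bounded_linear_vector_scale_left: "bounded_linear (\<lambda>c. c *s (v :: complex^'n))"
  by (rule bounded_linear_intro[where K = "norm v"])
     (auto simp: norm_vector_scale vector_sadd_rdistrib scaleR_vector_scale scaleR_conv_of_real mult_ac)

lemma clinear_form_bounded_linear:
  assumes "clinear_form A"
  shows "bounded_linear A"
proof -
  have "linear A"
    by (rule linearI) (simp_all add: clinear_form_add[OF assms] clinear_form_scale[OF assms] scaleR_vector_scale scaleR_conv_of_real)
  then show ?thesis by (simp add: linear_conv_bounded_linear)
qed

text \<open>The complex linear form with real part \<open>L\<close>, for real linear
  \<open>L\<close>. For the differential of \<open>\<rho>\<close> it is twice the (1,0)-part, so its
  kernel is the complex tangent space.\<close>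

definition cpart :: "(complex^'n \<Rightarrow> real) \<Rightarrow> complex^'n \<Rightarrow> complex" where
  "cpart L h = complex_of_real (L h) - \<i> * complex_of_real (L (\<i> *s h))"

lemma Re_cpart [simp]: "Re (cpart L h) = L h"
  by (simp add: cpart_def)

lemma clinear_form_cpart:
  fixes L :: "complex^'n \<Rightarrow> real"
  assumes "linear L"
  shows "clinear_form (cpart L)"
proof (rule clinear_formI)
  show add: "cpart L (x + y) = cpart L x + cpart L y" for x y
    by (simp add: cpart_def linear_add[OF assms] vector_add_ldistrib algebra_simps)
  have I: "cpart L (\<i> *s x) = \<i> * cpart L x" for x
  proof -
    have "\<i> *s (\<i> *s x) = - x" by (simp add: vec_eq_iff)
    then show ?thesis by (simp add: cpart_def linear_neg[OF assms] algebra_simps)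
  qed
  have r: "cpart L (complex_of_real r *s x) = complex_of_real r * cpart L x" for r x
  proof -
    have "\<i> *s (complex_of_real r *s x) = r *\<^sub>R (\<i> *s x)" by (simp add: vec_eq_iff complex_eq_iff)
    then show ?thesis
      by (simp add: cpart_def linear_scale[OF assms] scaleR_vector_scale[symmetric] algebra_simps)
  qed
  fix c :: complex and x :: "complex^'n"
  have "c *s x = complex_of_real (Re c) *s x + \<i> *s (complex_of_real (Im c) *s x)"
    by (simp add: vec_eq_iff complex_eq_iff)
  then have "cpart L (c *s x) = (complex_of_real (Re c) + \<i> * complex_of_real (Im c)) * cpart L x"
    by (simp only: add I r distrib_right mult.assoc)
  then show "cpart L (c *s x) = c * cpart L x"
    by (simp only: complex_eq[symmetric])
qed

lemma clinear_form_cpart_blinfun: "clinear_form (cpart (blinfun_apply L))"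
  by (intro clinear_form_cpart bounded_linear.linear blinfun.bounded_linear_right)


text \<open>For the Hessian \<open>B\<close> of a function this is four times its Levi form,
  expressed through real second derivatives.\<close>

definition levi_form :: "((complex^'n) \<Rightarrow>\<^sub>L (complex^'n) \<Rightarrow>\<^sub>L real) \<Rightarrow> complex^'n \<Rightarrow> real" where
  "levi_form B h = B h h + B (\<i> *s h) (\<i> *s h)"

lemma levi_flat_at_iff:
  fixes \<rho> :: "complex^'n \<Rightarrow> real"
  assumes V: "open V" "p \<in> V" and d1: "\<forall>x\<in>V. (\<rho> has_derivative blinfun_apply (\<rho>' x)) (at x)"
    and d2: "\<forall>x\<in>V. (\<rho>' has_derivative blinfun_apply (\<rho>'' x)) (at x)"
    and c: "continuous_on V \<rho>''"
  shows "levi_flat_at \<rho> p \<longleftrightarrow> (\<forall>w. cpart (\<rho>' p) w = 0 \<longrightarrow> levi_form (\<rho>'' p) w = 0)"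
proof -
  have axis: "\<i> *s axis i 1 = axis i \<i>" for i :: 'n by (simp add: vec_eq_iff axis_def)
  define B where "B = \<rho>'' p"
  have fd: "frechet_derivative (\<lambda>z. complex_of_real (\<rho> z)) (at x) = (\<lambda>h. complex_of_real (\<rho>' x h))" if "x \<in> V" for x
    by (rule frechet_derivative_at[OF has_derivative_of_real, symmetric]) (use d1 that in blast)
  have 1: "(\<Sum>i\<in>UNIV. dz i (\<lambda>z. complex_of_real (\<rho> z)) p * w $ i) = cpart (\<rho>' p) w / 2" for w
  proof -
    have "cpart (\<rho>' p) w = cpart (\<rho>' p) (\<Sum>i\<in>UNIV. w $ i *s axis i 1)" by (simp add: basis_expansion)
    also have "\<dots> = (\<Sum>i\<in>UNIV. w $ i * cpart (\<rho>' p) (axis i 1))"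
      using clinear_form_cpart_blinfun[of "\<rho>' p"] by (simp add: clinear_form_sum clinear_form_scale)
    finally show ?thesis
      by (simp add: dz_def fd V cpart_def axis sum_divide_distrib mult_ac)
  qed
  \<comment> \<open>\<open>S h k\<close> is the mixed derivative in the holomorphic direction
    \<open>h\<close> and the antiholomorphic direction \<open>k\<close>. It is complex linear in
    \<open>h\<close> and conjugate linear in \<open>k\<close>, hence determined on coordinate
    vectors; symmetry of \<open>B\<close> makes \<open>S w w\<close> real.\<close>
  define S where "S h k = (complex_of_real (B h k) + \<i> * complex_of_real (B h (\<i> *s k))
    - \<i> * complex_of_real (B (\<i> *s h) k) + complex_of_real (B (\<i> *s h) (\<i> *s k))) / 4" for h k
  have dzz: "dz i (dzbar j (\<lambda>z. complex_of_real (\<rho> z))) p = S (axis i 1) (axis j 1)" for i j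
  proof -
    have "((\<lambda>x. (complex_of_real (\<rho>' x (axis j 1)) + \<i> * complex_of_real (\<rho>' x (axis j \<i>))) / 2)
            has_derivative (\<lambda>h. (complex_of_real (B h (axis j 1)) + \<i> * complex_of_real (B h (axis j \<i>))) / 2)) (at p)"
      unfolding B_def using d2 V by (auto intro!: derivative_eq_intros)
    then have "(dzbar j (\<lambda>z. complex_of_real (\<rho> z)) has_derivative
        (\<lambda>h. (complex_of_real (B h (axis j 1)) + \<i> * complex_of_real (B h (axis j \<i>))) / 2)) (at p)"
      by (rule has_derivative_transform_within_open[OF _ V]) (simp add: dzbar_def fd)
    then show ?thesis
      by (simp add: dz_def frechet_derivative_at[symmetric] S_def axis field_simps)
  qed
  have Sh: "clinear_form (\<lambda>h. S h k)" for k
  proof -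
    have "(\<lambda>h. S h k) = (\<lambda>h. 1/4 * cpart (\<lambda>h. B h k) h + \<i>/4 * cpart (\<lambda>h. B h (\<i> *s k)) h)"
      by (simp add: S_def cpart_def fun_eq_iff algebra_simps add_divide_distrib diff_divide_distrib)
    moreover have "clinear_form (cpart (\<lambda>h. B h k))" for k
      by (rule clinear_form_cpart) (auto simp: linear_iff blinfun.add_left blinfun.scaleR_left blinfun.add_right blinfun.scaleR_right)
    ultimately show ?thesis by (simp only: clinear_form_combination)
  qed
  have Sk: "clinear_form (\<lambda>k. cnj (S h k))" for h
  proof -
    have "(\<lambda>k. cnj (S h k)) = (\<lambda>k. 1/4 * cpart (B h) k + \<i>/4 * cpart (B (\<i> *s h)) k)"
      by (simp add: S_def cpart_def fun_eq_iff algebra_simps add_divide_distrib diff_divide_distrib)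
    then show ?thesis by (simp only: clinear_form_combination clinear_form_cpart_blinfun)
  qed
  have Sww: "S w w = levi_form B w / 4" for w
    using C2_symmetric[OF V d1 d2 c, of w "\<i> *s w"] by (simp add: S_def levi_form_def B_def)
  have 2: "(\<Sum>i\<in>UNIV. \<Sum>j\<in>UNIV. dz i (dzbar j (\<lambda>z. complex_of_real (\<rho> z))) p * w $ i * cnj (w $ j)) = levi_form B w / 4" for w
  proof -
    have w: "w = (\<Sum>i\<in>UNIV. w $ i *s axis i 1)" by (simp add: basis_expansion)
    have "S (axis i 1) w = (\<Sum>j\<in>UNIV. S (axis i 1) (axis j 1) * cnj (w $ j))" for i
    proof -
      have "cnj (S (axis i 1) w) = (\<Sum>j\<in>UNIV. w $ j * cnj (S (axis i 1) (axis j 1)))"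
        by (subst w) (simp add: clinear_form_sum[OF Sk] clinear_form_scale[OF Sk])
      then have "cnj (cnj (S (axis i 1) w)) = cnj (\<Sum>j\<in>UNIV. w $ j * cnj (S (axis i 1) (axis j 1)))" by simp
      then show ?thesis by (simp add: mult_ac)
    qed
    moreover have "S w w = (\<Sum>i\<in>UNIV. w $ i * S (axis i 1) w)"
    proof -
      have "S (\<Sum>i\<in>UNIV. w $ i *s axis i 1) w = (\<Sum>i\<in>UNIV. w $ i * S (axis i 1) w)"
        by (simp add: clinear_form_sum[OF Sh] clinear_form_scale[OF Sh])
      then show ?thesis by (simp add: basis_expansion)
    qed
    ultimately show ?thesis
      by (simp add: Sww dzz sum_distrib_left mult_ac)
  qed
  show ?thesis by (simp add: levi_flat_at_def 1 2 B_def)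
qed

subsection \<open>A maximum principle on complex lines\<close>

definition holo_on :: "(complex^'n \<Rightarrow> complex) \<Rightarrow> (complex^'n) set \<Rightarrow> bool" where
  "holo_on h S \<longleftrightarrow> (\<forall>z\<in>S. \<exists>D. (h has_derivative D) (at z) \<and> clinear_form D)"

lemma holo_on_continuous: "holo_on h S \<Longrightarrow> continuous_on S h"
  unfolding holo_on_def
  by (intro continuous_at_imp_continuous_on ballI) (blast dest: has_derivative_continuous)

lemma holo_on_subset: "holo_on h S \<Longrightarrow> T \<subseteq> S \<Longrightarrow> holo_on h T"
  by (auto simp: holo_on_def)

lemma has_derivative_slice:
  "((\<lambda>\<zeta>. z + \<zeta> *s (e :: complex^'n)) has_derivative (\<lambda>k. k *s e)) (at \<zeta> within T)"
  using bounded_linear_imp_has_derivative[OF bounded_linear_vector_scale_left[of e]]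
  by (auto intro!: derivative_eq_intros)

lemma continuous_on_slice: "continuous_on T (\<lambda>\<zeta>. z + \<zeta> *s (e :: complex^'n))"
  unfolding continuous_on_eq_continuous_within
  by (intro ballI has_derivative_continuous[OF has_derivative_slice])

lemma holo_on_slice:
  assumes "holo_on h S" "\<And>\<zeta>. \<zeta> \<in> T \<Longrightarrow> z + \<zeta> *s e \<in> S"
  shows "(\<lambda>\<zeta>. h (z + \<zeta> *s e)) holomorphic_on T"
  unfolding holomorphic_on_def
proof
  fix \<zeta> assume "\<zeta> \<in> T"
  then obtain D where D: "(h has_derivative D) (at (z + \<zeta> *s e))" "clinear_form D"
    using assms unfolding holo_on_def by blast
  have "((\<lambda>\<zeta>. h (z + \<zeta> *s e)) has_derivative (\<lambda>k. D (k *s e))) (at \<zeta> within T)"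
    by (rule has_derivative_compose[OF has_derivative_slice D(1)])
  moreover have "(\<lambda>k. D (k *s e)) = (*) (D e)" by (auto simp: clinear_form_scale[OF D(2)] mult.commute)
  ultimately show "(\<lambda>\<zeta>. h (z + \<zeta> *s e)) field_differentiable at \<zeta> within T"
    unfolding field_differentiable_def has_field_derivative_def by metis
qed

lemma open_slice:
  assumes "open S"
  shows "open {\<zeta>. z + \<zeta> *s (e :: complex^'n) \<in> S}"
  using open_vimage[OF assms continuous_on_slice[of UNIV z e]] by (simp add: vimage_def)

text \<open>\<open>Q\<close> need not extend to the frontier. If the bound failed at
  \<open>z\<close>, the superlevel set \<open>U\<close> would have its closure inside
  \<open>W\<close>, and the usual maximum modulus principle on \<open>U\<close> would give a
  contradiction.\<close>

lemma maximum_modulus_limsup: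
  assumes W: "open W" "bounded W" and Q: "Q holomorphic_on W" and z: "z \<in> W"
    and bd: "\<And>\<xi> \<eta>. \<xi> \<in> frontier W \<Longrightarrow> \<eta> > 0 \<Longrightarrow> \<exists>d>0. \<forall>\<zeta>\<in>W \<inter> ball \<xi> d. cmod (Q \<zeta>) \<le> 1 + \<eta>"
  shows "cmod (Q z) \<le> 1"
proof (rule ccontr)
  assume "\<not> cmod (Q z) \<le> 1"
  define \<eta> where "\<eta> = (cmod (Q z) - 1) / 2"
  have \<eta>: "\<eta> > 0" "1 + \<eta> < cmod (Q z)" using \<open>\<not> cmod (Q z) \<le> 1\<close> by (auto simp: \<eta>_def field_simps)
  define U where "U = W \<inter> (\<lambda>\<zeta>. cmod (Q \<zeta>)) -` {1 + \<eta><..}"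
  have cont: "continuous_on W (\<lambda>\<zeta>. cmod (Q \<zeta>))"
    using Q holomorphic_on_imp_continuous_on continuous_on_norm by blast
  have oU: "open U" unfolding U_def
    by (rule continuous_open_preimage[OF cont W(1)]) simp
  have clU: "closure U \<subseteq> W"
  proof
    fix \<xi> assume \<xi>: "\<xi> \<in> closure U"
    show "\<xi> \<in> W"
    proof (rule ccontr)
      assume "\<xi> \<notin> W"
      moreover have "\<xi> \<in> closure W" using \<xi> closure_mono[of U W] by (auto simp: U_def)
      ultimately have "\<xi> \<in> frontier W" using W(1) by (simp add: frontier_def interior_open)
      then obtain d where d: "d > 0" "\<forall>\<zeta>\<in>W \<inter> ball \<xi> d. cmod (Q \<zeta>) \<le> 1 + \<eta>" using bd \<eta> by blast
      obtain \<zeta> where "\<zeta> \<in> U" "dist \<zeta> \<xi> < d" using \<xi> d(1) closure_approachable by metis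
      then show False using d(2) by (force simp: U_def dist_commute)
    qed
  qed
  have "cmod (Q z) \<le> 1 + \<eta>"
  proof (rule maximum_modulus_frontier[of Q U])
    show "Q holomorphic_on interior U" by (rule holomorphic_on_subset[OF Q]) (use oU in \<open>auto simp only: U_def interior_open\<close>)
    show "continuous_on (closure U) Q" using Q clU holomorphic_on_imp_continuous_on continuous_on_subset by blast
    show "bounded U" using W(2) bounded_subset by (auto simp: U_def)
    show "cmod (Q \<xi>) \<le> 1 + \<eta>" if "\<xi> \<in> frontier U" for \<xi>
    proof -
      have "\<xi> \<in> W" "\<xi> \<notin> U" using that clU oU by (auto simp: frontier_def interior_open)
      then show ?thesis by (auto simp: U_def)
    qed
    show "z \<in> U" using z \<eta> by (simp add: U_def)
  qed
  then show False using \<eta> by simp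
qed

text \<open>One-sided: the limsup of \<open>Re h\<close> along \<open>A\<close> at \<open>y\<close>
  is at most 0. It holds automatically where \<open>A\<close> does not accumulate, which hides the
  parts of the frontier that \<open>f\<close> sends elsewhere.\<close>

definition vanishes_at :: "(complex^'n) set \<Rightarrow> (complex^'n \<Rightarrow> complex) \<Rightarrow> complex^'n \<Rightarrow> bool" where
  "vanishes_at A h y \<longleftrightarrow> (\<forall>\<eta>>0. \<exists>d>0. \<forall>z\<in>A \<inter> ball y d. Re (h z) < \<eta>)"

definition tends_to_zero_at :: "(complex^'n) set \<Rightarrow> (complex^'n \<Rightarrow> complex) \<Rightarrow> complex^'n \<Rightarrow> bool" where
  "tends_to_zero_at A F y \<longleftrightarrow> (\<forall>\<eta>>0. \<exists>d>0. \<forall>z\<in>A \<inter> ball y d. cmod (F z) < \<eta>)"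

text \<open>\<open>G\<close> is \<open>(1 + \<beta>/R)^2 - 1\<close>. On the arc
  \<open>x^2 + y^2 = 1\<close> its real part is \<open>2 x (x + 1) - 1\<close>. So \<open>c0\<close>
  times \<open>G\<close> offsets a quantity bounded by \<open>c0\<close> on the arc, costs nothing
  at \<open>\<beta> = 0\<close>, and, being holomorphic, can be put into an exponent.\<close>

lemma half_disc_barrier:
  fixes R :: real and \<beta> :: complex
  assumes R: "R > 0" and re: "Re \<beta> \<le> 0" and m: "cmod \<beta> \<le> R"
  defines "G \<equiv> (\<beta> / of_real R)\<^sup>2 + 2 * (\<beta> / of_real R)"
  shows "Re G \<le> 0" and "cmod \<beta> = R \<Longrightarrow> Re G \<le> - 1"
proof -
  define x where "x = Re \<beta> / R"
  define y where "y = Im \<beta> / R"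
  have xy: "x\<^sup>2 + y\<^sup>2 = (cmod \<beta> / R)\<^sup>2"
    unfolding x_def y_def by (simp add: cmod_power2 power_divide add_divide_distrib)
  have x0: "x \<le> 0" using R re by (simp add: x_def divide_nonpos_pos)
  have x1: "-1 \<le> x" using R m abs_Re_le_cmod[of \<beta>] by (simp add: x_def field_simps)
  have G: "Re G = x\<^sup>2 - y\<^sup>2 + 2 * x"
    unfolding G_def x_def y_def by (simp add: power2_eq_square diff_divide_distrib)
  have "x * (x + 2) \<le> 0" using x0 x1 by (simp add: mult_nonpos_nonneg)
  then have "x\<^sup>2 + 2 * x \<le> 0" by (simp add: power2_eq_square algebra_simps)
  then show "Re G \<le> 0" unfolding G using zero_le_power2[of y] by linarith
  show "Re G \<le> - 1" if "cmod \<beta> = R"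
  proof -
    have "x\<^sup>2 + y\<^sup>2 = 1" using xy that R by simp
    moreover have "x * (x + 1) \<le> 0" using x0 x1 by (simp add: mult_nonpos_nonneg)
    ultimately show ?thesis unfolding G by (simp add: power2_eq_square algebra_simps)
  qed
qed

text \<open>On the slice through \<open>z1\<close> in direction \<open>e\<close>, apply the maximum
  principle to \<open>exp (N (h + c0 G)) F / C\<close>. Its boundary has three parts: the arc
  \<open>|\<beta>| = R\<close>, where the barrier offsets \<open>Re h \<le> c0\<close>; points of
  \<open>\<Omega> - A\<close>, where \<open>h\<close> vanishes in the limsup sense; and frontier
  points of \<open>\<Omega>\<close>, where \<open>h\<close> or \<open>F\<close> does. Letting
  \<open>N\<close> grow at fixed \<open>z1\<close> with \<open>F z1 \<noteq> 0\<close> leaves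
  \<open>Re h \<le> - c0 Re G\<close>, whose right side tends to 0 at \<open>z0\<close>.\<close>

lemma barrier_estimate:
  fixes h F b :: "complex^'n \<Rightarrow> complex" and e z0 :: "complex^'n"
  assumes \<Omega>: "open \<Omega>" and A: "open A" "A \<subseteq> \<Omega>" and h: "holo_on h A"
    and c0: "c0 > 0" "\<And>z. z \<in> A \<Longrightarrow> Re (h z) \<le> c0"
    and inner: "\<And>y. y \<in> \<Omega> - A \<Longrightarrow> vanishes_at A h y"
    and b: "clinear_form b" "\<And>y. y \<in> \<Omega> \<Longrightarrow> Re (b (y - z0)) < 0" and be: "b e = 1"
    and r: "r > 0" and F: "holo_on F (A \<inter> ball z0 r)"
    and C: "C > 0" "\<And>z. z \<in> A \<inter> ball z0 r \<Longrightarrow> cmod (F z) \<le> C"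
    and slice_boundary: "\<And>z \<zeta>. z \<in> \<Omega> \<inter> ball z0 r \<Longrightarrow> z + \<zeta> *s e \<in> frontier \<Omega> \<inter> ball z0 r \<Longrightarrow>
      vanishes_at A h (z + \<zeta> *s e) \<or> tends_to_zero_at A F (z + \<zeta> *s e)"
  shows "\<forall>\<eta>>0. \<exists>d>0. \<forall>z\<in>A \<inter> ball z0 d. F z \<noteq> 0 \<longrightarrow> Re (h z) < \<eta>"
proof -
  obtain K where K: "K > 0" "\<And>v. cmod (b v) \<le> norm v * K"
    using bounded_linear.pos_bounded[OF clinear_form_bounded_linear[OF b(1)]] by blast
  define k where "k = norm e + 1"
  have k: "k > 0" by (simp add: k_def add_nonneg_pos)
  \<comment> \<open>\<open>|\<beta>| \<le> R\<close> forces \<open>|\<zeta>| \<le> 2 R\<close>, a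
    displacement of at most \<open>r / 2\<close>. With \<open>d0 \<le> r / 4\<close> the slice stays
    in \<open>ball z0 r\<close>, and \<open>d0 \<le> R / K\<close> puts \<open>\<zeta> = 0\<close>
    inside the disc.\<close>
  define R where "R = r / (4 * k)"
  have R: "R > 0" unfolding R_def using r k by simp
  have Re4: "2 * R * norm e \<le> r / 2"
  proof -
    have "2 * R * norm e \<le> 2 * R * k" using R by (simp add: k_def)
    also have "\<dots> = r / 2" unfolding R_def using k by (simp add: field_simps)
    finally show ?thesis .
  qed
  define d0 where "d0 = min (r / 4) (R / K)"
  have d0: "d0 > 0" using r R K by (simp add: d0_def)
  define G where "G \<beta> = (\<beta> / of_real R)\<^sup>2 + 2 * (\<beta> / of_real R)" for \<beta> :: complex
  have G_cont: "isCont G \<beta>" for \<beta> unfolding G_def using R by (intro continuous_intros) auto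
  have key: "Re (h z1) \<le> - c0 * Re (G (b (z1 - z0)))"
    if z1: "z1 \<in> A" "dist z1 z0 < d0" and F1: "F z1 \<noteq> 0" for z1
  proof -
    define \<beta> where "\<beta> \<zeta> = b (z1 - z0) + \<zeta>" for \<zeta>
    have \<beta>_eq: "\<beta> \<zeta> = b (z1 + \<zeta> *s e - z0)" for \<zeta>
      using clinear_form_add[OF b(1), of "z1 - z0" "\<zeta> *s e"]
      by (simp add: \<beta>_def clinear_form_scale[OF b(1)] be algebra_simps)
    have b1: "cmod (b (z1 - z0)) < R"
    proof -
      have "norm (z1 - z0) < R / K" using z1(2) by (simp add: d0_def dist_norm)
      then have "norm (z1 - z0) * K < R" using K by (simp add: field_simps)
      then show ?thesis using K(2)[of "z1 - z0"] by linarith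
    qed
    have near: "z1 + \<zeta> *s e \<in> ball z0 r" if "cmod (\<beta> \<zeta>) \<le> R" for \<zeta>
    proof -
      have "\<zeta> = \<beta> \<zeta> - b (z1 - z0)" by (simp add: \<beta>_def)
      then have "cmod \<zeta> \<le> 2 * R" using that b1 norm_triangle_ineq4[of "\<beta> \<zeta>" "b (z1 - z0)"] by simp
      then have "norm (\<zeta> *s e) \<le> r / 2" using Re4 mult_right_mono[of "cmod \<zeta>" "2 * R" "norm e"] by (simp add: norm_vector_scale)
      moreover have "norm (z1 - z0) < r / 4" using z1(2) by (simp add: d0_def dist_norm)
      moreover have "norm (z1 + \<zeta> *s e - z0) \<le> norm (z1 - z0) + norm (\<zeta> *s e)"
        using norm_triangle_ineq[of "z1 - z0" "\<zeta> *s e"] by (simp add: algebra_simps)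
      ultimately show ?thesis using r by (simp add: dist_norm norm_minus_commute[of z0])
    qed
    define W where "W = {\<zeta>. z1 + \<zeta> *s e \<in> A} \<inter> \<beta> -` ball 0 R"
    have oW: "open W" unfolding W_def
      by (intro open_Int open_slice[OF A(1)] open_vimage) (auto simp: \<beta>_def intro!: continuous_intros)
    have bW: "bounded W"
    proof (rule boundedI)
      fix \<zeta> assume "\<zeta> \<in> W"
      then show "norm \<zeta> \<le> 2 * R" using b1 norm_triangle_ineq4[of "\<beta> \<zeta>" "b (z1 - z0)"] by (simp add: W_def \<beta>_def)
    qed
    have zW: "0 \<in> W" using z1(1) b1 by (simp add: W_def \<beta>_def)
    have Wsub: "z1 + \<zeta> *s e \<in> A \<inter> ball z0 r" if "\<zeta> \<in> W" for \<zeta> using that near by (simp add: W_def)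
    have cl: "Re (\<beta> \<zeta>) \<le> 0" "cmod (\<beta> \<zeta>) \<le> R" "z1 + \<zeta> *s e \<in> closure A" if \<zeta>: "\<zeta> \<in> closure W" for \<zeta>
    proof -
      have "closure W \<subseteq> {\<zeta>. Re (\<beta> \<zeta>) \<le> 0} \<inter> {\<zeta>. cmod (\<beta> \<zeta>) \<le> R}"
      proof (rule closure_minimal)
        show "W \<subseteq> {\<zeta>. Re (\<beta> \<zeta>) \<le> 0} \<inter> {\<zeta>. cmod (\<beta> \<zeta>) \<le> R}"
          using b(2) A(2) by (force simp: W_def \<beta>_eq intro: less_imp_le)
        show "closed ({\<zeta>. Re (\<beta> \<zeta>) \<le> 0} \<inter> {\<zeta>. cmod (\<beta> \<zeta>) \<le> R})"
          unfolding \<beta>_def by (intro closed_Int closed_Collect_le continuous_intros)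
      qed
      then show "Re (\<beta> \<zeta>) \<le> 0" "cmod (\<beta> \<zeta>) \<le> R" using \<zeta> by auto
      have "(\<lambda>\<zeta>. z1 + \<zeta> *s e) ` closure W \<subseteq> closure A"
        by (rule image_closure_subset[OF continuous_on_slice]) (use Wsub closure_subset in auto)
      then show "z1 + \<zeta> *s e \<in> closure A" using \<zeta> by blast
    qed
    define t where "t = Re (h z1) + c0 * Re (G (b (z1 - z0)))"
    have growth: "exp (real N * t) * cmod (F z1) \<le> C" for N
    proof -
      define Q where "Q \<zeta> = exp (of_nat N * (h (z1 + \<zeta> *s e) + of_real c0 * G (\<beta> \<zeta>))) * F (z1 + \<zeta> *s e) / of_real C" for \<zeta>
      have normQ: "cmod (Q \<zeta>) = exp (real N * (Re (h (z1 + \<zeta> *s e)) + c0 * Re (G (\<beta> \<zeta>)))) * (cmod (F (z1 + \<zeta> *s e)) / C)" for \<zeta>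
        using C(1) by (simp add: Q_def norm_mult norm_divide)
      have holQ: "Q holomorphic_on W"
      proof -
        have "(\<lambda>\<zeta>. h (z1 + \<zeta> *s e)) holomorphic_on W" by (rule holo_on_slice[OF h]) (use Wsub in auto)
        moreover have "(\<lambda>\<zeta>. F (z1 + \<zeta> *s e)) holomorphic_on W" by (rule holo_on_slice[OF F]) (use Wsub in auto)
        ultimately show ?thesis unfolding Q_def G_def \<beta>_def using R C(1) by (intro holomorphic_intros) auto
      qed
      have FC: "0 \<le> cmod (F (z1 + \<zeta> *s e)) / C" "cmod (F (z1 + \<zeta> *s e)) / C \<le> 1" if "\<zeta> \<in> W" for \<zeta>
        using C Wsub[OF that] by auto
      have Gneg: "Re (G (\<beta> \<zeta>)) \<le> 0" if "\<zeta> \<in> W" for \<zeta>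
        unfolding G_def by (rule half_disc_barrier(1)[OF R]) (use cl closure_subset that in blast)+
      have slice_cont: "isCont (\<lambda>\<zeta>. z1 + \<zeta> *s e) \<xi>" for \<xi>
        using continuous_on_slice[of UNIV z1 e] by (simp add: continuous_on_eq_continuous_at)
      have bd: "\<exists>d>0. \<forall>\<zeta>\<in>W \<inter> ball \<xi> d. cmod (Q \<zeta>) \<le> 1 + \<eta>" if \<xi>: "\<xi> \<in> frontier W" and \<eta>: "\<eta> > 0" for \<xi> \<eta>
      proof -
        have \<xi>W: "\<xi> \<in> closure W" "\<xi> \<notin> W" using \<xi> oW by (auto simp: frontier_def interior_open)
        note cl' = cl[OF \<xi>W(1)]
        define y where "y = z1 + \<xi> *s e"
        have pull: "\<exists>d'>0. \<forall>\<zeta>\<in>W \<inter> ball \<xi> d'. z1 + \<zeta> *s e \<in> A \<inter> ball y d" if "d > 0" for d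
        proof -
          obtain d' where "d' > 0" "\<And>\<zeta>. dist \<zeta> \<xi> < d' \<Longrightarrow> dist (z1 + \<zeta> *s e) y < d"
            using slice_cont[of \<xi>] \<open>d > 0\<close> unfolding continuous_at_eps_delta y_def by metis
          then show ?thesis using Wsub by (intro exI[of _ d']) (auto simp: dist_commute)
        qed
        have van: ?thesis if v: "vanishes_at A h y"
        proof -
          have "\<exists>\<epsilon>>0. exp (real N * \<epsilon>) \<le> 1 + \<eta>"
          proof (intro exI conjI)
            \<comment> \<open>The denominator \<open>real N + 1\<close> also covers
              \<open>N = 0\<close>.\<close>
            show "ln (1 + \<eta>) / (real N + 1) > 0" using \<eta> by simp
            have "real N * (ln (1 + \<eta>) / (real N + 1)) \<le> ln (1 + \<eta>)"
              using \<eta> by (simp add: field_simps)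
            then have "exp (real N * (ln (1 + \<eta>) / (real N + 1))) \<le> exp (ln (1 + \<eta>))" by (simp only: exp_le_cancel_iff)
            also have "\<dots> = 1 + \<eta>" using \<eta> by (intro exp_ln) linarith
            finally show "exp (real N * (ln (1 + \<eta>) / (real N + 1))) \<le> 1 + \<eta>" .
          qed
          then obtain \<epsilon> where \<epsilon>: "\<epsilon> > 0" "exp (real N * \<epsilon>) \<le> 1 + \<eta>" by blast
          obtain d where d: "d > 0" "\<forall>z\<in>A \<inter> ball y d. Re (h z) < \<epsilon>" using v[unfolded vanishes_at_def, rule_format, OF \<epsilon>(1)] by blast
          obtain d' where d': "d' > 0" "\<forall>\<zeta>\<in>W \<inter> ball \<xi> d'. z1 + \<zeta> *s e \<in> A \<inter> ball y d" using pull[OF d(1)] by blast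
          have "cmod (Q \<zeta>) \<le> 1 + \<eta>" if \<zeta>: "\<zeta> \<in> W \<inter> ball \<xi> d'" for \<zeta>
          proof -
            have "Re (h (z1 + \<zeta> *s e)) < \<epsilon>" using d(2) d'(2) \<zeta> by blast
            moreover have "c0 * Re (G (\<beta> \<zeta>)) \<le> 0" using Gneg[of \<zeta>] \<zeta> c0(1) by (simp add: mult_nonneg_nonpos)
            ultimately have "real N * (Re (h (z1 + \<zeta> *s e)) + c0 * Re (G (\<beta> \<zeta>))) \<le> real N * \<epsilon>"
              by (intro mult_left_mono) auto
            then have "cmod (Q \<zeta>) \<le> exp (real N * \<epsilon>) * 1"
              unfolding normQ using FC[of \<zeta>] \<zeta> by (intro mult_mono) auto
            then show ?thesis using \<epsilon>(2) by simp
          qed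
          then show ?thesis using d'(1) by blast
        qed
        show ?thesis
        proof (cases "cmod (\<beta> \<xi>) = R")
          case True
          have G1: "Re (G (\<beta> \<xi>)) \<le> -1" unfolding G_def by (rule half_disc_barrier(2)[OF R cl'(1,2) True])
          have "isCont (\<lambda>\<zeta>. exp (real N * (c0 + c0 * Re (G (\<beta> \<zeta>))))) \<xi>"
            unfolding G_def \<beta>_def using R by (intro continuous_intros) auto
          then obtain d where d: "d > 0" "\<And>\<zeta>. dist \<zeta> \<xi> < d \<Longrightarrow>
             dist (exp (real N * (c0 + c0 * Re (G (\<beta> \<zeta>))))) (exp (real N * (c0 + c0 * Re (G (\<beta> \<xi>))))) < \<eta>"
            using \<eta> unfolding continuous_at_eps_delta by metis
          have "c0 + c0 * Re (G (\<beta> \<xi>)) \<le> 0" using G1 c0(1) mult_left_mono[OF G1, of c0] by simp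
          then have e1: "exp (real N * (c0 + c0 * Re (G (\<beta> \<xi>)))) \<le> 1" by (simp add: mult_nonneg_nonpos)
          have "cmod (Q \<zeta>) \<le> 1 + \<eta>" if \<zeta>: "\<zeta> \<in> W \<inter> ball \<xi> d" for \<zeta>
          proof -
            have "exp (real N * (c0 + c0 * Re (G (\<beta> \<zeta>)))) \<le> 1 + \<eta>"
              using d(2)[of \<zeta>] \<zeta> e1 unfolding dist_real_def Int_iff mem_ball dist_commute[of \<xi>] by linarith
            moreover have "cmod (Q \<zeta>) \<le> exp (real N * (c0 + c0 * Re (G (\<beta> \<zeta>)))) * 1"
              unfolding normQ using FC[of \<zeta>] \<zeta> c0(2) Wsub by (intro mult_mono) (auto intro!: mult_left_mono)
            ultimately show ?thesis by simp
          qed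
          then show ?thesis using d(1) by blast
        next
          case False
          then have "y \<notin> A" using \<xi>W(2) cl'(2) by (auto simp: W_def y_def)
          show ?thesis
          proof (cases "y \<in> \<Omega>")
            case True
            then show ?thesis using inner \<open>y \<notin> A\<close> van by blast
          next
            case False
            have "y \<in> closure \<Omega>" using cl'(3) closure_mono[OF A(2)] by (auto simp: y_def)
            then have "y \<in> frontier \<Omega> \<inter> ball z0 r"
              using False \<Omega> near[OF cl'(2)] by (simp add: frontier_def interior_open y_def)
            moreover have "z1 \<in> \<Omega> \<inter> ball z0 r" using near[of 0] b1 z1(1) A(2) by (auto simp: \<beta>_def)
            ultimately consider "vanishes_at A h y" | "tends_to_zero_at A F y" using slice_boundary y_def by blast
            then show ?thesis
            proof cases
              case 1 then show ?thesis by (rule van)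
            next
              case 2
              \<comment> \<open>\<open>N\<close> is fixed here and the exponential factor is at most
                \<open>exp (N c0)\<close>, so convergence of \<open>F\<close> to 0 outweighs
                it.\<close>
              obtain d where d: "d > 0" "\<forall>z\<in>A \<inter> ball y d. cmod (F z) < C / exp (real N * c0)"
                using 2 C(1) unfolding tends_to_zero_at_def by (metis divide_pos_pos exp_gt_zero)
              obtain d' where d': "d' > 0" "\<forall>\<zeta>\<in>W \<inter> ball \<xi> d'. z1 + \<zeta> *s e \<in> A \<inter> ball y d" using pull[OF d(1)] by blast
              have "cmod (Q \<zeta>) \<le> 1 + \<eta>" if \<zeta>: "\<zeta> \<in> W \<inter> ball \<xi> d'" for \<zeta>
              proof -
                have "cmod (F (z1 + \<zeta> *s e)) < C / exp (real N * c0)" using d(2) d'(2) \<zeta> by blast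
                then have 1: "cmod (F (z1 + \<zeta> *s e)) / C \<le> 1 / exp (real N * c0)" using C(1) by (simp add: field_simps)
                have "c0 * Re (G (\<beta> \<zeta>)) \<le> 0" using Gneg[of \<zeta>] \<zeta> c0(1) by (simp add: mult_nonneg_nonpos)
                then have "real N * (Re (h (z1 + \<zeta> *s e)) + c0 * Re (G (\<beta> \<zeta>))) \<le> real N * c0"
                  using c0(2)[of "z1 + \<zeta> *s e"] Wsub[of \<zeta>] \<zeta> by (intro mult_left_mono) auto
                then have "cmod (Q \<zeta>) \<le> exp (real N * c0) * (1 / exp (real N * c0))"
                  unfolding normQ using 1 FC[of \<zeta>] \<zeta> by (intro mult_mono) auto
                then show ?thesis using \<eta> by simp
              qed
              then show ?thesis using d'(1) by blast
            qed
          qed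
        qed
      qed
      have "cmod (Q 0) \<le> 1" by (rule maximum_modulus_limsup[OF oW bW holQ zW bd])
      then show ?thesis using C(1) by (simp add: normQ t_def \<beta>_def field_simps)
    qed
    have "t \<le> 0"
    proof (rule ccontr)
      assume "\<not> t \<le> 0"
      then have t: "t > 0" by simp
      obtain N :: nat where N: "C / (cmod (F z1) * t) < real N" using reals_Archimedean2 by blast
      have Ft: "cmod (F z1) * t > 0" using F1 t by simp
      have "C < real N * t * cmod (F z1)" using N Ft by (simp add: pos_divide_less_eq mult_ac)
      also have "\<dots> \<le> exp (real N * t) * cmod (F z1)"
        using exp_ge_add_one_self[of "real N * t"] by (intro mult_right_mono) (linarith, simp)
      finally show False using growth[of N] by simp
    qed
    then show ?thesis by (simp add: t_def)
  qed
  show ?thesis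
  proof (intro allI impI)
    fix \<eta> :: real assume \<eta>: "\<eta> > 0"
    have "isCont (\<lambda>z. b (z - z0)) z0"
      by (rule bounded_linear.isCont[OF clinear_form_bounded_linear[OF b(1)]]) (intro continuous_intros)
    then have "isCont (\<lambda>z. - c0 * Re (G (b (z - z0)))) z0"
      unfolding G_def using R by (intro continuous_intros) auto
    then obtain d where d: "d > 0" "\<And>z. dist z z0 < d \<Longrightarrow> dist (- c0 * Re (G (b (z - z0)))) (- c0 * Re (G (b (z0 - z0)))) < \<eta>"
      using \<eta> unfolding continuous_at_eps_delta by metis
    have "Re (h z) < \<eta>" if z: "z \<in> A \<inter> ball z0 (min d d0)" "F z \<noteq> 0" for z
    proof -
      have "Re (h z) \<le> - c0 * Re (G (b (z - z0)))" using key[of z] z by (simp add: dist_commute)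
      also have "\<dots> < \<eta>" using d(2)[of z] z by (simp add: dist_commute clinear_form_zero[OF b(1)] G_def dist_real_def)
      finally show ?thesis .
    qed
    then show "\<exists>d>0. \<forall>z\<in>A \<inter> ball z0 d. F z \<noteq> 0 \<longrightarrow> Re (h z) < \<eta>"
      using d(1) d0 by (intro exI[of _ "min d d0"]) auto
  qed
qed

subsection \<open>Convex domains with locally constant complex supporting directions\<close>

lemma segment_meets_frontier:
  fixes x y :: "'a::real_normed_vector"
  assumes "x \<in> S" "y \<notin> S"
  obtains t :: real where "0 \<le> t" "t \<le> 1" "x + t *\<^sub>R (y - x) \<in> frontier S"
proof -
  have "closed_segment x y \<inter> frontier S \<noteq> {}"
    by (rule connected_Int_frontier) (use assms in auto)
  then obtain t where "0 \<le> t" "t \<le> 1" "(1 - t) *\<^sub>R x + t *\<^sub>R y \<in> frontier S"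
    by (auto simp: in_segment)
  moreover have "(1 - t) *\<^sub>R x + t *\<^sub>R y = x + t *\<^sub>R (y - x)" by (simp add: algebra_simps)
  ultimately show ?thesis using that by metis
qed

text \<open>That the kernels are locally constant is what Levi flatness gives for a convex domain.\<close>

locale flat_support =
  fixes \<Omega> :: "(complex^'n) set" and Act :: "complex^'n \<Rightarrow> nat set" and a :: "nat \<Rightarrow> complex^'n \<Rightarrow> complex^'n \<Rightarrow> complex"
  assumes opn: "open \<Omega>" and ne: "\<Omega> \<noteq> {}"
    and fin: "\<And>z. z \<in> frontier \<Omega> \<Longrightarrow> finite (Act z)"
    and act: "\<And>z. z \<in> frontier \<Omega> \<Longrightarrow> Act z \<noteq> {}"
    and lin: "\<And>z i. z \<in> frontier \<Omega> \<Longrightarrow> i \<in> Act z \<Longrightarrow> clinear_form (a i z)"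
    and supp: "\<And>z i y. z \<in> frontier \<Omega> \<Longrightarrow> i \<in> Act z \<Longrightarrow> y \<in> \<Omega> \<Longrightarrow> Re (a i z (y - z)) < 0"
    and loc: "\<And>z. z \<in> frontier \<Omega> \<Longrightarrow> \<exists>r>0. \<forall>y\<in>frontier \<Omega> \<inter> ball z r. Act y \<subseteq> Act z \<and>
                (\<forall>i\<in>Act y. \<forall>w. a i y w = 0 \<longleftrightarrow> a i z w = 0)"
begin

definition kern :: "nat \<Rightarrow> complex^'n \<Rightarrow> (complex^'n) set" where
  "kern i z = {w. a i z w = 0}"

text \<open>A set of kernels rather than of indices, so that active indices with the same kernel
  count once. Its cardinality is the induction parameter in
  \<open>vanishes_at_frontier\<close>.\<close>

definition dirs :: "complex^'n \<Rightarrow> (complex^'n) set set" where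
  "dirs z = (\<lambda>i. kern i z) ` Act z"

lemma finite_dirs: "z \<in> frontier \<Omega> \<Longrightarrow> finite (dirs z)"
  by (simp add: dirs_def fin)

lemma dirs_local:
  assumes "z \<in> frontier \<Omega>"
  obtains r where "r > 0" "\<And>y. y \<in> frontier \<Omega> \<inter> ball z r \<Longrightarrow> dirs y \<subseteq> dirs z"
proof -
  obtain r where r: "r > 0" "\<forall>y\<in>frontier \<Omega> \<inter> ball z r. Act y \<subseteq> Act z \<and>
                (\<forall>i\<in>Act y. \<forall>w. a i y w = 0 \<longleftrightarrow> a i z w = 0)" using loc[OF assms] by blast
  have "dirs y \<subseteq> dirs z" if "y \<in> frontier \<Omega> \<inter> ball z r" for y
  proof
    fix K assume "K \<in> dirs y"
    then obtain i where i: "i \<in> Act y" "K = kern i y" by (auto simp: dirs_def)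
    then have "i \<in> Act z" "K = kern i z" using r(2) that by (auto simp: kern_def)
    then show "K \<in> dirs z" by (simp add: dirs_def)
  qed
  then show ?thesis using r(1) that by blast
qed

text \<open>A supporting form is constant along its own kernel, but strictly smaller on
  \<open>\<Omega>\<close> than at the boundary point. So moving from \<open>\<Omega>\<close> in a
  kernel direction never reaches a boundary point having that kernel.\<close>

lemma frontier_slice_not_kern:
  assumes y: "y \<in> frontier \<Omega>" and z: "z \<in> \<Omega>" and K: "K \<in> dirs y" and e: "y = z + \<zeta> *s e"
  shows "e \<notin> K"
proof
  assume "e \<in> K"
  obtain i where i: "i \<in> Act y" "K = kern i y" using K by (auto simp: dirs_def)
  note l = lin[OF y i(1)]
  have "z - y = (- \<zeta>) *s e" using e by simp
  then have "a i y (z - y) = 0" using \<open>e \<in> K\<close> i(2) clinear_form_scale[OF l, of "- \<zeta>" e] by (simp add: kern_def)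
  then show False using supp[OF y i(1) z] by simp
qed

text \<open>A disc leaving \<open>\<Omega>\<close> would cross the frontier near \<open>z0\<close>,
  where every point has the single direction \<open>K\<close>; this is excluded by
  \<open>frontier_slice_not_kern\<close>. Halving the radius keeps the crossing point in the
  neighbourhood given by \<open>dirs_local\<close>.\<close>

lemma disc_in_domain:
  assumes z0: "z0 \<in> frontier \<Omega>" and K: "dirs z0 = {K}" and e: "e \<in> K"
  obtains r where "r > 0" "\<And>z \<xi>. z \<in> \<Omega> \<inter> ball z0 r \<Longrightarrow> norm (\<xi> *s e) < r \<Longrightarrow> z + \<xi> *s e \<in> \<Omega>"
proof -
  obtain r where r: "r > 0" "\<And>y. y \<in> frontier \<Omega> \<inter> ball z0 r \<Longrightarrow> dirs y \<subseteq> dirs z0" using dirs_local[OF z0] by blast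
  have dirs_y: "dirs y = {K}" if "y \<in> frontier \<Omega> \<inter> ball z0 r" for y
    using r(2)[OF that] K act[of y] that by (auto simp: dirs_def)
  have "z + \<xi> *s e \<in> \<Omega>" if z: "z \<in> \<Omega> \<inter> ball z0 (r / 2)" and \<xi>: "norm (\<xi> *s e) < r / 2" for z \<xi>
  proof (rule ccontr)
    assume "z + \<xi> *s e \<notin> \<Omega>"
    then obtain t :: real where t: "0 \<le> t" "t \<le> 1" "z + t *\<^sub>R (\<xi> *s e) \<in> frontier \<Omega>"
      using segment_meets_frontier[of z \<Omega> "z + \<xi> *s e"] z by auto
    define y where "y = z + (of_real t * \<xi>) *s e"
    have y: "y \<in> frontier \<Omega>" using t(3) by (simp add: y_def scaleR_vector_scale vector_smult_assoc)
    have "norm ((of_real t * \<xi>) *s e) = \<bar>t\<bar> * norm (\<xi> *s e)" by (simp add: norm_vector_scale norm_mult)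
    also have "\<dots> \<le> norm (\<xi> *s e)" using t by (simp add: mult_left_le_one_le)
    finally have "norm (y - z) < r / 2" using \<xi> by (simp add: y_def)
    moreover have "dist z0 y \<le> dist z0 z + norm (y - z)" using dist_triangle[of z0 y z] by (simp add: dist_norm norm_minus_commute)
    ultimately have "y \<in> ball z0 r" using z by simp
    then show False using frontier_slice_not_kern[OF y, of z K _ e] dirs_y y z e y_def by blast
  qed
  then show ?thesis using that[of "r / 2"] r(1) by auto
qed

section \<open>Propagation of the limsup bound along the frontier\<close>

context
  fixes A :: "(complex^'n) set" and h :: "complex^'n \<Rightarrow> complex" and c0 :: real
  assumes A: "open A" "A \<subseteq> \<Omega>" and h: "holo_on h A"
    and c0: "c0 > 0" "\<And>z. z \<in> A \<Longrightarrow> Re (h z) \<le> c0"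
    and inner: "\<And>y. y \<in> \<Omega> - A \<Longrightarrow> vanishes_at A h y"
begin

text \<open>\<open>barrier_estimate\<close> controls \<open>h\<close> only where the auxiliary
  function is nonzero. A finite family without common zeros covers all of \<open>A\<close> near
  \<open>z0\<close>; in the application it consists of the components of one vector-valued
  difference.\<close>

lemma vanishes_at_single_direction:
  fixes F :: "'j \<Rightarrow> complex^'n \<Rightarrow> complex"
  assumes z0: "z0 \<in> frontier \<Omega>" and r: "r > 0" and J: "finite J"
    and F: "\<And>j. j \<in> J \<Longrightarrow> holo_on (F j) (A \<inter> ball z0 r)"
    and C: "C > 0" "\<And>j z. j \<in> J \<Longrightarrow> z \<in> A \<inter> ball z0 r \<Longrightarrow> cmod (F j z) \<le> C"
    and zero: "\<And>j y. j \<in> J \<Longrightarrow> y \<in> frontier \<Omega> \<inter> ball z0 r \<Longrightarrow> tends_to_zero_at A (F j) y"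
    and nz: "\<And>z. z \<in> A \<inter> ball z0 r \<Longrightarrow> \<exists>j\<in>J. F j z \<noteq> 0"
  shows "vanishes_at A h z0"
  unfolding vanishes_at_def
proof (intro allI impI)
  fix \<eta> :: real assume \<eta>: "\<eta> > 0"
  obtain i where i: "i \<in> Act z0" using act[OF z0] by blast
  obtain y0 where y0: "y0 \<in> \<Omega>" using ne by blast
  define b where "b = a i z0"
  have b: "clinear_form b" "\<And>y. y \<in> \<Omega> \<Longrightarrow> Re (b (y - z0)) < 0" using lin[OF z0 i] supp[OF z0 i] by (simp_all add: b_def)
  \<comment> \<open>Any direction on which the supporting form is nonzero would do; the one towards
    a point of \<open>\<Omega>\<close> certainly qualifies, and it is normalised to
    \<open>b e = 1\<close>.\<close>
  define e where "e = (1 / b (y0 - z0)) *s (y0 - z0)"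
  have "b (y0 - z0) \<noteq> 0" using b(2)[OF y0] by auto
  then have be: "b e = 1" unfolding e_def clinear_form_scale[OF b(1)] by simp
  have "\<forall>j\<in>J. \<exists>d>0. \<forall>z\<in>A \<inter> ball z0 d. F j z \<noteq> 0 \<longrightarrow> Re (h z) < \<eta>"
  proof
    fix j assume j: "j \<in> J"
    have "\<forall>\<eta>>0. \<exists>d>0. \<forall>z\<in>A \<inter> ball z0 d. F j z \<noteq> 0 \<longrightarrow> Re (h z) < \<eta>"
      by (rule barrier_estimate[OF opn A h c0 inner b be r F[OF j] C(1) C(2)[OF j]]) (use zero[OF j] in blast)+
    then show "\<exists>d>0. \<forall>z\<in>A \<inter> ball z0 d. F j z \<noteq> 0 \<longrightarrow> Re (h z) < \<eta>" using \<eta> by blast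
  qed
  then obtain d where d: "\<And>j. j \<in> J \<Longrightarrow> d j > 0" "\<And>j z. j \<in> J \<Longrightarrow> z \<in> A \<inter> ball z0 (d j) \<Longrightarrow> F j z \<noteq> 0 \<Longrightarrow> Re (h z) < \<eta>"
    by metis
  define D where "D = Min (insert r (d ` J))"
  have D: "D > 0" "D \<le> r" "\<And>j. j \<in> J \<Longrightarrow> D \<le> d j" using J d(1) r by (auto simp: D_def)
  have "Re (h z) < \<eta>" if z: "z \<in> A \<inter> ball z0 D" for z
  proof -
    obtain j where j: "j \<in> J" "F j z \<noteq> 0" using nz[of z] z D(2) by auto
    then show ?thesis using d(2)[of j z] D(3)[of j] z by auto
  qed
  then show "\<exists>d>0. \<forall>z\<in>A \<inter> ball z0 d. Re (h z) < \<eta>" using D(1) by blast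
qed

text \<open>With two distinct kernels at \<open>z0\<close>, take \<open>e\<close> in one and outside
  the other. Slices along \<open>e\<close> miss every frontier point that has the first kernel, so
  nearby they end at points with fewer directions, where the claim is known. The form of the second
  kernel is nonzero on \<open>e\<close> and supplies the barrier; the auxiliary function is the
  constant 1.\<close>

lemma vanishes_at_frontier:
  assumes single: "\<And>z K. z \<in> frontier \<Omega> \<Longrightarrow> dirs z = {K} \<Longrightarrow> vanishes_at A h z"
    and z0: "z0 \<in> frontier \<Omega>"
  shows "vanishes_at A h z0"
  using z0
proof (induction "card (dirs z0)" arbitrary: z0 rule: less_induct)
  case less
  show ?case
  proof (cases "\<exists>K. dirs z0 = {K}")
    case True
    then show ?thesis using single less.prems by blast
  next
    case False
    obtain i where i: "i \<in> Act z0" using act[OF less.prems] by blast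
    have "dirs z0 \<noteq> {kern i z0}" using False by blast
    then obtain K where "K \<in> dirs z0" "K \<noteq> kern i z0" using i by (auto simp: dirs_def)
    then obtain i' where i': "i' \<in> Act z0" "kern i z0 \<noteq> kern i' z0" by (auto simp: dirs_def)
    have "\<exists>i1\<in>Act z0. \<exists>i2\<in>Act z0. \<exists>e'\<in>kern i1 z0. e' \<notin> kern i2 z0"
    proof (cases "kern i z0 \<subseteq> kern i' z0")
      case True
      then obtain e' where "e' \<in> kern i' z0" "e' \<notin> kern i z0" using i'(2) by blast
      then show ?thesis using i i'(1) by blast
    next
      case False
      then show ?thesis using i i'(1) by blast
    qed
    then obtain i1 i2 e' where *: "i1 \<in> Act z0" "i2 \<in> Act z0" "e' \<in> kern i1 z0" "e' \<notin> kern i2 z0" by blast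
    define b where "b = a i2 z0"
    have b: "clinear_form b" "\<And>y. y \<in> \<Omega> \<Longrightarrow> Re (b (y - z0)) < 0"
      using lin[OF less.prems *(2)] supp[OF less.prems *(2)] by (simp_all add: b_def)
    define e where "e = (1 / b e') *s e'"
    have "b e' \<noteq> 0" using *(4) by (simp add: kern_def b_def)
    then have be: "b e = 1" unfolding e_def clinear_form_scale[OF b(1)] by simp
    have ek: "e \<in> kern i1 z0" using *(3) clinear_form_scale[OF lin[OF less.prems *(1)]] by (simp add: e_def kern_def)
    obtain r where r: "r > 0" "\<And>y. y \<in> frontier \<Omega> \<inter> ball z0 r \<Longrightarrow> dirs y \<subseteq> dirs z0" using dirs_local[OF less.prems] by blast
    have slice: "vanishes_at A h (z + \<zeta> *s e)"
      if z: "z \<in> \<Omega> \<inter> ball z0 r" and y: "z + \<zeta> *s e \<in> frontier \<Omega> \<inter> ball z0 r" for z \<zeta>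
    proof -
      have "kern i1 z0 \<notin> dirs (z + \<zeta> *s e)" using frontier_slice_not_kern[of "z + \<zeta> *s e" z _ \<zeta> e] z y ek by blast
      moreover have "kern i1 z0 \<in> dirs z0" using *(1) by (simp add: dirs_def)
      ultimately have "dirs (z + \<zeta> *s e) \<subset> dirs z0" using r(2)[OF y] by blast
      then have "card (dirs (z + \<zeta> *s e)) < card (dirs z0)" using finite_dirs[OF less.prems] psubset_card_mono by blast
      then show ?thesis using less.hyps y by blast
    qed
    have one: "holo_on (\<lambda>_. 1) (A \<inter> ball z0 r)" unfolding holo_on_def
      by (auto intro!: exI[of _ "\<lambda>_. 0"] derivative_eq_intros clinear_formI)
    have "\<forall>\<eta>>0. \<exists>d>0. \<forall>z\<in>A \<inter> ball z0 d. (1 :: complex) \<noteq> 0 \<longrightarrow> Re (h z) < \<eta>"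
      by (rule barrier_estimate[OF opn A h c0 inner b be r(1) one zero_less_one]) (use slice in auto)
    then show ?thesis by (simp add: vanishes_at_def)
  qed
qed

text \<open>On a slice of \<open>A\<close> the function \<open>exp h\<close> has boundary limsup of
  modulus at most 1 everywhere, since points of \<open>\<Omega> - A\<close> are covered by
  \<open>inner\<close>. Hence \<open>Re h \<le> 0\<close>, against \<open>pos\<close>.\<close>

lemma empty_if_vanishes_at_frontier:
  assumes van: "\<And>z. z \<in> frontier \<Omega> \<Longrightarrow> vanishes_at A h z" and bdd: "bounded \<Omega>"
    and pos: "\<And>z. z \<in> A \<Longrightarrow> Re (h z) > 0"
  shows "A = {}"
proof (rule ccontr)
  assume "A \<noteq> {}"
  then obtain z where z: "z \<in> A" by blast
  \<comment> \<open>\<open>undefined\<close> merely selects some coordinate; any unit vector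
    serves.\<close>
  define e :: "complex^'n" where "e = axis undefined 1"
  have e: "norm e = 1" by (simp add: e_def)
  define W where "W = {\<zeta>. z + \<zeta> *s e \<in> A}"
  obtain M where M: "\<And>x. x \<in> \<Omega> \<Longrightarrow> norm x \<le> M" using bdd bounded_iff by blast
  have W: "open W" unfolding W_def by (rule open_slice[OF A(1)])
  have bW: "bounded W"
  proof (rule boundedI)
    fix \<zeta> assume "\<zeta> \<in> W"
    then have "norm (z + \<zeta> *s e) \<le> M" "norm z \<le> M" using M A(2) z by (auto simp: W_def)
    then have "norm (\<zeta> *s e) \<le> 2 * M" using norm_triangle_ineq4[of "z + \<zeta> *s e" z] by simp
    then show "norm \<zeta> \<le> 2 * M" by (simp add: norm_vector_scale e)
  qed
  have "cmod (exp (h (z + 0 *s e))) \<le> 1"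
  proof (rule maximum_modulus_limsup[OF W bW, of "\<lambda>\<zeta>. exp (h (z + \<zeta> *s e))"])
    have "(\<lambda>\<zeta>. h (z + \<zeta> *s e)) holomorphic_on W" by (rule holo_on_slice[OF h]) (simp add: W_def)
    then show "(\<lambda>\<zeta>. exp (h (z + \<zeta> *s e))) holomorphic_on W" by (intro holomorphic_intros)
    show "0 \<in> W" using z by (simp add: W_def)
    fix \<xi> and \<eta> :: real assume \<xi>: "\<xi> \<in> frontier W" and \<eta>: "\<eta> > 0"
    define y where "y = z + \<xi> *s e"
    have "\<xi> \<in> closure W" "\<xi> \<notin> W" using \<xi> W by (auto simp: frontier_def interior_open)
    have "(\<lambda>\<zeta>. z + \<zeta> *s e) ` closure W \<subseteq> closure A"
      by (rule image_closure_subset[OF continuous_on_slice]) (use closure_subset in \<open>auto simp: W_def\<close>)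
    then have "y \<in> closure \<Omega>" using \<open>\<xi> \<in> closure W\<close> closure_mono[OF A(2)] by (auto simp: y_def)
    moreover have "y \<notin> A" using \<open>\<xi> \<notin> W\<close> by (simp add: W_def y_def)
    ultimately have "vanishes_at A h y" using inner van opn by (cases "y \<in> \<Omega>") (auto simp: frontier_def interior_open)
    moreover have "ln (1 + \<eta>) > 0" using \<eta> by simp
    ultimately obtain d where d: "d > 0" "\<forall>z\<in>A \<inter> ball y d. Re (h z) < ln (1 + \<eta>)" unfolding vanishes_at_def by blast
    have "isCont (\<lambda>\<zeta>. z + \<zeta> *s e) \<xi>" using continuous_on_slice[of UNIV z e] by (simp add: continuous_on_eq_continuous_at)
    then obtain d' where d': "d' > 0" "\<And>\<zeta>. dist \<zeta> \<xi> < d' \<Longrightarrow> dist (z + \<zeta> *s e) y < d"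
      using d(1) unfolding continuous_at_eps_delta y_def by metis
    have "cmod (exp (h (z + \<zeta> *s e))) \<le> 1 + \<eta>" if \<zeta>: "\<zeta> \<in> W \<inter> ball \<xi> d'" for \<zeta>
    proof -
      have "Re (h (z + \<zeta> *s e)) < ln (1 + \<eta>)" using d(2) d'(2)[of \<zeta>] \<zeta> by (auto simp: W_def dist_commute)
      then have "exp (Re (h (z + \<zeta> *s e))) < exp (ln (1 + \<eta>))" by (simp only: exp_less_cancel_iff)
      then show ?thesis using \<eta> by simp
    qed
    then show "\<exists>d>0. \<forall>\<zeta>\<in>W \<inter> ball \<xi> d. cmod (exp (h (z + \<zeta> *s e))) \<le> 1 + \<eta>" using d'(1) by blast
  qed
  then show False using pos[OF z] by simp
qed

end

end

subsection \<open>Strictly pseudoconvex boundary points\<close>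

text \<open>Both vectors are annihilated by the nonzero row \<open>(a1, a2)\<close>, so their
  determinant is zero. This is where one vector comes to represent the whole complex tangent
  space.\<close>

lemma clinear_form_kernel_2:
  fixes A :: "complex^2 \<Rightarrow> complex"
  assumes A: "clinear_form A" and x: "A x \<noteq> 0" and w: "A w = 0" "w \<noteq> 0" and h: "A h = 0"
  obtains \<alpha> where "h = \<alpha> *s w"
proof -
  define a1 a2 where "a1 = A (axis 1 1)" and "a2 = A (axis 2 1)"
  have rep: "A v = v $ 1 * a1 + v $ 2 * a2" for v
  proof -
    have "A (\<Sum>i\<in>UNIV. v $ i *s axis i 1) = v $ 1 * a1 + v $ 2 * a2"
      unfolding clinear_form_sum[OF A] clinear_form_scale[OF A] a1_def a2_def by (simp add: sum_2)
    then show ?thesis by (simp only: basis_expansion)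
  qed
  have hw: "h $ 1 * a1 + h $ 2 * a2 = 0" "w $ 1 * a1 + w $ 2 * a2 = 0" using h w rep by auto
  have "a1 \<noteq> 0 \<or> a2 \<noteq> 0" using x rep[of x] by auto
  moreover have "a1 * (h $ 1 * w $ 2 - h $ 2 * w $ 1) = 0" "a2 * (h $ 1 * w $ 2 - h $ 2 * w $ 1) = 0"
    using hw by algebra+
  ultimately have det: "h $ 1 * w $ 2 = h $ 2 * w $ 1" by auto
  show ?thesis
  proof (cases "w $ 1 = 0")
    case False
    then show ?thesis using det by (intro that[of "h $ 1 / w $ 1"]) (simp add: vec_eq_iff forall_2 field_simps)
  next
    case True
    then have "w $ 2 \<noteq> 0" using w(2) by (simp add: vec_eq_iff forall_2)
    then show ?thesis using det True by (intro that[of "h $ 2 / w $ 2"]) (simp add: vec_eq_iff forall_2 field_simps)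
  qed
qed

lemma levi_form_scale: "levi_form B (\<alpha> *s h) = (cmod \<alpha>)\<^sup>2 * levi_form B h"
proof -
  define u where "u = \<alpha> *s h"
  have u: "u = Re \<alpha> *\<^sub>R h + Im \<alpha> *\<^sub>R (\<i> *s h)" and iu: "\<i> *s u = Re \<alpha> *\<^sub>R (\<i> *s h) - Im \<alpha> *\<^sub>R h"
    by (simp_all add: vec_eq_iff complex_eq_iff u_def)
  have cm: "(cmod \<alpha>)\<^sup>2 = Re \<alpha> * Re \<alpha> + Im \<alpha> * Im \<alpha>" by (simp only: cmod_power2 power2_eq_square[of "Re \<alpha>"] power2_eq_square[of "Im \<alpha>"])
  have "levi_form B u = (cmod \<alpha>)\<^sup>2 * levi_form B h"
    unfolding levi_form_def iu cm unfolding u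
    by (simp add: blinfun.add_left blinfun.add_right blinfun.diff_left blinfun.diff_right blinfun.scaleR_left
        blinfun.scaleR_right algebra_simps)
  then show ?thesis by (simp add: u_def)
qed

lemma levi_form_scaleR: "levi_form B (r *\<^sub>R h) = r\<^sup>2 * levi_form B h"
  by (simp add: scaleR_vector_scale levi_form_scale)

lemma continuous_on_levi_form: "continuous_on S (levi_form B)"
  unfolding levi_form_def
  by (intro continuous_intros linear_continuous_on[OF bounded_linear_vector_scale])

text \<open>Compactness and homogeneity: on the unit sphere the set \<open>N\<close> where the Levi
  form is not positive is compact and avoids the kernel of \<open>A\<close>, so a large multiple of
  \<open>|A h|^2\<close> compensates there.\<close>

lemma levi_form_positive_definite:
  fixes A :: "complex^2 \<Rightarrow> complex"
  assumes A: "clinear_form A" and x: "A x \<noteq> 0" and w: "A w = 0" "levi_form B w > 0"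
  obtains K c where "K \<ge> 0" "c > 0" "\<And>h. c * (norm h)\<^sup>2 \<le> levi_form B h / 4 + K * (cmod (A h))\<^sup>2"
proof -
  have w0: "w \<noteq> 0" using w(2) by (auto simp: levi_form_def)
  let ?S = "sphere (0 :: complex^2) 1"
  have S: "compact ?S" "?S \<noteq> {}" by auto
  have A_cont: "continuous_on T A" for T by (rule linear_continuous_on[OF clinear_form_bounded_linear[OF A]])
  define N where "N = {h \<in> ?S. levi_form B h \<le> 0}"
  have "compact N" unfolding N_def
  proof -
    have "closed {h. levi_form B h \<le> 0}" by (intro closed_Collect_le continuous_on_levi_form continuous_intros)
    then show "compact {h \<in> ?S. levi_form B h \<le> 0}" using compact_Int_closed[OF S(1)] by (simp add: Collect_conj_eq sphere_def)
  qed
  have A0: "A h \<noteq> 0" if "h \<in> N" for h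
  proof
    assume "A h = 0"
    then obtain \<alpha> where \<alpha>: "h = \<alpha> *s w" using clinear_form_kernel_2[OF A x w(1) w0] by metis
    then have "\<alpha> \<noteq> 0" using that by (auto simp: N_def)
    then have "levi_form B h > 0" using w(2) by (simp add: \<alpha> levi_form_scale)
    then show False using that by (simp add: N_def)
  qed
  obtain a where a: "a > 0" "\<And>h. h \<in> N \<Longrightarrow> a \<le> (cmod (A h))\<^sup>2"
  proof (cases "N = {}")
    case True
    then show ?thesis using that[of 1] by simp
  next
    case False
    have "continuous_on N (\<lambda>h. (cmod (A h))\<^sup>2)" by (intro continuous_intros A_cont)
    then obtain h0 where "h0 \<in> N" "\<forall>h\<in>N. (cmod (A h0))\<^sup>2 \<le> (cmod (A h))\<^sup>2"
      using continuous_attains_inf[OF \<open>compact N\<close> False] by blast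
    then show ?thesis using that[of "(cmod (A h0))\<^sup>2"] A0[of h0] by auto
  qed
  obtain h1 where h1: "h1 \<in> ?S" "\<And>h. h \<in> ?S \<Longrightarrow> levi_form B h1 \<le> levi_form B h"
    using continuous_attains_inf[OF S continuous_on_levi_form] by blast
  \<comment> \<open>On \<open>N\<close> the added term is at least \<open>K a\<close>, which exceeds
    the largest possible deficit \<open>|levi_form B h1| / 4\<close> by 1.\<close>
  define K where "K = (\<bar>levi_form B h1\<bar> / 4 + 1) / a"
  have K: "K \<ge> 0" "K * a = \<bar>levi_form B h1\<bar> / 4 + 1" using a(1) by (auto simp: K_def)
  define g where "g h = levi_form B h / 4 + K * (cmod (A h))\<^sup>2" for h
  have g_pos: "g h > 0" if h: "h \<in> ?S" for h
  proof (cases "h \<in> N")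
    case True
    have "K * a \<le> K * (cmod (A h))\<^sup>2" using a(2)[OF True] K(1) by (rule mult_left_mono)
    then show ?thesis using h1(2)[OF h] K(2) unfolding g_def by linarith
  next
    case False
    then have "levi_form B h > 0" using h by (simp add: N_def)
    then show ?thesis using K(1) by (simp add: g_def add_pos_nonneg)
  qed
  have "continuous_on ?S g" unfolding g_def by (intro continuous_intros continuous_on_levi_form A_cont) auto
  then obtain h2 where h2: "h2 \<in> ?S" "\<And>h. h \<in> ?S \<Longrightarrow> g h2 \<le> g h"
    using continuous_attains_inf[OF S] by blast
  have "g h2 * (norm h)\<^sup>2 \<le> g h" for h
  proof (cases "h = 0")
    case True
    then show ?thesis by (simp add: g_def levi_form_def clinear_form_zero[OF A])
  next
    case False
    define u where "u = (1 / norm h) *\<^sub>R h"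
    have "u \<in> ?S" using False by (simp add: u_def)
    have hu: "h = norm h *\<^sub>R u" using False by (simp add: u_def)
    have "A (r *\<^sub>R v) = of_real r * A v" for r v by (simp add: scaleR_vector_scale clinear_form_scale[OF A])
    then have "g (r *\<^sub>R v) = r\<^sup>2 * g v" for r v
      by (simp add: g_def levi_form_scaleR norm_mult power_mult_distrib algebra_simps)
    then have "g h = (norm h)\<^sup>2 * g u" using hu by metis
    then show ?thesis using h2(2)[OF \<open>u \<in> ?S\<close>] by (simp add: mult_right_mono mult.commute)
  qed
  then show ?thesis using that[OF K(1) g_pos[OF h2(1)]] by (simp add: g_def)
qed

section \<open>Holomorphic functions and the holomorphic part of a quadratic form\<close>

lemma holo_on_clinear_form: "clinear_form A \<Longrightarrow> holo_on A S"
  unfolding holo_on_def using clinear_form_bounded_linear bounded_linear_imp_has_derivative by blast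

lemma holo_on_const: "holo_on (\<lambda>_. k) S"
  unfolding holo_on_def by (auto intro!: exI[of _ "\<lambda>_. 0"] derivative_eq_intros clinear_formI)

lemma holo_on_add:
  assumes "holo_on f S" "holo_on g S"
  shows "holo_on (\<lambda>z. f z + g z) S"
  unfolding holo_on_def
proof
  fix z assume z: "z \<in> S"
  obtain D E where "(f has_derivative D) (at z)" "clinear_form D" "(g has_derivative E) (at z)" "clinear_form E"
    using assms z unfolding holo_on_def by meson
  then show "\<exists>D. ((\<lambda>z. f z + g z) has_derivative D) (at z) \<and> clinear_form D"
    using clinear_form_combination[of D E 1 1]
    by (intro exI[of _ "\<lambda>h. D h + E h"]) (auto intro!: derivative_intros)
qed

lemma holo_on_mult:
  assumes "holo_on f S" "holo_on g S"
  shows "holo_on (\<lambda>z. f z * g z) S"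
  unfolding holo_on_def
proof
  fix z assume z: "z \<in> S"
  obtain D E where D: "(f has_derivative D) (at z)" "clinear_form D" "(g has_derivative E) (at z)" "clinear_form E"
    using assms z unfolding holo_on_def by meson
  have "((\<lambda>z. f z * g z) has_derivative (\<lambda>h. f z * E h + D h * g z)) (at z)"
    by (rule has_derivative_mult[OF D(1,3)])
  moreover have "(\<lambda>h. f z * E h + D h * g z) = (\<lambda>h. f z * E h + g z * D h)" by (simp add: mult.commute)
  moreover have "clinear_form (\<lambda>h. f z * E h + g z * D h)" by (rule clinear_form_combination[OF D(4,2)])
  ultimately show "\<exists>D. ((\<lambda>z. f z * g z) has_derivative D) (at z) \<and> clinear_form D" by metis
qed

lemma holo_on_compose:
  assumes f: "holomorphic_map f S" and h: "holo_on h T" and sub: "f ` S \<subseteq> T"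
  shows "holo_on (\<lambda>z. h (f z)) S"
  unfolding holo_on_def
proof
  fix z assume z: "z \<in> S"
  obtain D where D: "(f has_derivative D) (at z)" "Vector_Spaces.linear (*s) (*s) D"
    using f z unfolding holomorphic_map_def by blast
  obtain E where E: "(h has_derivative E) (at (f z))" "clinear_form E"
    using h sub z unfolding holo_on_def by blast
  have "((\<lambda>z. h (f z)) has_derivative (\<lambda>k. E (D k))) (at z)" by (rule has_derivative_compose[OF D(1) E(1)])
  moreover have "clinear_form (\<lambda>k. E (D k))"
    using D(2) clinear_form_add[OF E(2)] clinear_form_scale[OF E(2)]
    by (intro clinear_formI) (auto simp: Vector_Spaces.linear_iff)
  ultimately show "\<exists>D. ((\<lambda>z. h (f z)) has_derivative D) (at z) \<and> clinear_form D" by blast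
qed

text \<open>The holomorphic part of the real quadratic form \<open>h \<mapsto> B h h\<close>, whose Hermitian part is
  half the Levi form.\<close>

definition holo_quad :: "((complex^'n) \<Rightarrow>\<^sub>L (complex^'n) \<Rightarrow>\<^sub>L real) \<Rightarrow> complex^'n \<Rightarrow> complex" where
  "holo_quad B h = (complex_of_real (B h h - B (\<i> *s h) (\<i> *s h)) - \<i> * complex_of_real (B h (\<i> *s h) + B (\<i> *s h) h)) / 2"

lemma quad_decomposition: "blinfun_apply (blinfun_apply B h) h = levi_form B h / 2 + Re (holo_quad B h)"
  by (simp add: levi_form_def holo_quad_def field_simps)

lemma holo_quad_scale: "holo_quad B (\<alpha> *s h) = \<alpha>\<^sup>2 * holo_quad B h"
proof -
  define u where "u = \<alpha> *s h"
  have u: "u = Re \<alpha> *\<^sub>R h + Im \<alpha> *\<^sub>R (\<i> *s h)" and iu: "\<i> *s u = Re \<alpha> *\<^sub>R (\<i> *s h) - Im \<alpha> *\<^sub>R h"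
    by (simp_all add: vec_eq_iff complex_eq_iff u_def)
  have "holo_quad B u = \<alpha>\<^sup>2 * holo_quad B h"
    unfolding holo_quad_def iu unfolding u
    by (simp add: complex_eq_iff blinfun.add_left blinfun.add_right blinfun.diff_left blinfun.diff_right blinfun.scaleR_left
        blinfun.scaleR_right power2_eq_square field_simps)
  then show ?thesis by (simp add: u_def)
qed

lemma holo_on_holo_quad:
  fixes B :: "(complex^'n) \<Rightarrow>\<^sub>L (complex^'n) \<Rightarrow>\<^sub>L real"
  shows "holo_on (holo_quad B) S"
  unfolding holo_on_def
proof
  fix h :: "complex^'n" assume "h \<in> S"
  \<comment> \<open>The real part of the derivative of \<open>holo_quad B\<close> at
    \<open>h\<close>; the derivative turns out to be \<open>cpart L\<close>, hence complex
    linear.\<close>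
  define L where "L k = (B k h + B h k - B (\<i> *s k) (\<i> *s h) - B (\<i> *s h) (\<i> *s k)) / 2" for k
  have lin: "linear L"
  proof (rule linearI)
    have iadd: "\<i> *s (x + y) = \<i> *s x + \<i> *s y" and iscale: "\<i> *s (r *\<^sub>R x) = r *\<^sub>R (\<i> *s x)" for x y :: "complex^'n" and r
      by (simp_all add: vec_eq_iff complex_eq_iff algebra_simps)
    show "L (x + y) = L x + L y" for x y
      unfolding L_def iadd by (simp add: blinfun.add_left blinfun.add_right field_simps)
    show "L (r *\<^sub>R x) = r *\<^sub>R L x" for r x
      unfolding L_def iscale by (simp add: blinfun.scaleR_left blinfun.scaleR_right field_simps)
  qed
  have ii: "\<i> *s (\<i> *s k) = - k" for k :: "complex^'n" by (simp add: vec_eq_iff)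
  have I: "((\<lambda>x. \<i> *s x) has_derivative (\<lambda>k. \<i> *s k)) (at h)"
    by (rule bounded_linear_imp_has_derivative[OF bounded_linear_vector_scale])
  have BB: "((\<lambda>x. blinfun_apply (blinfun_apply B (f x)) (g x)) has_derivative (\<lambda>k. B (f h) (g' k) + B (f' k) (g h))) (at h)"
    if f: "(f has_derivative f') (at h)" and g: "(g has_derivative g') (at h)" for f f' g g'
    by (rule bounded_bilinear.FDERIV[OF bounded_bilinear_blinfun_apply
          bounded_linear.has_derivative[OF blinfun.bounded_linear_right f] g])
  have id: "((\<lambda>x. x) has_derivative (\<lambda>k. k)) (at h)" by (rule has_derivative_ident)
  have "holo_quad B = (\<lambda>h. (complex_of_real (B h h - B (\<i> *s h) (\<i> *s h)) - \<i> * complex_of_real (B h (\<i> *s h) + B (\<i> *s h) h)) * (1 / 2))"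
    by (simp add: fun_eq_iff holo_quad_def)
  moreover have "((\<lambda>h. (complex_of_real (B h h - B (\<i> *s h) (\<i> *s h)) - \<i> * complex_of_real (B h (\<i> *s h) + B (\<i> *s h) h)) * (1 / 2))
     has_derivative (\<lambda>k. (complex_of_real (B h k + B k h - (B (\<i> *s h) (\<i> *s k) + B (\<i> *s k) (\<i> *s h)))
       - \<i> * complex_of_real (B h (\<i> *s k) + B k (\<i> *s h) + (B (\<i> *s h) k + B (\<i> *s k) h))) * (1 / 2))) (at h)"
    by (intro has_derivative_mult_left has_derivative_mult_right has_derivative_diff has_derivative_add has_derivative_of_real
          BB[OF id id] BB[OF id I] BB[OF I id] BB[OF I I])
  moreover have "(\<lambda>k. (complex_of_real (B h k + B k h - (B (\<i> *s h) (\<i> *s k) + B (\<i> *s k) (\<i> *s h)))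
       - \<i> * complex_of_real (B h (\<i> *s k) + B k (\<i> *s h) + (B (\<i> *s h) k + B (\<i> *s k) h))) * (1 / 2)) = cpart L"
    by (simp add: fun_eq_iff cpart_def L_def ii blinfun.minus_left blinfun.minus_right complex_eq_iff field_simps)
  ultimately have "(holo_quad B has_derivative cpart L) (at h)" by simp
  then show "\<exists>D. (holo_quad B has_derivative D) (at h) \<and> clinear_form D"
    using clinear_form_cpart[OF lin] by blast
qed

text \<open>\<open>\<Lambda> q\<close> is the Levi polynomial at \<open>q\<close>, with quadratic
  part frozen at \<open>p\<close>, plus \<open>K A^2\<close>. Since
  \<open>Re (A^2) = 2 (Re A)^2 - |A|^2\<close>, the correction completes the Levi form to a positive
  definite one at the price of \<open>2 K (\<rho>' p h)^2\<close>. Up to a small error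
  \<open>\<rho>' p h\<close> is \<open>\<rho> q' - \<rho> q\<close>, whose square is negligible
  against \<open>- \<rho> q - \<rho> q'\<close>; the \<open>\<rho> q'\<close> terms then cancel,
  leaving \<open>- 2 * \<rho> q\<close>. Letting \<open>q\<close> vary is what later makes discs
  near the boundary collapse.\<close>

lemma strictly_pseudoconvex_support:
  fixes \<rho> :: "complex^2 \<Rightarrow> real"
  assumes V: "open V" "p \<in> V" and d1: "\<forall>x\<in>V. (\<rho> has_derivative blinfun_apply (\<rho>' x)) (at x)"
    and d2: "\<forall>x\<in>V. (\<rho>' has_derivative blinfun_apply (\<rho>'' x)) (at x)"
    and cont: "continuous_on V \<rho>''" and p0: "\<rho> p = 0" and grad: "\<rho>' p x \<noteq> 0"
    and w: "cpart (\<rho>' p) w = 0" "levi_form (\<rho>'' p) w > 0"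
  obtains s c \<Lambda> where "s > 0" "c > 0" "ball p s \<subseteq> V" "\<And>q. \<Lambda> q 0 = 0" "\<And>q. holo_on (\<Lambda> q) UNIV"
    "\<And>q q'. q \<in> ball p s \<Longrightarrow> q' \<in> ball p s \<Longrightarrow> \<rho> q \<le> 0 \<Longrightarrow> \<rho> q' \<le> 0 \<Longrightarrow>
       Re (\<Lambda> q (q' - q)) \<le> - 2 * \<rho> q - c * (norm (q' - q))\<^sup>2"
proof -
  define A where "A = cpart (\<rho>' p)"
  define B where "B = \<rho>'' p"
  have A: "clinear_form A" unfolding A_def by (rule clinear_form_cpart_blinfun)
  have Ax: "A x \<noteq> 0" unfolding A_def using grad Re_cpart[of "\<rho>' p" x] by (metis zero_complex.sel(1))
  obtain K c where K: "K \<ge> 0" "c > 0" and pd: "\<And>h. c * (norm h)\<^sup>2 \<le> levi_form B h / 4 + K * (cmod (A h))\<^sup>2"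
    using levi_form_positive_definite[OF A Ax, of w B] w unfolding A_def B_def by metis
  define \<epsilon> where "\<epsilon> = c / 4"
  have e: "\<epsilon> > 0" using K by (simp add: \<epsilon>_def)
  obtain s1 where s1: "s1 > 0" "ball p s1 \<subseteq> V"
    "\<forall>x\<in>ball p s1. \<forall>y\<in>ball p s1. norm (\<rho>' y - \<rho>' x - B (y - x)) \<le> \<epsilon> * norm (y - x)"
    using C2_derivative_expansion[OF V d2 cont e] unfolding B_def by blast
  have "isCont \<rho> p" using d1 V has_derivative_continuous by blast
  moreover have "1 / (4 * K + 1) > 0" using K by (simp add: add_nonneg_pos)
  ultimately obtain s2 where s2: "s2 > 0" "\<And>q. dist q p < s2 \<Longrightarrow> dist (\<rho> q) (\<rho> p) < 1 / (4 * K + 1)"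
    unfolding continuous_at_eps_delta by metis
  define L where "L = 2 * norm B + 3 * \<epsilon>"
  have L: "L > 0" using e by (simp add: L_def add_nonneg_pos)
  \<comment> \<open>Chosen so that \<open>(L s)^2 \<le> c / (16 K + 1)\<close>, hence
    \<open>4 K E^2 \<le> (c / 4) |h|^2\<close> for the error \<open>E\<close> below; the summand 1
    covers \<open>K = 0\<close>.\<close>
  define s3 where "s3 = sqrt (c / (16 * K + 1)) / L"
  have s3: "s3 > 0" using L K by (simp add: s3_def add_nonneg_pos)
  define s where "s = min s1 (min s2 s3)"
  have s: "s > 0" "s \<le> s1" "s \<le> s2" "s \<le> s3" using s1 s2 s3 by (auto simp: s_def)
  define \<Lambda> where "\<Lambda> q h = cpart (\<rho>' q) h + (1/2) * holo_quad B h + of_real K * (A h * A h)" for q h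
  have zero: "\<Lambda> q 0 = 0" for q
    using clinear_form_zero[OF A] clinear_form_zero[OF clinear_form_cpart_blinfun[of "\<rho>' q"]]
    by (simp add: \<Lambda>_def holo_quad_def)
  have hol: "holo_on (\<Lambda> q) UNIV" for q
    unfolding \<Lambda>_def
    by (intro holo_on_add holo_on_mult holo_on_const holo_on_holo_quad holo_on_clinear_form A clinear_form_cpart_blinfun)
  have ineq: "Re (\<Lambda> q (q' - q)) \<le> - 2 * \<rho> q - (c / 2) * (norm (q' - q))\<^sup>2"
    if q: "q \<in> ball p s" "q' \<in> ball p s" and neg: "\<rho> q \<le> 0" "\<rho> q' \<le> 0" for q q'
  proof -
    define h where "h = q' - q"
    have hs: "norm h \<le> 2 * s"
      using q norm_triangle_ineq4[of "q' - p" "q - p"] by (simp add: h_def dist_norm norm_minus_commute[of p])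
    have ball1: "q \<in> ball p s1" "q + h \<in> ball p s1" "p \<in> ball p s1" using q s s1(1) by (auto simp: h_def)
    have d1': "\<forall>x\<in>ball p s1. (\<rho> has_derivative \<rho>' x) (at x)" using d1 s1(2) by blast
    have taylor: "\<bar>\<rho> (q + h) - \<rho> q - \<rho>' q h - B h h / 2\<bar> \<le> \<epsilon> * (norm h)\<^sup>2"
      by (rule C2_taylor[OF d1' s1(3) ball1(1,2)]) (use e in simp)
    have qh: "q + h = q'" by (simp add: h_def)
    have Bhh: "\<bar>B h h\<bar> \<le> norm B * (norm h)\<^sup>2"
    proof -
      have "\<bar>B h h\<bar> \<le> norm (B h) * norm h" by (metis norm_blinfun real_norm_def)
      also have "\<dots> \<le> (norm B * norm h) * norm h" by (intro mult_right_mono norm_blinfun) auto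
      finally show ?thesis by (simp add: power2_eq_square mult.assoc)
    qed
    have h2: "(norm h)\<^sup>2 \<le> 2 * s * norm h" using hs by (simp add: power2_eq_square mult_right_mono)
    have dpq: "\<bar>\<rho>' q h - \<rho>' p h\<bar> \<le> (norm B + \<epsilon>) * s * norm h"
    proof -
      have "norm (\<rho>' q - \<rho>' p) \<le> norm (\<rho>' q - \<rho>' p - B (q - p)) + norm (B (q - p))"
        using norm_triangle_ineq[of "\<rho>' q - \<rho>' p - B (q - p)" "B (q - p)"] by simp
      also have "\<dots> \<le> \<epsilon> * norm (q - p) + norm B * norm (q - p)"
        using s1(3) ball1 by (intro add_mono norm_blinfun) auto
      also have "\<dots> = (norm B + \<epsilon>) * norm (q - p)" by (simp add: algebra_simps)
      also have "\<dots> \<le> (norm B + \<epsilon>) * s"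
        using q(1) e by (intro mult_left_mono) (auto simp: dist_norm norm_minus_commute)
      finally have "norm (\<rho>' q - \<rho>' p) \<le> (norm B + \<epsilon>) * s" .
      moreover have "\<bar>(\<rho>' q - \<rho>' p) h\<bar> \<le> norm (\<rho>' q - \<rho>' p) * norm h" by (metis norm_blinfun real_norm_def)
      ultimately show ?thesis
        using mult_right_mono[of "norm (\<rho>' q - \<rho>' p)" "(norm B + \<epsilon>) * s" "norm h"]
        by (simp add: blinfun.diff_left)
    qed
    define a where "a = - \<rho> q'"
    define d where "d = - \<rho> q"
    have ad: "a \<ge> 0" "d \<ge> 0" using neg by (auto simp: a_def d_def)
    have small: "4 * K * a\<^sup>2 \<le> a" "4 * K * d\<^sup>2 \<le> d"
    proof -
      have aux: "4 * K * x\<^sup>2 \<le> x" if x: "0 \<le> x" "x < 1 / (4 * K + 1)" for x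
      proof -
        have "(4 * K + 1) * x < 1" using x(2) K by (simp add: field_simps)
        then have "4 * K * x \<le> 1" using x(1) by (simp add: algebra_simps)
        then have "(4 * K * x) * x \<le> 1 * x" using x(1) by (rule mult_right_mono)
        then show ?thesis by (simp add: power2_eq_square mult.assoc)
      qed
      show "4 * K * a\<^sup>2 \<le> a" using s2(2)[of q'] q s ad p0 by (intro aux) (auto simp: a_def dist_commute)
      show "4 * K * d\<^sup>2 \<le> d" using s2(2)[of q] q s ad p0 by (intro aux) (auto simp: d_def dist_commute)
    qed
    \<comment> \<open>The error in approximating \<open>\<rho> q' - \<rho> q = d - a\<close> by the
      differential taken at \<open>p\<close> instead of \<open>q\<close>; it is of order
      \<open>s |h|\<close>.\<close>
    define E where "E = \<rho>' p h - (d - a)"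
    have E: "\<bar>E\<bar> \<le> L * s * norm h"
    proof -
      have t: "\<bar>d - a - \<rho>' q h - B h h / 2\<bar> \<le> \<epsilon> * (norm h)\<^sup>2" using taylor qh by (simp add: a_def d_def)
      have "\<epsilon> * (norm h)\<^sup>2 \<le> \<epsilon> * (2 * s * norm h)" using h2 e by (intro mult_left_mono) auto
      moreover have "norm B * (norm h)\<^sup>2 \<le> norm B * (2 * s * norm h)" using h2 by (intro mult_left_mono) auto
      ultimately have "\<bar>E\<bar> \<le> (norm B + \<epsilon>) * s * norm h + norm B * (2 * s * norm h) / 2 + \<epsilon> * (2 * s * norm h)"
        unfolding E_def using t dpq Bhh by linarith
      also have "\<dots> = L * s * norm h" by (simp add: L_def algebra_simps)
      finally show ?thesis .
    qed
    have KE: "4 * K * E\<^sup>2 \<le> (c / 4) * (norm h)\<^sup>2"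
    proof -
      have "L * s \<le> sqrt (c / (16 * K + 1))" using s(4) L by (simp add: s3_def field_simps)
      then have "(L * s)\<^sup>2 \<le> (sqrt (c / (16 * K + 1)))\<^sup>2" using L s by (intro power_mono) auto
      also have "\<dots> = c / (16 * K + 1)" using K by simp
      finally have Ls: "(L * s)\<^sup>2 \<le> c / (16 * K + 1)" .
      have "E\<^sup>2 \<le> (L * s * norm h)\<^sup>2" using E by (metis abs_ge_zero power2_abs power_mono)
      then have "E\<^sup>2 \<le> (L * s)\<^sup>2 * (norm h)\<^sup>2" by (simp add: power_mult_distrib)
      also have "\<dots> \<le> c / (16 * K + 1) * (norm h)\<^sup>2" using Ls by (intro mult_right_mono) auto
      finally have "4 * K * E\<^sup>2 \<le> 4 * K * (c / (16 * K + 1) * (norm h)\<^sup>2)" using K by (intro mult_left_mono) auto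
      also have "\<dots> = (4 * K * c / (16 * K + 1)) * (norm h)\<^sup>2" by simp
      also have "\<dots> \<le> (c / 4) * (norm h)\<^sup>2" using K by (intro mult_right_mono) (auto simp: field_simps)
      finally show ?thesis .
    qed
    have sq: "(\<rho>' p h)\<^sup>2 \<le> 2 * (a\<^sup>2 + d\<^sup>2) + 2 * E\<^sup>2"
    proof -
      have "(\<rho>' p h)\<^sup>2 = ((d - a) + E)\<^sup>2" by (simp add: E_def)
      also have "\<dots> \<le> 2 * (d - a)\<^sup>2 + 2 * E\<^sup>2" using sum_squares_bound[of "d - a" E] by (simp add: power2_sum)
      also have "(d - a)\<^sup>2 \<le> a\<^sup>2 + d\<^sup>2" using ad by (simp add: power2_diff)
      finally show ?thesis by simp
    qed
    have "2 * K * (\<rho>' p h)\<^sup>2 \<le> 2 * K * (2 * (a\<^sup>2 + d\<^sup>2) + 2 * E\<^sup>2)" using sq K by (intro mult_left_mono) auto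
    also have "\<dots> = 4 * K * a\<^sup>2 + 4 * K * d\<^sup>2 + 4 * K * E\<^sup>2" by (simp add: algebra_simps)
    finally have bound: "2 * K * (\<rho>' p h)\<^sup>2 \<le> a + d + (c / 4) * (norm h)\<^sup>2" using small KE by linarith
    have Re_sq: "Re (A h * A h) = 2 * (\<rho>' p h)\<^sup>2 - (cmod (A h))\<^sup>2"
    proof -
      have "Re (A h) = \<rho>' p h" by (simp add: A_def)
      then show ?thesis by (simp add: cmod_power2) (simp add: power2_eq_square)
    qed
    have "Re (\<Lambda> q h) = \<rho>' q h + Re (holo_quad B h) / 2 + K * (2 * (\<rho>' p h)\<^sup>2 - (cmod (A h))\<^sup>2)"
      unfolding \<Lambda>_def using Re_sq by simp
    also have "\<dots> = \<rho>' q h + B h h / 2 - (levi_form B h / 4 + K * (cmod (A h))\<^sup>2) + 2 * K * (\<rho>' p h)\<^sup>2"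
      using quad_decomposition[of B h] by (simp add: algebra_simps)
    also have "\<dots> \<le> (d - a + \<epsilon> * (norm h)\<^sup>2) - c * (norm h)\<^sup>2 + (a + d + (c / 4) * (norm h)\<^sup>2)"
      using taylor pd[of h] bound unfolding qh a_def d_def by linarith
    also have "\<dots> = - 2 * \<rho> q - (c / 2) * (norm h)\<^sup>2" by (simp add: \<epsilon>_def d_def algebra_simps)
    finally show ?thesis by (simp add: h_def)
  qed
  show ?thesis by (rule that[OF s(1), of "c / 2" \<Lambda>]) (use K s s1 zero hol ineq in auto)
qed

text \<open>The Borel-Caratheodory argument: \<open>f / (2 D - f)\<close> maps the half-plane
  \<open>Re < D\<close> into the unit disc and fixes 0, so the Schwarz lemma bounds it by
  \<open>1 / 2\<close> at half the radius.\<close>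

lemma Re_bound_imp_cmod_bound:
  assumes hol: "f holomorphic_on ball 0 t" and t: "t > 0" and f0: "f 0 = 0" and D: "D > 0"
    and re: "\<And>\<xi>. \<xi> \<in> ball 0 t \<Longrightarrow> Re (f \<xi>) < D" and \<xi>: "cmod \<xi> \<le> t / 2"
  shows "cmod (f \<xi>) \<le> 2 * D"
proof -
  define u where "u x = f (of_real t * x) / (2 * of_real D - f (of_real t * x))" for x
  have sub: "of_real t * x \<in> ball 0 t" if "x \<in> ball 0 1" for x :: complex
    using that t by (simp add: norm_mult)
  have nz: "2 * of_real D - f y \<noteq> 0" if "y \<in> ball 0 t" for y
    using re[OF that] D by (auto simp: complex_eq_iff)
  have lt: "cmod (f y) < cmod (2 * of_real D - f y)" if "y \<in> ball 0 t" for y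
  proof -
    have "(Re (f y))\<^sup>2 < (2 * D - Re (f y))\<^sup>2" using re[OF that] D by (simp add: power2_eq_square algebra_simps)
    then have "(cmod (f y))\<^sup>2 < (cmod (2 * of_real D - f y))\<^sup>2" by (simp add: cmod_power2)
    then show ?thesis using norm_ge_zero power_less_imp_less_base by blast
  qed
  have "(\<lambda>x. f (of_real t * x)) holomorphic_on ball 0 1"
    by (rule holomorphic_on_compose_gen[OF _ hol, unfolded o_def]) (use sub in \<open>auto intro!: holomorphic_intros\<close>)
  then have "u holomorphic_on ball 0 1" unfolding u_def
    by (intro holomorphic_intros) (use nz sub in auto)
  moreover have "u 0 = 0" by (simp add: u_def f0)
  moreover have "cmod (u x) < 1" if "cmod x < 1" for x
    using lt[OF sub[of x]] that by (simp add: u_def norm_divide divide_less_eq)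
  moreover have x1: "cmod (\<xi> / of_real t) \<le> 1 / 2" using \<xi> t by (simp add: norm_divide field_simps)
  ultimately have "cmod (u (\<xi> / of_real t)) \<le> cmod (\<xi> / of_real t)" by (intro Schwarz_Lemma(1)) auto
  then have "cmod (u (\<xi> / of_real t)) \<le> 1 / 2" using x1 by linarith
  then have "cmod (f \<xi>) / cmod (2 * of_real D - f \<xi>) \<le> 1 / 2" using t by (simp add: u_def norm_divide)
  moreover have "cmod (2 * of_real D - f \<xi>) > 0" using nz[of \<xi>] \<xi> t by simp
  ultimately have "2 * cmod (f \<xi>) \<le> cmod (2 * of_real D - f \<xi>)" by (simp add: field_simps)
  also have "\<dots> \<le> 2 * D + cmod (f \<xi>)" using norm_triangle_ineq4[of "2 * of_real D" "f \<xi>"] D by (simp add: norm_mult)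
  finally show ?thesis by simp
qed

text \<open>Schwarz lemma for \<open>f - f 0\<close>, which is bounded by \<open>2 R\<close>;
  dividing by \<open>3 R\<close> makes the bound strict.\<close>

lemma bounded_holomorphic_lipschitz_at_0:
  assumes hol: "f holomorphic_on ball 0 r" and r: "r > 0" and R: "R > 0"
    and bd: "\<And>\<xi>. \<xi> \<in> ball 0 r \<Longrightarrow> cmod (f \<xi>) \<le> R" and \<xi>: "cmod \<xi> < r"
  shows "cmod (f \<xi> - f 0) \<le> 3 * R * cmod \<xi> / r"
proof -
  define u where "u x = (f (of_real r * x) - f 0) / (3 * of_real R)" for x
  have sub: "of_real r * x \<in> ball 0 r" if "x \<in> ball 0 1" for x :: complex
    using that r by (simp add: norm_mult)
  have "(\<lambda>x. f (of_real r * x)) holomorphic_on ball 0 1"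
    by (rule holomorphic_on_compose_gen[OF _ hol, unfolded o_def]) (use sub in \<open>auto intro!: holomorphic_intros\<close>)
  then have "u holomorphic_on ball 0 1" unfolding u_def using R by (intro holomorphic_intros) auto
  moreover have u0: "u 0 = 0" by (simp add: u_def)
  moreover have "cmod (u x) < 1" if "cmod x < 1" for x
  proof -
    have "cmod (f (of_real r * x) - f 0) \<le> R + R"
      using bd[OF sub[of x]] bd[of 0] that r norm_triangle_ineq4[of "f (of_real r * x)" "f 0"] by simp
    then show ?thesis using R by (simp add: u_def norm_divide norm_mult)
  qed
  ultimately have "cmod (u (\<xi> / of_real r)) \<le> cmod (\<xi> / of_real r)"
    using \<xi> r u0 by (intro Schwarz_Lemma(1)) (auto simp: norm_divide)
  then show ?thesis using r R by (simp add: u_def norm_divide norm_mult field_simps)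
qed

lemma holo_on_shift:
  assumes "holo_on h T" "\<And>z. z \<in> S \<Longrightarrow> z + v \<in> T"
  shows "holo_on (\<lambda>z. h (z + v)) S"
  unfolding holo_on_def
proof
  fix z assume "z \<in> S"
  then obtain D where D: "(h has_derivative D) (at (z + v))" "clinear_form D"
    using assms unfolding holo_on_def by blast
  have "((\<lambda>z. z + v) has_derivative (\<lambda>k. k)) (at z)" by (auto intro!: derivative_eq_intros)
  then have "((\<lambda>z. h (z + v)) has_derivative D) (at z)" by (rule has_derivative_compose[where f = "\<lambda>z. z + v", OF _ D(1)])
  then show "\<exists>D. ((\<lambda>z. h (z + v)) has_derivative D) (at z) \<and> clinear_form D" using D(2) by blast
qed

lemma clinear_form_component: "clinear_form (\<lambda>w. w $ j)"
  by (rule clinear_formI) auto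

lemma holomorphic_map_continuous: "holomorphic_map f S \<Longrightarrow> continuous_on S f"
  unfolding holomorphic_map_def
  by (intro continuous_at_imp_continuous_on ballI) (blast dest: has_derivative_continuous)

lemma holomorphic_map_component: "holomorphic_map f S \<Longrightarrow> holo_on (\<lambda>z. f z $ j) S"
  by (rule holo_on_compose[OF _ holo_on_clinear_form[OF clinear_form_component], of _ _ UNIV]) auto

section \<open>Excluding a positive Levi form\<close>

context flat_support
begin

lemma no_strictly_pseudoconvex_image:
  fixes f :: "complex^'n \<Rightarrow> complex^'m" and g :: "complex^'m \<Rightarrow> complex^'n"
  assumes bdd: "bounded \<Omega>" and ker: "\<And>z K. z \<in> frontier \<Omega> \<Longrightarrow> K \<in> dirs z \<Longrightarrow> \<exists>e\<in>K. e \<noteq> 0"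
    and f: "holomorphic_map f \<Omega>" and g: "holomorphic_map g \<Omega>'"
    and fg: "f ` \<Omega> = \<Omega>'" "g ` \<Omega>' = \<Omega>" "\<And>z. z \<in> \<Omega> \<Longrightarrow> g (f z) = z"
    and \<Omega>': "bounded \<Omega>'" "p \<in> closure \<Omega>'"
    and s: "s > 0" and \<rho>: "continuous_on (ball p s) \<rho>" "\<And>q. q \<in> ball p s \<Longrightarrow> q \<in> \<Omega>' \<longleftrightarrow> \<rho> q < 0" "\<rho> p = 0"
    and c: "c > 0" and \<Lambda>0: "\<And>q. \<Lambda> q 0 = 0" and \<Lambda>: "\<And>q. holo_on (\<Lambda> q) UNIV"
    and ineq: "\<And>q q'. q \<in> ball p s \<Longrightarrow> q' \<in> ball p s \<Longrightarrow> \<rho> q \<le> 0 \<Longrightarrow> \<rho> q' \<le> 0 \<Longrightarrow>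
       Re (\<Lambda> q (q' - q)) \<le> - 2 * \<rho> q - c * (norm (q' - q))\<^sup>2"
  shows False
proof -
  \<comment> \<open>\<open>Re h > 0\<close> forces \<open>c |f z - p|^2 < c0 = c (s / 4)^2\<close>,
    so the cap lies within \<open>s / 4\<close> of \<open>p\<close>, well inside
    \<open>ball p s\<close>.\<close>
  define c0 where "c0 = c * s\<^sup>2 / 16"
  have c0: "c0 > 0" using c s by (simp add: c0_def)
  define P where "P w = of_real c0 + \<Lambda> p (w + (- p))" for w
  define h where "h z = P (f z)" for z
  define A where "A = {z \<in> \<Omega>. f z \<in> ball p s \<and> Re (h z) > 0}"
  have P: "holo_on P UNIV" unfolding P_def by (intro holo_on_add holo_on_const holo_on_shift[OF \<Lambda>]) auto
  have h\<Omega>: "holo_on h \<Omega>" unfolding h_def by (rule holo_on_compose[OF f P]) auto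
  have f_cont: "continuous_on \<Omega> f" by (rule holomorphic_map_continuous[OF f])
  have h_cont: "continuous_on \<Omega> h" by (rule holo_on_continuous[OF h\<Omega>])
  have A_sub: "A \<subseteq> \<Omega>" by (auto simp: A_def)
  have f_in: "f z \<in> \<Omega>'" if "z \<in> \<Omega>" for z using fg(1) that by blast
  have Aopen: "open A"
  proof -
    have "open (\<Omega> \<inter> f -` ball p s)" by (rule continuous_open_preimage[OF f_cont opn open_ball])
    moreover have "open (\<Omega> \<inter> (\<lambda>z. Re (h z)) -` {0<..})"
      by (rule continuous_open_preimage[OF _ opn]) (auto intro!: continuous_intros h_cont)
    moreover have "A = (\<Omega> \<inter> f -` ball p s) \<inter> (\<Omega> \<inter> (\<lambda>z. Re (h z)) -` {0<..})" by (auto simp: A_def)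
    ultimately show ?thesis by auto
  qed
  have h_le: "Re (h z) \<le> c0 - c * (norm (f z - p))\<^sup>2" if z: "z \<in> \<Omega>" "f z \<in> ball p s" for z
    using ineq[of p "f z"] z s \<rho>(2)[OF z(2)] f_in[OF z(1)] \<rho>(3) by (simp add: h_def P_def)
  have cap: "norm (f z - p) < s / 4" if "z \<in> A" for z
  proof -
    have "c * (norm (f z - p))\<^sup>2 < c0" using h_le[of z] that by (auto simp: A_def)
    also have "c0 = c * (s / 4)\<^sup>2" by (simp add: c0_def power_divide)
    finally have "(norm (f z - p))\<^sup>2 < (s / 4)\<^sup>2" using c by simp
    then show ?thesis by (rule power2_less_imp_less) (use s in simp)
  qed
  have h_le0: "Re (h z) \<le> c0" if "z \<in> A" for z
  proof -
    have "Re (h z) \<le> c0 - c * (norm (f z - p))\<^sup>2" using h_le that by (simp add: A_def)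
    moreover have "0 \<le> c * (norm (f z - p))\<^sup>2" using c by simp
    ultimately show ?thesis by linarith
  qed
  \<comment> \<open>A point of \<open>\<Omega>\<close> outside \<open>A\<close> either has
    \<open>Re h \<le> 0\<close>, and continuity suffices, or has its image outside
    \<open>ball p s\<close>; then \<open>A\<close> cannot come near, its image staying within
    \<open>s / 4\<close> of \<open>p\<close>.\<close>
  have inner: "vanishes_at A h y" if y: "y \<in> \<Omega> - A" for y
    unfolding vanishes_at_def
  proof (intro allI impI)
    fix \<eta> :: real assume \<eta>: "\<eta> > 0"
    have "isCont f y" "isCont h y" using y f_cont h_cont by (simp_all add: continuous_on_eq_continuous_at[OF opn])
    show "\<exists>d>0. \<forall>z\<in>A \<inter> ball y d. Re (h z) < \<eta>"
    proof (cases "f y \<in> ball p s")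
      case True
      then have "Re (h y) \<le> 0" using y by (auto simp: A_def)
      obtain d where d: "d > 0" "\<And>z. dist z y < d \<Longrightarrow> dist (h z) (h y) < \<eta>"
        using \<open>isCont h y\<close> \<eta> unfolding continuous_at_eps_delta by metis
      have "Re (h z) < \<eta>" if "z \<in> A \<inter> ball y d" for z
      proof -
        have "cmod (h z - h y) < \<eta>" using d(2)[of z] that by (simp add: dist_norm norm_minus_commute)
        then show ?thesis using abs_Re_le_cmod[of "h z - h y"] \<open>Re (h y) \<le> 0\<close> by simp
      qed
      then show ?thesis using d(1) by blast
    next
      case False
      obtain d where d: "d > 0" "\<And>z. dist z y < d \<Longrightarrow> dist (f z) (f y) < s / 4"
        using \<open>isCont f y\<close> s unfolding continuous_at_eps_delta by (metis zero_less_divide_iff zero_less_numeral)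
      have False if z: "z \<in> A \<inter> ball y d" for z
      proof -
        have "dist p (f y) \<le> dist p (f z) + dist (f z) (f y)" by (rule dist_triangle)
        also have "\<dots> < s / 4 + s / 4"
          using cap[of z] d(2)[of z] z by (intro add_strict_mono) (auto simp: dist_norm norm_minus_commute)
        finally show False using False s by simp
      qed
      then show ?thesis using d(1) by blast
    qed
  qed
  \<comment> \<open>Properness of \<open>f\<close>: the part of the cap region with
    \<open>\<rho> \<le> - \<eta>\<close> is compact in \<open>\<Omega>'\<close>, so its image under
    \<open>g\<close> is compact in \<open>\<Omega>\<close> and stays away from
    \<open>y\<close>.\<close>
  have proper: "\<exists>d>0. \<forall>z\<in>A \<inter> ball y d. - \<rho> (f z) < \<eta>" if y: "y \<in> frontier \<Omega>" and \<eta>: "\<eta> > 0" for y \<eta>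
  proof -
    define C where "C = {q \<in> cball p (s / 4). \<rho> q \<in> {..- \<eta>}}"
    have sub: "cball p (s / 4) \<subseteq> ball p s" using s by auto
    have "closed C"
      using continuous_closed_preimage[OF continuous_on_subset[OF \<rho>(1) sub] closed_cball closed_atMost]
      unfolding C_def by (simp add: vimage_def Int_def)
    then have "compact C" using compact_Int_closed[OF compact_cball, of C p "s/4"] by (simp add: C_def Int_absorb1 subset_eq)
    have "C \<subseteq> \<Omega>'" using \<rho>(2) sub \<eta> by (auto simp: C_def)
    then have gC: "g ` C \<subseteq> \<Omega>" "compact (g ` C)"
      using fg(2) \<open>compact C\<close> compact_continuous_image[OF continuous_on_subset[OF holomorphic_map_continuous[OF g]]] by auto
    have "y \<notin> g ` C" using y opn gC(1) by (auto simp: frontier_def interior_open)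
    then obtain d where d: "d > 0" "ball y d \<inter> g ` C = {}"
      using compact_imp_closed[OF gC(2)] by (metis Compl_iff disjoint_eq_subset_Compl open_Compl open_contains_ball_eq)
    have "- \<rho> (f z) < \<eta>" if z: "z \<in> A \<inter> ball y d" for z
    proof (rule ccontr)
      assume "\<not> - \<rho> (f z) < \<eta>"
      then have "f z \<in> C" using cap[of z] z by (auto simp: C_def dist_norm norm_minus_commute)
      then have "g (f z) \<in> g ` C" by blast
      moreover have "g (f z) = z" using fg(3) z A_sub by blast
      ultimately show False using d(2) z by (metis IntD2 IntI empty_iff)
    qed
    then show ?thesis using d(1) by blast
  qed
  obtain R where R: "R > 0" "\<And>w. w \<in> \<Omega>' \<Longrightarrow> norm w \<le> R" using \<Omega>'(1) bounded_pos by metis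
  have single: "vanishes_at A h z0" if z0: "z0 \<in> frontier \<Omega>" and K: "dirs z0 = {K}" for z0 K
  proof -
    obtain e where e: "e \<in> K" "e \<noteq> 0" using ker[OF z0, of K] K by blast
    obtain r where r: "r > 0" and disc: "\<And>z \<xi>. z \<in> \<Omega> \<inter> ball z0 r \<Longrightarrow> norm (\<xi> *s e) < r \<Longrightarrow> z + \<xi> *s e \<in> \<Omega>"
      using disc_in_domain[OF z0 K e(1)] by metis
    define r1 where "r1 = r / norm e"
    have r1: "r1 > 0" using r e by (simp add: r1_def)
    have disc1: "z + \<xi> *s e \<in> \<Omega>" if "z \<in> \<Omega> \<inter> ball z0 r" "cmod \<xi> < r1" for z \<xi>
      using disc[OF that(1), of \<xi>] that(2) e(2) by (simp add: norm_vector_scale r1_def field_simps)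
    define M where "M = real CARD('m) * (3 * R / r1)"
    have M: "M > 0" using R r1 by (simp add: M_def)
    \<comment> \<open>A disc of radius \<open>t\<close> moves the image by at most
      \<open>M t \<le> s / 2\<close>; starting within \<open>s / 4\<close> of \<open>p\<close> it
      stays in \<open>ball p s\<close>, where the support inequality applies.\<close>
    define t where "t = min r1 (s / (2 * M))"
    have t: "t > 0" "t \<le> r1" "M * t \<le> s / 2" using r1 s M by (auto simp: t_def min_def field_simps)
    have lip: "norm (f (z + \<xi> *s e) - f z) \<le> M * cmod \<xi>" if z: "z \<in> \<Omega> \<inter> ball z0 r" and \<xi>: "cmod \<xi> < r1" for z \<xi>
    proof -
      have "norm (f (z + \<xi> *s e) - f z) \<le> (\<Sum>j\<in>UNIV. cmod ((f (z + \<xi> *s e) - f z) $ j))"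
        unfolding norm_vec_def by (rule L2_set_le_sum) simp
      also have "\<dots> \<le> (\<Sum>j\<in>(UNIV :: 'm set). 3 * R * cmod \<xi> / r1)"
      proof (rule sum_mono)
        fix j
        have hol: "(\<lambda>\<xi>. f (z + \<xi> *s e) $ j) holomorphic_on ball 0 r1"
          by (rule holo_on_slice[OF holomorphic_map_component[OF f]]) (use disc1[OF z] in simp)
        have "cmod (f (z + \<xi>' *s e) $ j) \<le> R" if "\<xi>' \<in> ball 0 r1" for \<xi>'
          using R(2)[OF f_in[OF disc1[OF z, of \<xi>']]] Finite_Cartesian_Product.norm_nth_le[of "f (z + \<xi>' *s e)" j] that
          by simp
        then have "cmod (f (z + \<xi> *s e) $ j - f (z + 0 *s e) $ j) \<le> 3 * R * cmod \<xi> / r1"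
          using bounded_holomorphic_lipschitz_at_0[OF hol r1 R(1)] \<xi> by blast
        then show "cmod ((f (z + \<xi> *s e) - f z) $ j) \<le> 3 * R * cmod \<xi> / r1" by simp
      qed
      also have "\<dots> = M * cmod \<xi>" by (simp add: M_def)
      finally show ?thesis .
    qed
    define \<tau> where "\<tau> = complex_of_real (t / 2)"
    have \<tau>: "cmod \<tau> = t / 2" "cmod \<tau> < r1" "\<tau> \<noteq> 0" using t by (auto simp: \<tau>_def)
    \<comment> \<open>\<open>Re lam\<close> is at most \<open>2 (- \<rho> q)\<close>, strictly below
      \<open>D = 3 (- \<rho> q)\<close>, and \<open>lam 0 = 0\<close>; hence
      \<open>cmod (lam \<tau>) \<le> 6 (- \<rho> q)\<close> at half the radius. Inserted into
      \<open>re\<close> at \<open>\<tau>\<close>, this gives the factor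
      \<open>2 + 6 = 8\<close>.\<close>
    have est: "c * (norm (f (z + \<tau> *s e) - f z))\<^sup>2 \<le> 8 * - \<rho> (f z)" if z: "z \<in> A \<inter> ball z0 r" for z
    proof -
      define q where "q = f z"
      have z\<Omega>: "z \<in> \<Omega> \<inter> ball z0 r" using z A_sub by auto
      have q: "q \<in> ball p s" "\<rho> q < 0" "norm (q - p) < s / 4"
        using z cap[of z] \<rho>(2)[of q] f_in[of z] by (auto simp: A_def q_def)
      have in_ball: "f (z + \<xi> *s e) \<in> ball p s" "\<rho> (f (z + \<xi> *s e)) \<le> 0" if \<xi>: "\<xi> \<in> ball 0 t" for \<xi>
      proof -
        have x: "cmod \<xi> < r1" "cmod \<xi> < t" using \<xi> t by auto
        have "M * cmod \<xi> \<le> M * t" using x(2) M by simp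
        then have "M * cmod \<xi> \<le> s / 2" using t(3) by linarith
        then have "norm (f (z + \<xi> *s e) - q) \<le> s / 2" using lip[OF z\<Omega> x(1)] by (simp add: q_def)
        moreover have "norm (f (z + \<xi> *s e) - p) \<le> norm (f (z + \<xi> *s e) - q) + norm (q - p)"
          using norm_triangle_ineq[of "f (z + \<xi> *s e) - q" "q - p"] by simp
        ultimately show 1: "f (z + \<xi> *s e) \<in> ball p s" using q(3) s by (simp add: dist_norm norm_minus_commute[of p])
        show "\<rho> (f (z + \<xi> *s e)) \<le> 0" using \<rho>(2)[OF 1] f_in[OF disc1[OF z\<Omega> x(1)]] by simp
      qed
      define lam where "lam \<xi> = \<Lambda> q (f (z + \<xi> *s e) + (- q))" for \<xi>
      have re: "Re (lam \<xi>) \<le> - 2 * \<rho> q - c * (norm (f (z + \<xi> *s e) - q))\<^sup>2" if "\<xi> \<in> ball 0 t" for \<xi>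
        using ineq[OF q(1) in_ball(1)[OF that] _ in_ball(2)[OF that]] q(2) by (simp add: lam_def)
      have hol: "lam holomorphic_on ball 0 t" unfolding lam_def
      proof (rule holo_on_slice[of "\<lambda>w. \<Lambda> q (f w + (- q))" \<Omega>])
        show "holo_on (\<lambda>w. \<Lambda> q (f w + - q)) \<Omega>"
          by (rule holo_on_compose[OF f holo_on_shift[OF \<Lambda>], of UNIV]) auto
        show "\<And>\<xi>. \<xi> \<in> ball 0 t \<Longrightarrow> z + \<xi> *s e \<in> \<Omega>" using disc1[OF z\<Omega>] t by simp
      qed
      have "cmod (lam \<tau>) \<le> 2 * (3 * - \<rho> q)"
      proof (rule Re_bound_imp_cmod_bound[OF hol t(1)])
        show "lam 0 = 0" using \<Lambda>0 by (simp add: lam_def q_def)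
        show "3 * - \<rho> q > 0" using q(2) by simp
        show "Re (lam \<xi>) < 3 * - \<rho> q" if "\<xi> \<in> ball 0 t" for \<xi>
        proof -
          have "0 \<le> c * (norm (f (z + \<xi> *s e) - q))\<^sup>2" using c by simp
          then show ?thesis using re[OF that] q(2) by linarith
        qed
        show "cmod \<tau> \<le> t / 2" using \<tau> by simp
      qed
      moreover have "\<tau> \<in> ball 0 t" using \<tau>(1) t(1) by simp
      ultimately show ?thesis using re[of \<tau>] abs_Re_le_cmod[of "lam \<tau>"] by (simp add: q_def)
    qed
    \<comment> \<open>A difference at fixed \<open>\<tau>\<close> rather than a derivative:
      \<open>est\<close> and \<open>proper\<close> make it tend to 0 at the frontier, and
      injectivity of \<open>f\<close> makes some component nonzero at every point.\<close>
    define F where "F j z = f (z + \<tau> *s e) $ j + (- 1) * f z $ j" for j z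
    have F_eq: "F j z = (f (z + \<tau> *s e) - f z) $ j" for j z by (simp add: F_def)
    show ?thesis
    proof (rule vanishes_at_single_direction[OF Aopen A_sub holo_on_subset[OF h\<Omega> A_sub] c0 h_le0 inner z0 r finite_class.finite_UNIV])
      fix j :: 'm
      show "holo_on (F j) (A \<inter> ball z0 r)" unfolding F_def
        by (intro holo_on_add holo_on_mult holo_on_const holo_on_shift[OF holomorphic_map_component[OF f]]
              holo_on_subset[OF holomorphic_map_component[OF f]]) (use A_sub disc1 \<tau> in auto)
      show "2 * R > 0" using R by simp
      show "cmod (F j z) \<le> 2 * R" if "z \<in> A \<inter> ball z0 r" for z
      proof -
        have "norm (f (z + \<tau> *s e) - f z) \<le> R + R"
          using norm_triangle_ineq4[of "f (z + \<tau> *s e)" "f z"] R(2)[OF f_in[OF disc1]] R(2)[OF f_in] that A_sub \<tau>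
          by (smt (verit, best) Int_iff subsetD)
        then show ?thesis using Finite_Cartesian_Product.norm_nth_le[of "f (z + \<tau> *s e) - f z" j] by (simp add: F_eq)
      qed
      show "tends_to_zero_at A (F j) y" if y: "y \<in> frontier \<Omega> \<inter> ball z0 r" for y
        unfolding tends_to_zero_at_def
      proof (intro allI impI)
        fix \<eta> :: real assume \<eta>: "\<eta> > 0"
        obtain d1 where d1: "d1 > 0" "\<forall>z\<in>A \<inter> ball y d1. - \<rho> (f z) < c * \<eta>\<^sup>2 / 8" using proper[of y "c * \<eta>\<^sup>2 / 8"] y \<eta> c by auto
        obtain d2 where d2: "d2 > 0" "ball y d2 \<subseteq> ball z0 r" using y by (meson IntD2 openE open_ball)
        have "cmod (F j z) < \<eta>" if z: "z \<in> A \<inter> ball y (min d1 d2)" for z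
        proof -
          have "- \<rho> (f z) < c * \<eta>\<^sup>2 / 8" "z \<in> A \<inter> ball z0 r" using z d1(2) d2 by auto
          then have "c * (norm (f (z + \<tau> *s e) - f z))\<^sup>2 < c * \<eta>\<^sup>2" using est[of z] by linarith
          then have "(norm (f (z + \<tau> *s e) - f z))\<^sup>2 < \<eta>\<^sup>2" using c by simp
          then have "norm (f (z + \<tau> *s e) - f z) < \<eta>" by (rule power2_less_imp_less) (use \<eta> in simp)
          then show ?thesis using Finite_Cartesian_Product.norm_nth_le[of "f (z + \<tau> *s e) - f z" j] by (simp add: F_eq)
        qed
        then show "\<exists>d>0. \<forall>z\<in>A \<inter> ball y d. cmod (F j z) < \<eta>" using d1(1) d2(1) by (intro exI[of _ "min d1 d2"]) auto
      qed
    next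
      fix z assume z: "z \<in> A \<inter> ball z0 r"
      have "f (z + \<tau> *s e) \<noteq> f z"
      proof
        assume "f (z + \<tau> *s e) = f z"
        then have "z + \<tau> *s e = z" using fg(3)[of z] fg(3)[OF disc1[of z \<tau>]] z A_sub \<tau> by auto
        then show False using \<tau>(3) e(2) by simp
      qed
      then show "\<exists>j\<in>UNIV. F j z \<noteq> 0" by (auto simp: F_eq vec_eq_iff)
    qed
  qed
  have van: "vanishes_at A h z" if "z \<in> frontier \<Omega>" for z
    by (rule vanishes_at_frontier[OF Aopen A_sub holo_on_subset[OF h\<Omega> A_sub] c0 h_le0 inner single that])
  have "A = {}"
    by (rule empty_if_vanishes_at_frontier[OF Aopen A_sub holo_on_subset[OF h\<Omega> A_sub] c0 h_le0 inner van bdd])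
       (auto simp: A_def)
  moreover have "A \<noteq> {}"
  proof -
    have "isCont P p" using holo_on_continuous[OF P] by (simp add: continuous_on_eq_continuous_at)
    then obtain d where d: "d > 0" "\<And>w. dist w p < d \<Longrightarrow> dist (P w) (P p) < c0"
      using c0 unfolding continuous_at_eps_delta by metis
    obtain q where q: "q \<in> \<Omega>'" "dist q p < min d s" using \<Omega>'(2) d(1) s closure_approachable[of p \<Omega>'] by (metis min_less_iff_conj)
    have "P p = of_real c0" using \<Lambda>0 by (simp add: P_def)
    then have "Re (P q) > 0" using d(2)[of q] q(2) abs_Re_le_cmod[of "P q - P p"] by (simp add: dist_norm)
    moreover obtain z where "z \<in> \<Omega>" "f z = q" using fg(1) q(1) by blast
    ultimately have "z \<in> A" using q(2) by (auto simp: A_def h_def dist_commute)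
    then show ?thesis by blast
  qed
  ultimately show False by simp
qed

end

subsection \<open>Boundary points with negative Levi form\<close>

text \<open>The quadratic term \<open>\<xi>\<^sup>2 b\<close> cancels the pluriharmonic part of the second order expansion
  of \<open>\<rho>\<close> along \<open>w\<close>, so that only the (negative) Levi form remains.\<close>

lemma pseudoconcave_discs:
  fixes \<rho> :: "complex^'n \<Rightarrow> real"
  assumes V: "open V" "p \<in> V" and d1: "\<forall>x\<in>V. (\<rho> has_derivative blinfun_apply (\<rho>' x)) (at x)"
    and d2: "\<forall>x\<in>V. (\<rho>' has_derivative blinfun_apply (\<rho>'' x)) (at x)"
    and cont: "continuous_on V \<rho>''" and p0: "\<rho> p = 0" and n: "\<rho>' p n = 1"
    and w: "cpart (\<rho>' p) w = 0" "levi_form (\<rho>'' p) w < 0"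
  obtains b \<sigma> where "\<sigma> > 0"
    "\<And>t \<xi>. 0 \<le> t \<Longrightarrow> t \<le> \<sigma> \<Longrightarrow> cmod \<xi> \<le> \<sigma> \<Longrightarrow> t > 0 \<or> \<xi> \<noteq> 0 \<Longrightarrow>
      p - t *\<^sub>R n + \<xi> *s w + \<xi>\<^sup>2 *s b \<in> V \<and> \<rho> (p - t *\<^sub>R n + \<xi> *s w + \<xi>\<^sup>2 *s b) < 0"
proof -
  define A where "A = cpart (\<rho>' p)"
  define B where "B = \<rho>'' p"
  have A: "clinear_form A" unfolding A_def by (rule clinear_form_cpart_blinfun)
  have ReA: "Re (A h) = \<rho>' p h" for h by (simp add: A_def)
  have An: "A n \<noteq> 0" using ReA[of n] n by auto
  define b where "b = (- (1/2) * holo_quad B w / A n) *s n"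
  have Ab: "A b = - (1/2) * holo_quad B w" unfolding b_def clinear_form_scale[OF A] using An by simp
  define l where "l = - levi_form B w"
  have l: "l > 0" using w by (simp add: l_def B_def)
  \<comment> \<open>The budget is \<open>- t - l r^2 / 4\<close> with \<open>r = |\<xi>|\<close>.
    This choice spends at most \<open>l r^2 / 16\<close> on the Taylor remainder along
    \<open>w\<close>.\<close>
  define \<epsilon> where "\<epsilon> = l / (32 * ((norm w)\<^sup>2 + 1))"
  have wpos: "(norm w)\<^sup>2 + 1 > 0" by (simp add: add_nonneg_pos)
  have e: "\<epsilon> > 0" using l wpos by (simp add: \<epsilon>_def)
  have ew: "2 * \<epsilon> * (norm w)\<^sup>2 \<le> l / 16"
  proof -
    have "2 * \<epsilon> * (norm w)\<^sup>2 \<le> 2 * \<epsilon> * ((norm w)\<^sup>2 + 1)" using e by simp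
    also have "\<dots> = l / 16" using wpos by (simp add: \<epsilon>_def field_simps)
    finally show ?thesis .
  qed
  obtain s1 where s1: "s1 > 0" "ball p s1 \<subseteq> V"
    "\<forall>x\<in>ball p s1. \<forall>y\<in>ball p s1. norm (\<rho>' y - \<rho>' x - B (y - x)) \<le> \<epsilon> * norm (y - x)"
    using C2_derivative_expansion[OF V d2 cont e] unfolding B_def by blast
  define N where "N = norm n + norm b + norm w + 1"
  have N: "N > 0" "norm n \<le> N" "norm b \<le> N" "norm w \<le> N" "norm n + norm b + norm w \<le> N"
    by (auto simp: N_def add_nonneg_pos)
  \<comment> \<open>\<open>M\<close> dominates the coefficients of all remaining errors;
    \<open>\<sigma> M\<close> at most \<open>1 / 2\<close> and \<open>l / 16\<close> then leaves
    \<open>- t / 2 - l r^2 / 8\<close>.\<close>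
  define M where "M = norm B * (2 * N\<^sup>2) + 4 * \<epsilon> * (2 * N\<^sup>2) + 1"
  have M: "M > 0" using e by (simp add: M_def add_nonneg_pos)
  define \<sigma> where "\<sigma> = min 1 (min (s1 / (2 * N)) (min (1/2) (l / 16) / M))"
  have \<sigma>: "\<sigma> > 0" "\<sigma> \<le> 1" "\<sigma> \<le> s1 / (2 * N)" "\<sigma> \<le> min (1/2) (l / 16) / M"
    using s1 N M l by (auto simp: \<sigma>_def)
  have \<sigma>M: "\<sigma> * M \<le> 1 / 2" "\<sigma> * M \<le> l / 16"
    using \<sigma>(4) M by (auto simp: pos_le_divide_eq)
  have \<sigma>N: "\<sigma> * N < s1" using \<sigma>(3) N(1) s1(1) by (simp add: field_simps)
  have main: "p + h \<in> ball p s1 \<and> \<rho> (p + h) < 0"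
    if t: "0 \<le> t" "t \<le> \<sigma>" and \<xi>: "cmod \<xi> \<le> \<sigma>" and ne: "t > 0 \<or> \<xi> \<noteq> 0"
      and h: "h = - t *\<^sub>R n + \<xi> *s w + \<xi>\<^sup>2 *s b" for t \<xi> h
  proof -
    define r where "r = cmod \<xi>"
    have r: "0 \<le> r" "r \<le> \<sigma>" "r \<le> 1" using \<xi> \<sigma> by (auto simp: r_def)
    have r2: "r\<^sup>2 \<le> \<sigma>" using r mult_mono[of r \<sigma> r 1] by (simp add: power2_eq_square)
    define u where "u = \<xi> *s w"
    define v where "v = - t *\<^sub>R n + \<xi>\<^sup>2 *s b"
    have huv: "h = u + v" by (simp add: h u_def v_def)
    have u: "norm u = r * norm w" by (simp add: u_def norm_vector_scale r_def)
    have v: "norm v \<le> t * norm n + r\<^sup>2 * norm b"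
    proof -
      have "norm v \<le> norm (- t *\<^sub>R n) + norm (\<xi>\<^sup>2 *s b)" unfolding v_def by (rule norm_triangle_ineq)
      then show ?thesis using t by (simp add: norm_vector_scale norm_power r_def)
    qed
    have vN: "norm v \<le> N * (t + r\<^sup>2)"
    proof -
      have "t * norm n + r\<^sup>2 * norm b \<le> t * N + r\<^sup>2 * N" using N t by (intro add_mono mult_left_mono) auto
      then show ?thesis using v by (simp add: algebra_simps)
    qed
    have uN: "norm u \<le> \<sigma> * N" unfolding u using r N \<sigma> by (intro mult_mono) auto
    have vs: "norm v \<le> \<sigma> * (norm n + norm b)"
    proof -
      have "t * norm n + r\<^sup>2 * norm b \<le> \<sigma> * norm n + \<sigma> * norm b" using t r2 by (intro add_mono mult_right_mono) auto
      then show ?thesis using v by (simp add: algebra_simps)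
    qed
    have vs': "norm v \<le> \<sigma> * N"
    proof -
      have "norm n + norm b \<le> N" by (simp add: N_def)
      then have "\<sigma> * (norm n + norm b) \<le> \<sigma> * N" using \<sigma> by (intro mult_left_mono) auto
      then show ?thesis using vs by linarith
    qed
    have hs: "norm h \<le> \<sigma> * N"
    proof -
      have "norm h \<le> norm u + norm v" unfolding huv by (rule norm_triangle_ineq)
      also have "\<dots> \<le> \<sigma> * norm w + \<sigma> * (norm n + norm b)" using vs r u by (intro add_mono) (auto intro: mult_right_mono)
      also have "\<dots> = \<sigma> * (norm n + norm b + norm w)" by (simp add: algebra_simps)
      also have "\<dots> \<le> \<sigma> * N" using N \<sigma> by (intro mult_left_mono) auto
      finally show ?thesis .
    qed
    then have ball: "p \<in> ball p s1" "p + h \<in> ball p s1" using \<sigma>N s1 by (auto simp: dist_norm)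
    have d1': "\<forall>x\<in>ball p s1. (\<rho> has_derivative \<rho>' x) (at x)" using d1 s1(2) by blast
    have taylor: "\<bar>\<rho> (p + h) - \<rho> p - \<rho>' p h - B h h / 2\<bar> \<le> \<epsilon> * (norm h)\<^sup>2"
      by (rule C2_taylor[OF d1' s1(3) ball]) (use e in simp)
    have lin: "\<rho>' p h = - t - Re (holo_quad B u) / 2"
    proof -
      have "A u = 0" using w(1) by (simp add: u_def clinear_form_scale[OF A]) (simp add: A_def)
      then have "\<rho>' p u = 0" using ReA[of u] by simp
      moreover have "\<rho>' p (\<xi>\<^sup>2 *s b) = - Re (holo_quad B u) / 2"
        using ReA[of "\<xi>\<^sup>2 *s b"] by (simp add: clinear_form_scale[OF A] Ab u_def holo_quad_scale field_simps)
      ultimately show ?thesis using n by (simp add: huv v_def blinfun.add_right blinfun.diff_right blinfun.minus_right blinfun.scaleR_right)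
    qed
    have Buu: "B u u = - l * r\<^sup>2 / 2 + Re (holo_quad B u)"
      using quad_decomposition[of B u] by (simp add: u_def levi_form_scale l_def r_def)
    have Bxy: "\<bar>B x y\<bar> \<le> norm B * (norm x * norm y)" for x y
    proof -
      have "\<bar>B x y\<bar> \<le> norm (B x) * norm y" by (metis norm_blinfun real_norm_def)
      also have "\<dots> \<le> (norm B * norm x) * norm y" by (intro mult_right_mono norm_blinfun) auto
      finally show ?thesis by (simp add: mult.assoc)
    qed
    have prod: "norm u * norm v \<le> (\<sigma> * N) * (N * (t + r\<^sup>2))" "norm v * norm v \<le> (\<sigma> * N) * (N * (t + r\<^sup>2))"
      using uN vs' vN N \<sigma> t by (auto intro!: mult_mono)
    \<comment> \<open>\<open>v\<close> is of order \<open>t + r^2\<close>, so its products with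
      \<open>u\<close> or \<open>v\<close> gain a further factor \<open>\<sigma>\<close> and are
      small against the budget.\<close>
    define m where "m = \<sigma> * (t + r\<^sup>2)"
    have m: "m \<ge> 0" using \<sigma> t by (simp add: m_def)
    have pm: "(\<sigma> * N) * (N * (t + r\<^sup>2)) = N\<^sup>2 * m" by (simp add: m_def power2_eq_square)
    have cross: "\<bar>B h h - B u u\<bar> \<le> norm B * (3 * (N\<^sup>2 * m))"
    proof -
      have "B h h - B u u = B u v + B v u + B v v" by (simp add: huv blinfun.add_left blinfun.add_right)
      then have "\<bar>B h h - B u u\<bar> \<le> norm B * (norm u * norm v) + norm B * (norm v * norm u) + norm B * (norm v * norm v)"
        using Bxy[of u v] Bxy[of v u] Bxy[of v v] by linarith
      also have "\<dots> = norm B * (norm u * norm v + norm u * norm v + norm v * norm v)" by (simp add: algebra_simps)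
      also have "\<dots> \<le> norm B * (3 * (N\<^sup>2 * m))" using prod unfolding pm by (intro mult_left_mono) auto
      finally show ?thesis .
    qed
    have "(norm h)\<^sup>2 \<le> 2 * (norm u)\<^sup>2 + 2 * (norm v)\<^sup>2"
    proof -
      have "(norm h)\<^sup>2 \<le> (norm u + norm v)\<^sup>2" unfolding huv by (intro power_mono norm_triangle_ineq) auto
      also have "\<dots> \<le> 2 * (norm u)\<^sup>2 + 2 * (norm v)\<^sup>2" using sum_squares_bound[of "norm u" "norm v"] by (simp add: power2_sum)
      finally show ?thesis .
    qed
    also have "\<dots> \<le> 2 * (r\<^sup>2 * (norm w)\<^sup>2) + 2 * (N\<^sup>2 * m)"
      using prod(2) unfolding pm by (simp add: u power_mult_distrib power2_eq_square)
    finally have "\<epsilon> * (norm h)\<^sup>2 \<le> \<epsilon> * (2 * (r\<^sup>2 * (norm w)\<^sup>2) + 2 * (N\<^sup>2 * m))" using e by (intro mult_left_mono) auto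
    also have "\<dots> = (2 * \<epsilon> * (norm w)\<^sup>2) * r\<^sup>2 + 2 * \<epsilon> * (N\<^sup>2 * m)" by (simp add: algebra_simps)
    also have "\<dots> \<le> l / 16 * r\<^sup>2 + 2 * \<epsilon> * (N\<^sup>2 * m)" using ew by (intro add_right_mono mult_right_mono) auto
    finally have eh: "\<epsilon> * (norm h)\<^sup>2 \<le> l / 16 * r\<^sup>2 + 2 * \<epsilon> * (N\<^sup>2 * m)" .
    have "norm B * (3 * (N\<^sup>2 * m)) / 2 + 2 * \<epsilon> * (N\<^sup>2 * m) \<le> M * m"
    proof -
      have "M * m = norm B * (2 * (N\<^sup>2 * m)) + 8 * \<epsilon> * (N\<^sup>2 * m) + m" by (simp add: M_def algebra_simps)
      moreover have "norm B * (3 * (N\<^sup>2 * m)) / 2 \<le> norm B * (2 * (N\<^sup>2 * m))" using m by (simp add: mult_left_mono)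
      moreover have "0 \<le> \<epsilon> * (N\<^sup>2 * m)" using m e by simp
      ultimately show ?thesis using m by linarith
    qed
    also have "M * m = (\<sigma> * M) * t + (\<sigma> * M) * r\<^sup>2" by (simp add: m_def algebra_simps)
    also have "\<dots> \<le> 1 / 2 * t + l / 16 * r\<^sup>2" using \<sigma>M t by (intro add_mono mult_right_mono) auto
    finally have "\<rho> (p + h) \<le> - t / 2 - l / 8 * r\<^sup>2"
      using taylor cross eh unfolding lin p0 Buu by (auto simp: abs_le_iff algebra_simps)
    moreover have "- t / 2 - l / 8 * r\<^sup>2 < 0"
    proof -
      have "0 \<le> l / 8 * r\<^sup>2" using l by simp
      moreover have "0 < l / 8 * r\<^sup>2" if "\<xi> \<noteq> 0" using l that by (simp add: r_def)
      ultimately show ?thesis using ne t(1) by (cases "t > 0") auto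
    qed
    ultimately show ?thesis using ball by simp
  qed
  show ?thesis
  proof (rule that[OF \<sigma>(1), of b])
    fix t \<xi> assume "0 \<le> t" "t \<le> \<sigma>" "cmod \<xi> \<le> \<sigma>" "t > 0 \<or> \<xi> \<noteq> 0"
    from main[OF this refl] show "p - t *\<^sub>R n + \<xi> *s w + \<xi>\<^sup>2 *s b \<in> V \<and> \<rho> (p - t *\<^sub>R n + \<xi> *s w + \<xi>\<^sup>2 *s b) < 0"
      using s1(2) by (auto simp: algebra_simps)
  qed
qed

lemma holo_on_disc_map:
  assumes h: "holo_on h S" and sub: "\<And>\<xi>. \<xi> \<in> T \<Longrightarrow> a + \<xi> *s w + \<xi>\<^sup>2 *s b \<in> S"
  shows "(\<lambda>\<xi>. h (a + \<xi> *s w + \<xi>\<^sup>2 *s b)) holomorphic_on T"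
  unfolding holomorphic_on_def
proof
  fix \<xi> assume "\<xi> \<in> T"
  then obtain D where D: "(h has_derivative D) (at (a + \<xi> *s w + \<xi>\<^sup>2 *s b))" "clinear_form D"
    using assms unfolding holo_on_def by blast
  have sq: "((\<lambda>\<xi>. \<xi>\<^sup>2) has_derivative (\<lambda>k. 2 * \<xi> * k)) (at \<xi> within T)"
    by (auto intro!: derivative_eq_intros simp: power2_eq_square)
  have "((\<lambda>\<xi>. a + \<xi> *s w + \<xi>\<^sup>2 *s b) has_derivative (\<lambda>k. k *s w + (2 * \<xi> * k) *s b)) (at \<xi> within T)"
    by (rule has_derivative_add[OF has_derivative_slice bounded_linear.has_derivative[OF bounded_linear_vector_scale_left sq]])
  then have "((\<lambda>\<xi>. h (a + \<xi> *s w + \<xi>\<^sup>2 *s b)) has_derivative (\<lambda>k. D (k *s w + (2 * \<xi> * k) *s b))) (at \<xi> within T)"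
    by (rule has_derivative_compose[where f = "\<lambda>\<xi>. a + \<xi> *s w + \<xi>\<^sup>2 *s b", OF _ D(1)])
  moreover have "(\<lambda>k. D (k *s w + (2 * \<xi> * k) *s b)) = (*) (D w + 2 * \<xi> * D b)"
    by (auto simp: clinear_form_scale[OF D(2)] clinear_form_add[OF D(2)] algebra_simps)
  ultimately show "(\<lambda>\<xi>. h (a + \<xi> *s w + \<xi>\<^sup>2 *s b)) field_differentiable at \<xi> within T"
    unfolding field_differentiable_def has_field_derivative_def by metis
qed

text \<open>\<open>g\<close> sends the boundary circles into a compact subset of
  \<open>\<Omega>\<close>, at distance \<open>\<epsilon>\<close> from the complement, while the
  image \<open>z\<close> of a centre close to \<open>p\<close> comes within
  \<open>\<epsilon>\<close> of some frontier point \<open>y\<close>. A supporting form at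
  \<open>y\<close> then takes a larger real part at \<open>z\<close> than on the whole image circle,
  which the maximum principle forbids.\<close>

lemma (in flat_support) no_pseudoconcave_image:
  fixes f :: "complex^'n \<Rightarrow> complex^'m" and g :: "complex^'m \<Rightarrow> complex^'n"
  assumes bdd: "bounded \<Omega>"
    and f: "holomorphic_map f \<Omega>" and g: "holomorphic_map g \<Omega>'"
    and fg: "f ` \<Omega> = \<Omega>'" "g ` \<Omega>' = \<Omega>" "\<And>w. w \<in> \<Omega>' \<Longrightarrow> f (g w) = w"
    and p: "p \<notin> \<Omega>'" and \<sigma>: "\<sigma> > 0"
    and discs: "\<And>t \<xi>. 0 \<le> t \<Longrightarrow> t \<le> \<sigma> \<Longrightarrow> cmod \<xi> \<le> \<sigma> \<Longrightarrow> t > 0 \<or> \<xi> \<noteq> 0 \<Longrightarrow> p - t *\<^sub>R n + \<xi> *s w + \<xi>\<^sup>2 *s b \<in> \<Omega>'"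
  shows False
proof -
  define \<gamma> where "\<gamma> = (\<lambda>(t, \<xi>). p - t *\<^sub>R n + \<xi> *s w + \<xi>\<^sup>2 *s b)"
  have \<gamma>_cont: "continuous_on S \<gamma>" for S
    unfolding \<gamma>_def case_prod_unfold
    by (intro continuous_intros bounded_linear.continuous_on[OF bounded_linear_vector_scale_left])
  \<comment> \<open>\<open>t = 0\<close> is included, which makes \<open>C\<close> compact: by
    \<open>discs\<close> the limit disc can leave \<open>\<Omega>'\<close> only at its
    centre.\<close>
  define C where "C = \<gamma> ` ({0..\<sigma>} \<times> sphere 0 \<sigma>)"
  have C: "compact C" unfolding C_def by (intro compact_continuous_image \<gamma>_cont compact_Times) auto
  have "C \<subseteq> \<Omega>'" using discs \<sigma> by (auto simp: C_def \<gamma>_def)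
  have g_cont: "continuous_on \<Omega>' g" and f_cont: "continuous_on \<Omega> f" using f g holomorphic_map_continuous by auto
  have gC: "compact (g ` C)" "g ` C \<subseteq> \<Omega>"
    using compact_continuous_image[OF continuous_on_subset[OF g_cont \<open>C \<subseteq> \<Omega>'\<close>] C] fg(2) \<open>C \<subseteq> \<Omega>'\<close> by auto
  obtain \<epsilon> where \<epsilon>: "\<epsilon> > 0" "(\<Union>x\<in>g ` C. ball x \<epsilon>) \<subseteq> \<Omega>"
    using compact_subset_open_imp_ball_epsilon_subset[OF gC(1) opn gC(2)] by blast
  define D where "D = {z \<in> closure \<Omega>. \<forall>y\<in>frontier \<Omega>. \<epsilon> \<le> dist z y}"
  have D_sub: "D \<subseteq> \<Omega>"
  proof
    fix z assume z: "z \<in> D"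
    then have "z \<notin> frontier \<Omega>" using \<epsilon>(1) by (auto simp: D_def)
    then show "z \<in> \<Omega>" using z opn by (auto simp: D_def frontier_def interior_open)
  qed
  have "compact D"
  proof -
    have "closed {z. \<forall>y\<in>frontier \<Omega>. \<epsilon> \<le> dist z y}"
      unfolding Ball_def by (intro closed_Collect_all closed_Collect_imp open_Collect_const closed_Collect_le continuous_intros)
    moreover have "compact (closure \<Omega>)" using bdd by (simp add: compact_closure)
    ultimately show ?thesis unfolding D_def using compact_Int_closed by (auto simp: Collect_conj_eq)
  qed
  have "compact (f ` D)" by (rule compact_continuous_image[OF continuous_on_subset[OF f_cont D_sub] \<open>compact D\<close>])
  moreover have "p \<notin> f ` D" using p D_sub fg(1) by auto
  ultimately obtain d where d: "d > 0" "ball p d \<inter> f ` D = {}"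
    using compact_imp_closed by (metis Compl_iff disjoint_eq_subset_Compl open_Compl open_contains_ball_eq)
  define k where "k = norm n + 1"
  have np: "k > 0" "norm n \<le> k" by (simp_all add: k_def add_nonneg_pos)
  define t where "t = min \<sigma> (d / (2 * k))"
  have t: "t > 0" "t \<le> \<sigma>" using \<sigma> d(1) np by (auto simp: t_def)
  define q where "q = p - t *\<^sub>R n"
  have q: "q \<in> \<Omega>'" using discs[of t 0] t \<sigma> by (simp add: q_def)
  have "dist p q < d"
  proof -
    have "dist p q = t * norm n" using t by (simp add: q_def dist_norm)
    also have "\<dots> \<le> d / (2 * k) * k" using t np d(1) by (intro mult_mono) (auto simp: t_def)
    also have "\<dots> < d" using np d(1) by simp
    finally show ?thesis .
  qed
  then have "q \<notin> f ` D" using d(2) by auto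
  define z where "z = g q"
  have z: "z \<in> \<Omega>" using fg(2) q by (auto simp: z_def)
  have "z \<notin> D" using \<open>q \<notin> f ` D\<close> fg(3)[OF q] by (metis image_eqI z_def)
  then obtain y where y: "y \<in> frontier \<Omega>" "dist z y < \<epsilon>"
    using z closure_subset[of \<Omega>] by (auto simp: D_def not_le)
  obtain i where i: "i \<in> Act y" using act[OF y(1)] by blast
  note l = lin[OF y(1) i]
  \<comment> \<open>Translation by \<open>y - z\<close>, shorter than \<open>\<epsilon>\<close>,
    keeps \<open>x\<close> in \<open>\<Omega>\<close> and moves the comparison point from
    \<open>y\<close> to \<open>z\<close>.\<close>
  have neg: "Re (a i y (x + (- z))) < 0" if x: "x \<in> g ` C" for x
  proof -
    have "x + (y - z) \<in> ball x \<epsilon>" using y(2) by (simp add: dist_norm norm_minus_commute)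
    then have "x + (y - z) \<in> \<Omega>" using \<epsilon>(2) x by blast
    then have "Re (a i y (x + (y - z) - y)) < 0" by (rule supp[OF y(1) i])
    then show ?thesis by simp
  qed
  define G where "G \<xi> = exp (a i y (g (q + \<xi> *s w + \<xi>\<^sup>2 *s b) + (- z)))" for \<xi>
  have in\<Omega>': "q + \<xi> *s w + \<xi>\<^sup>2 *s b \<in> \<Omega>'" if "\<xi> \<in> cball 0 \<sigma>" for \<xi>
    using discs[of t \<xi>] t that by (simp add: q_def)
  have G_hol: "G holomorphic_on cball 0 \<sigma>"
    unfolding G_def
  proof (intro holomorphic_intros holo_on_disc_map[of "\<lambda>x. a i y (g x + (- z))" \<Omega>'])
    show "holo_on (\<lambda>x. a i y (g x + - z)) \<Omega>'"
      by (rule holo_on_compose[OF g holo_on_shift[OF holo_on_clinear_form[OF l, of UNIV]], of UNIV]) auto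
  qed (rule in\<Omega>')
  have "sphere (0 :: complex) \<sigma> \<noteq> {}" using \<sigma> by simp
  then obtain \<xi>0 where \<xi>0: "\<xi>0 \<in> sphere 0 \<sigma>" "\<And>\<xi>. \<xi> \<in> sphere 0 \<sigma> \<Longrightarrow> cmod (G \<xi>) \<le> cmod (G \<xi>0)"
    using continuous_attains_sup[OF compact_sphere, of 0 \<sigma> "\<lambda>\<xi>. cmod (G \<xi>)"]
      continuous_on_norm[OF continuous_on_subset[OF holomorphic_on_imp_continuous_on[OF G_hol] sphere_cball]] by metis
  have "cmod (G 0) \<le> cmod (G \<xi>0)"
  proof (rule maximum_modulus_frontier[of G "ball 0 \<sigma>"])
    show "G holomorphic_on interior (ball 0 \<sigma>)" using holomorphic_on_subset[OF G_hol] by (simp add: ball_subset_cball)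
    show "continuous_on (closure (ball 0 \<sigma>)) G" using holomorphic_on_imp_continuous_on[OF G_hol] \<sigma> by simp
    show "cmod (G \<xi>) \<le> cmod (G \<xi>0)" if "\<xi> \<in> frontier (ball 0 \<sigma>)" for \<xi> using that \<xi>0(2) \<sigma> by simp
  qed (use \<sigma> in auto)
  moreover have "G 0 = 1" by (simp add: G_def z_def clinear_form_zero[OF l])
  moreover have "cmod (G \<xi>0) < 1"
  proof -
    have "q + \<xi>0 *s w + \<xi>0\<^sup>2 *s b = \<gamma> (t, \<xi>0)" by (simp add: \<gamma>_def q_def)
    moreover have "(t, \<xi>0) \<in> {0..\<sigma>} \<times> sphere 0 \<sigma>" using t \<xi>0(1) by simp
    ultimately have "g (q + \<xi>0 *s w + \<xi>0\<^sup>2 *s b) \<in> g ` C" unfolding C_def by (metis imageI)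
    then show ?thesis using neg by (simp add: G_def)
  qed
  ultimately show False by simp
qed

subsection \<open>Convex Levi flat hypersurfaces\<close>

text \<open>Cramer's rule: the dual vectors are the rows of the adjugate matrix divided by the determinant.\<close>

lemma wedge_nonzero_dual:
  fixes \<omega>s :: "('a::real_vector \<Rightarrow> real) list"
  assumes lin: "\<And>\<omega>. \<omega> \<in> set \<omega>s \<Longrightarrow> linear \<omega>" and nz: "wedge \<omega>s \<noteq> (\<lambda>v. 0)"
  obtains x where "\<And>i j. i < length \<omega>s \<Longrightarrow> j < length \<omega>s \<Longrightarrow> (\<omega>s ! j) (x i) = (if i = j then 1 else 0)"
proof -
  obtain v where v: "wedge \<omega>s v \<noteq> 0" using nz by auto
  define n where "n = length \<omega>s"
  define W where "W = wedge \<omega>s v"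
  define Perms where "Perms = {\<sigma>. \<sigma> permutes {..<n}}"
  define T where "T i \<sigma> = of_int (sign \<sigma>) * (\<Prod>a\<in>{..<n} - {i}. (\<omega>s ! a) (v (\<sigma> a)))" for i \<sigma>
  define x where "x i = (1 / W) *\<^sub>R (\<Sum>\<sigma>\<in>Perms. T i \<sigma> *\<^sub>R v (\<sigma> i))" for i
  have expand: "(\<omega>s ! j) (x i) = (\<Sum>\<sigma>\<in>Perms. T i \<sigma> * (\<omega>s ! j) (v (\<sigma> i))) / W" if "j < n" for i j
  proof -
    have l: "linear (\<omega>s ! j)" using lin that by (simp add: n_def)
    show ?thesis by (simp add: x_def linear_scale[OF l] linear_sum[OF l])
  qed
  have diag: "(\<omega>s ! i) (x i) = 1" if "i < n" for i
  proof -
    have "T i \<sigma> * (\<omega>s ! i) (v (\<sigma> i)) = of_int (sign \<sigma>) * (\<Prod>a<n. (\<omega>s ! a) (v (\<sigma> a)))" for \<sigma>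
      using that by (simp add: T_def prod.remove[of "{..<n}" i] mult_ac)
    then have "(\<Sum>\<sigma>\<in>Perms. T i \<sigma> * (\<omega>s ! i) (v (\<sigma> i))) = W"
      by (simp add: W_def wedge_def Perms_def n_def)
    then show ?thesis using expand[OF that, of i] v by (simp add: W_def)
  qed
  \<comment> \<open>Expansion of a determinant with two equal rows: composing with the transposition
    of \<open>i\<close> and \<open>j\<close> negates every summand.\<close>
  have off: "(\<omega>s ! j) (x i) = 0" if "i < n" "j < n" "i \<noteq> j" for i j
  proof -
    define \<tau> where "\<tau> = Transposition.transpose i j"
    have \<tau>: "\<tau> permutes {..<n}" unfolding \<tau>_def using that by (simp add: permutes_swap_id)
    define S where "S \<sigma> = T i \<sigma> * (\<omega>s ! j) (v (\<sigma> i))" for \<sigma>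
    have swap: "S (\<sigma> \<circ> \<tau>) = - S \<sigma>" if \<sigma>: "\<sigma> \<in> Perms" for \<sigma>
    proof -
      have "sign (\<sigma> \<circ> \<tau>) = - sign \<sigma>"
        using \<sigma> \<tau> \<open>i \<noteq> j\<close> by (simp add: sign_compose permutes_imp_permutation[of "{..<n}"] Perms_def sign_swap_id \<tau>_def)
      moreover have "S \<sigma> = of_int (sign \<sigma>) * (\<Prod>a\<in>{..<n} - {i} - {j}. (\<omega>s ! a) (v (\<sigma> a))) * ((\<omega>s ! j) (v (\<sigma> j)) * (\<omega>s ! j) (v (\<sigma> i)))" for \<sigma>
        using \<open>i < n\<close> \<open>j < n\<close> \<open>i \<noteq> j\<close> by (simp add: S_def T_def prod.remove[of "{..<n} - {i}" j] mult_ac)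
      moreover have "(\<Prod>a\<in>{..<n} - {i} - {j}. (\<omega>s ! a) (v ((\<sigma> \<circ> \<tau>) a))) = (\<Prod>a\<in>{..<n} - {i} - {j}. (\<omega>s ! a) (v (\<sigma> a)))"
        by (rule prod.cong) (auto simp: \<tau>_def Transposition.transpose_def)
      moreover have "(\<sigma> \<circ> \<tau>) i = \<sigma> j" "(\<sigma> \<circ> \<tau>) j = \<sigma> i" by (simp_all add: \<tau>_def)
      ultimately show ?thesis by simp
    qed
    have "(\<Sum>\<sigma>\<in>Perms. S \<sigma>) = (\<Sum>\<sigma>\<in>Perms. S (\<sigma> \<circ> \<tau>))"
      unfolding Perms_def by (rule sum_permutations_compose_right[OF \<tau>])
    also have "\<dots> = - (\<Sum>\<sigma>\<in>Perms. S \<sigma>)" by (simp add: swap sum_negf)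
    finally have "(\<Sum>\<sigma>\<in>Perms. S \<sigma>) = 0" by simp
    then show ?thesis using expand[OF \<open>j < n\<close>, of i] by (simp add: S_def)
  qed
  show ?thesis by (rule that[of x]) (use diag off in \<open>auto simp: n_def\<close>)
qed

text \<open>If \<open>L (y - z)\<close> were positive, \<open>\<rho>\<close> would increase at the
  start of the segment from \<open>z\<close> to \<open>y\<close>, although its points other than
  \<open>z\<close> lie in \<open>S\<close>. When \<open>L\<close> is nonzero the inequality is
  strict, because \<open>y\<close> can be moved a little along \<open>n\<close> within
  \<open>S\<close>.\<close>

lemma convex_support_derivative:
  fixes \<rho> :: "'a::euclidean_space \<Rightarrow> real"
  assumes S: "open S" "convex S" and z: "z \<in> closure S" "\<rho> z = 0" and d: "(\<rho> has_derivative L) (at z)"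
    and neg: "\<And>x. x \<in> S \<Longrightarrow> \<rho> x < 0" and y: "y \<in> S"
  shows "L (y - z) \<le> 0" and "L n = 1 \<Longrightarrow> L (y - z) < 0"
proof -
  have lin: "linear L" using d has_derivative_linear by blast
  have le: "L (y - z) \<le> 0" if y: "y \<in> S" for y
  proof (rule ccontr)
    assume "\<not> L (y - z) \<le> 0"
    then have pos: "L (y - z) > 0" by simp
    have "((\<lambda>t. z + t *\<^sub>R (y - z)) has_derivative (\<lambda>k. k *\<^sub>R (y - z))) (at 0)"
      by (auto intro!: derivative_eq_intros)
    moreover have "(\<rho> has_derivative L) (at (z + 0 *\<^sub>R (y - z)))" using d by simp
    ultimately have "((\<lambda>t. \<rho> (z + t *\<^sub>R (y - z))) has_derivative (\<lambda>k. L (k *\<^sub>R (y - z)))) (at 0)"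
      by (rule has_derivative_compose[where f = "\<lambda>t. z + t *\<^sub>R (y - z)"])
    moreover have "(\<lambda>k. L (k *\<^sub>R (y - z))) = (\<lambda>k. k * L (y - z))" by (simp add: linear_scale[OF lin])
    moreover have "(\<lambda>k. k * L (y - z)) = (*) (L (y - z))" by (simp add: fun_eq_iff)
    ultimately have "((\<lambda>t. \<rho> (z + t *\<^sub>R (y - z))) has_real_derivative L (y - z)) (at 0)"
      by (simp add: has_field_derivative_def)
    then obtain e where e: "e > 0" "\<And>h. 0 < h \<Longrightarrow> h < e \<Longrightarrow> \<rho> (z + 0 *\<^sub>R (y - z)) < \<rho> (z + (0 + h) *\<^sub>R (y - z))"
      using DERIV_pos_inc_right[OF _ pos] by blast
    define h where "h = min 1 (e / 2)"
    have h: "0 < h" "h \<le> 1" "h < e" using e(1) by (auto simp: h_def)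
    have "z - h *\<^sub>R (z - y) \<in> interior S"
      by (rule mem_interior_closure_convex_shrink[OF S(2)]) (use y z h S(1) in \<open>auto simp: interior_open\<close>)
    then have "z + h *\<^sub>R (y - z) \<in> S" using S(1) by (simp add: interior_open algebra_simps)
    then have "\<rho> (z + h *\<^sub>R (y - z)) < 0" by (rule neg)
    then show False using e(2)[OF h(1,3)] z(2) by simp
  qed
  show "L (y - z) \<le> 0" by (rule le[OF y])
  show "L (y - z) < 0" if n: "L n = 1"
  proof -
    obtain e where e: "e > 0" "ball y e \<subseteq> S" using S(1) y openE by blast
    define k where "k = e / (2 * (norm n + 1))"
    have np: "norm n + 1 > 0" by (simp add: add_nonneg_pos)
    have k: "k > 0" using e(1) np by (simp add: k_def)
    have "norm (k *\<^sub>R n) \<le> k * (norm n + 1)" using k by simp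
    also have "\<dots> = e / 2" using np by (simp add: k_def divide_simps)
    finally have "y + k *\<^sub>R n \<in> ball y e" using e(1) by (simp add: dist_norm)
    then have "L (y + k *\<^sub>R n - z) \<le> 0" using le e(2) by blast
    moreover have "y + k *\<^sub>R n - z = (y - z) + k *\<^sub>R n" by simp
    ultimately show ?thesis using k n by (simp add: linear_add[OF lin] linear_scale[OF lin])
  qed
qed

text \<open>If \<open>B h h = - 4 \<kappa> < 0\<close>, the point
  \<open>z + t h + \<kappa> t^2 n\<close> has \<open>\<rho>\<close> close to
  \<open>\<kappa> t^2 - 2 \<kappa> t^2 < 0\<close> and lies in \<open>S\<close>, yet on the wrong
  side of the supporting hyperplane, since \<open>\<rho>' z\<close> equals
  \<open>\<kappa> t^2 > 0\<close> on the displacement.\<close>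

lemma convex_hessian_nonneg:
  fixes \<rho> :: "'a::euclidean_space \<Rightarrow> real"
  assumes S: "open S" "convex S" and N: "open N" "z \<in> N" "S \<inter> N = {x \<in> N. \<rho> x < 0}"
    and z: "z \<in> closure S" "\<rho> z = 0" and neg: "\<And>x. x \<in> S \<Longrightarrow> \<rho> x < 0"
    and d1: "\<forall>x\<in>N. (\<rho> has_derivative blinfun_apply (\<rho>' x)) (at x)"
    and d2: "\<forall>x\<in>N. (\<rho>' has_derivative blinfun_apply (\<rho>'' x)) (at x)" and cont: "continuous_on N \<rho>''"
    and n: "\<rho>' z n = 1" and h: "\<rho>' z h = 0"
  shows "blinfun_apply (blinfun_apply (\<rho>'' z) h) h \<ge> 0"
proof (rule ccontr)
  define B where "B = \<rho>'' z"
  assume "\<not> ?thesis"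
  then have Bneg: "B h h < 0" by (simp add: B_def)
  define \<kappa> where "\<kappa> = - B h h / 4"
  have \<kappa>: "\<kappa> > 0" using Bneg by (simp add: \<kappa>_def)
  define m where "m = norm h + \<kappa> * norm n + 1"
  have m: "m > 0" using \<kappa> by (simp add: m_def add_nonneg_pos)
  define \<epsilon> where "\<epsilon> = \<kappa> / (4 * m\<^sup>2)"
  have e: "\<epsilon> > 0" "\<epsilon> * m\<^sup>2 = \<kappa> / 4" using \<kappa> m by (simp_all add: \<epsilon>_def)
  obtain s where s: "s > 0" "ball z s \<subseteq> N"
    "\<forall>x\<in>ball z s. \<forall>y\<in>ball z s. norm (\<rho>' y - \<rho>' x - B (y - x)) \<le> \<epsilon> * norm (y - x)"
    using C2_derivative_expansion[OF N(1,2) d2 cont e(1)] unfolding B_def by blast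
  define C where "C = norm B * (3 * m\<^sup>2) + 1"
  have C: "C > 0" by (simp add: C_def add_nonneg_pos)
  define t where "t = min 1 (min (s / (2 * m)) (\<kappa> / (2 * C)))"
  have t: "t > 0" "t \<le> 1" "t \<le> s / (2 * m)" "t \<le> \<kappa> / (2 * C)" using s m \<kappa> C by (auto simp: t_def)
  define u where "u = t *\<^sub>R h"
  define v where "v = (\<kappa> * t\<^sup>2) *\<^sub>R n"
  define k where "k = u + v"
  have t2: "t\<^sup>2 \<le> t" using t by (simp add: power2_eq_square mult_left_le)
  have u: "norm u \<le> t * m" using t \<kappa> by (simp add: u_def m_def)
  have v: "norm v \<le> t\<^sup>2 * m" using t \<kappa> by (simp add: v_def m_def algebra_simps)
  have k: "norm k \<le> t * m"
  proof -
    have "norm k \<le> norm u + norm v" unfolding k_def by (rule norm_triangle_ineq)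
    also have "\<dots> = t * norm h + t\<^sup>2 * (\<kappa> * norm n)" using t \<kappa> by (simp add: u_def v_def mult_ac)
    also have "\<dots> \<le> t * norm h + t * (\<kappa> * norm n)" using t2 \<kappa> by (intro add_left_mono mult_right_mono) auto
    also have "\<dots> \<le> t * m" using t by (simp add: m_def algebra_simps)
    finally show ?thesis .
  qed
  have "t * m \<le> s / 2" using t(3) m by (simp add: field_simps)
  then have zk: "z \<in> ball z s" "z + k \<in> ball z s" using k s(1) by (auto simp: dist_norm)
  have d1': "\<forall>x\<in>ball z s. (\<rho> has_derivative \<rho>' x) (at x)" using d1 s(2) by blast
  have taylor: "\<bar>\<rho> (z + k) - \<rho> z - \<rho>' z k - B k k / 2\<bar> \<le> \<epsilon> * (norm k)\<^sup>2"
    by (rule C2_taylor[OF d1' s(3) zk]) (use e in simp)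
  have lin: "\<rho>' z k = \<kappa> * t\<^sup>2" using n h by (simp add: k_def u_def v_def blinfun.add_right blinfun.scaleR_right)
  have Bxy: "B x y \<le> norm B * (norm x * norm y)" for x y
  proof -
    have "\<bar>B x y\<bar> \<le> norm (B x) * norm y" by (metis norm_blinfun real_norm_def)
    also have "\<dots> \<le> (norm B * norm x) * norm y" by (intro mult_right_mono norm_blinfun) auto
    finally show ?thesis by (simp add: mult.assoc)
  qed
  have Bkk: "B k k \<le> - 4 * \<kappa> * t\<^sup>2 + C * t * t\<^sup>2"
  proof -
    have prods: "norm u * norm v \<le> (t * m) * (t\<^sup>2 * m)" "norm v * norm v \<le> (t * m) * (t\<^sup>2 * m)"
    proof -
      show "norm u * norm v \<le> (t * m) * (t\<^sup>2 * m)" using u v t m by (intro mult_mono) auto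
      have "t\<^sup>2 * m \<le> t * m" using t2 m by simp
      then have "norm v \<le> t * m" using v by linarith
      then show "norm v * norm v \<le> (t * m) * (t\<^sup>2 * m)" using v t m by (intro mult_mono) auto
    qed
    have "B k k = B u u + B u v + B v u + B v v" by (simp add: k_def blinfun.add_left blinfun.add_right)
    also have "B u u = - 4 * \<kappa> * t\<^sup>2" by (simp add: u_def \<kappa>_def blinfun.scaleR_left blinfun.scaleR_right power2_eq_square)
    finally have "B k k \<le> - 4 * \<kappa> * t\<^sup>2 + norm B * (norm u * norm v) + norm B * (norm v * norm u) + norm B * (norm v * norm v)"
      using Bxy[of u v] Bxy[of v u] Bxy[of v v] by linarith
    also have "\<dots> = - 4 * \<kappa> * t\<^sup>2 + norm B * (norm u * norm v + norm u * norm v + norm v * norm v)" by (simp add: algebra_simps)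
    also have "\<dots> \<le> - 4 * \<kappa> * t\<^sup>2 + norm B * (3 * ((t * m) * (t\<^sup>2 * m)))"
      using prods by (intro add_left_mono mult_left_mono) auto
    also have "norm B * (3 * ((t * m) * (t\<^sup>2 * m))) = (norm B * (3 * m\<^sup>2)) * (t * t\<^sup>2)" by (simp add: power2_eq_square)
    also have "\<dots> \<le> C * (t * t\<^sup>2)" using t by (intro mult_right_mono) (auto simp: C_def)
    finally show ?thesis by (simp add: mult.assoc)
  qed
  have "\<epsilon> * (norm k)\<^sup>2 \<le> \<epsilon> * (t * m)\<^sup>2" using k e(1) by (intro mult_left_mono power_mono) auto
  also have "\<dots> = \<kappa> / 4 * t\<^sup>2" using e(2) by (simp add: power_mult_distrib)
  finally have ek: "\<epsilon> * (norm k)\<^sup>2 \<le> \<kappa> / 4 * t\<^sup>2" .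
  have "C * t \<le> \<kappa> / 2" using t(4) C by (simp add: field_simps)
  then have "C * t * t\<^sup>2 \<le> \<kappa> / 2 * t\<^sup>2" by (rule mult_right_mono) simp
  then have "\<rho> (z + k) \<le> - \<kappa> * t\<^sup>2 / 2" using taylor lin Bkk ek z(2) by (auto simp: abs_le_iff)
  moreover have "\<kappa> * t\<^sup>2 > 0" using \<kappa> t by simp
  ultimately have "\<rho> (z + k) < 0" by linarith
  then have zkS: "z + k \<in> S" using zk(2) s(2) N(3) by blast
  have "(\<rho> has_derivative \<rho>' z) (at z)" using d1 N(2) by blast
  then have "\<rho>' z (z + k - z) \<le> 0" by (rule convex_support_derivative(1)[where \<rho> = \<rho>, OF S z]) (fact neg, fact zkS)
  then show False using lin \<open>\<kappa> * t\<^sup>2 > 0\<close> by simp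
qed

text \<open>Hence a Levi flat convex hypersurface has second fundamental form of rank at most one.\<close>

lemma flat_hessian_kernel:
  fixes B :: "(complex^'n) \<Rightarrow>\<^sub>L (complex^'n) \<Rightarrow>\<^sub>L real"
  assumes sym: "\<And>x y. B x y = B y x" and psd: "\<And>h. L h = 0 \<Longrightarrow> B h h \<ge> 0" and lin: "linear L"
    and flat: "levi_form B w = 0" and w: "cpart L w = 0" and h: "L h = 0"
  shows "blinfun_apply (blinfun_apply B h) w = 0"
proof -
  have Lw: "L w = 0" using w Re_cpart[of L w] by simp
  have "cpart L (\<i> *s w) = 0" using w clinear_form_scale[OF clinear_form_cpart[OF lin]] by simp
  then have "L (\<i> *s w) = 0" using Re_cpart[of L "\<i> *s w"] by simp
  then have Bww: "B w w = 0" using psd[OF Lw] psd[of "\<i> *s w"] flat by (simp add: levi_form_def)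
  \<comment> \<open>Because \<open>B w w = 0\<close>, the form along \<open>h + s w\<close> is
    affine in \<open>s\<close>; being nonnegative for all \<open>s\<close>, it has slope
    zero.\<close>
  have ge: "B h h + 2 * s * B h w \<ge> 0" for s
  proof -
    have "L (h + s *\<^sub>R w) = 0" using h Lw by (simp add: linear_add[OF lin] linear_scale[OF lin])
    then have "B (h + s *\<^sub>R w) (h + s *\<^sub>R w) \<ge> 0" by (rule psd)
    then show ?thesis using Bww sym[of w h]
      by (simp add: blinfun.add_left blinfun.add_right blinfun.scaleR_left blinfun.scaleR_right)
  qed
  show ?thesis
  proof (rule ccontr)
    assume nz: "B h w \<noteq> 0"
    have "B h h + 2 * (- (B h h + 1) / (2 * B h w)) * B h w = - 1" using nz by (simp add: field_simps)
    then show False using ge[of "- (B h h + 1) / (2 * B h w)"] by simp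
  qed
qed

text \<open>\<open>\<Psi>\<close> adds to \<open>z - z0\<close> the nonlinear part of each
  \<open>\<rho> i\<close> in the dual direction \<open>v i\<close>. Its derivative at
  \<open>z0\<close> is the identity and duality gives
  \<open>\<rho>' j z0 (\<Psi> z) = \<rho> j z\<close>, so the local inverse \<open>g\<close> makes
  all these functions linear.\<close>

lemma straightening_chart:
  fixes \<rho> :: "nat \<Rightarrow> 'a::euclidean_space \<Rightarrow> real"
  assumes N: "open N" "z0 \<in> N" and I: "finite I"
    and d1: "\<And>i x. i \<in> I \<Longrightarrow> x \<in> N \<Longrightarrow> (\<rho> i has_derivative blinfun_apply (\<rho>' i x)) (at x)"
    and cont: "\<And>i. i \<in> I \<Longrightarrow> continuous_on N (\<rho>' i)" and zero: "\<And>i. i \<in> I \<Longrightarrow> \<rho> i z0 = 0"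
    and dual: "\<And>i j. i \<in> I \<Longrightarrow> j \<in> I \<Longrightarrow> \<rho>' j z0 (v i) = (if i = j then 1 else 0)"
  obtains \<eta> g g' where "\<eta> > 0" "g 0 = z0" "open (g ` ball 0 \<eta>)"
    "\<And>y. y \<in> ball 0 \<eta> \<Longrightarrow> g y \<in> N" "\<And>y. y \<in> ball 0 \<eta> \<Longrightarrow> (g has_derivative g' y) (at y)"
    "\<And>i y. i \<in> I \<Longrightarrow> y \<in> ball 0 \<eta> \<Longrightarrow> \<rho> i (g y) = \<rho>' i z0 y"
proof -
  define \<Psi> where "\<Psi> z = (z - z0) + (\<Sum>i\<in>I. (\<rho> i z - \<rho>' i z0 (z - z0)) *\<^sub>R v i)" for z
  define \<Psi>' where "\<Psi>' z = id_blinfun + (\<Sum>i\<in>I. blinfun_scaleR_left (v i) o\<^sub>L (\<rho>' i z - \<rho>' i z0))" for z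
  have der: "(\<Psi> has_derivative \<Psi>' z) (at z)" if "z \<in> N" for z
  proof -
    have "(\<Psi> has_derivative (\<lambda>h. (h - 0) + (\<Sum>i\<in>I. (\<rho>' i z h - \<rho>' i z0 (h - 0)) *\<^sub>R v i))) (at z)"
      unfolding \<Psi>_def
      by (intro has_derivative_add has_derivative_sum has_derivative_scaleR_left has_derivative_diff has_derivative_ident has_derivative_const
         d1 that bounded_linear.has_derivative[OF blinfun.bounded_linear_right]) auto
    moreover have "(\<lambda>h. (h - 0) + (\<Sum>i\<in>I. (\<rho>' i z h - \<rho>' i z0 (h - 0)) *\<^sub>R v i)) = \<Psi>' z"
      by (simp add: fun_eq_iff \<Psi>'_def blinfun.add_left blinfun.sum_left blinfun.diff_left)
    ultimately show ?thesis by simp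
  qed
  have c\<Psi>: "continuous_on N \<Psi>'" unfolding \<Psi>'_def
    by (intro continuous_intros bounded_bilinear.continuous_on[OF bounded_bilinear_blinfun_compose] cont)
  have i\<Psi>: "id_blinfun o\<^sub>L \<Psi>' z0 = id_blinfun" by (rule blinfun_eqI) (simp add: \<Psi>'_def blinfun.add_left blinfun.sum_left blinfun.diff_left)
  show ?thesis
  proof (rule inverse_function_theorem[OF N(1) der c\<Psi> N(2) i\<Psi>])
    fix U' V g g'
    assume ift: "open U'" "U' \<subseteq> N" "z0 \<in> U'" "open V" "\<Psi> z0 \<in> V" "homeomorphism U' V \<Psi> g"
       "\<And>y. y \<in> V \<Longrightarrow> (g has_derivative (g' y)) (at y)"
    have \<Psi>0: "\<Psi> z0 = 0" using zero by (simp add: \<Psi>_def)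
    then obtain \<eta> where \<eta>: "\<eta> > 0" "ball 0 \<eta> \<subseteq> V" using ift(4,5) openE by metis
    have gU: "g y \<in> U'" "\<Psi> (g y) = y" if "y \<in> ball 0 \<eta>" for y
      using that \<eta>(2) ift(6) unfolding homeomorphism_def by auto
    have coord: "\<rho>' j z0 (\<Psi> z) = \<rho> j z" if "j \<in> I" for j z
    proof -
      have "\<rho>' j z0 (\<Psi> z) = \<rho>' j z0 (z - z0) + (\<Sum>i\<in>I. (\<rho> i z - \<rho>' i z0 (z - z0)) * \<rho>' j z0 (v i))"
        by (simp add: \<Psi>_def blinfun.add_right blinfun.sum_right blinfun.scaleR_right)
      also have "(\<Sum>i\<in>I. (\<rho> i z - \<rho>' i z0 (z - z0)) * \<rho>' j z0 (v i)) = (\<Sum>i\<in>I. if j = i then \<rho> i z - \<rho>' i z0 (z - z0) else 0)"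
        by (rule sum.cong) (use dual that in auto)
      also have "\<dots> = \<rho> j z - \<rho>' j z0 (z - z0)" using I that by (simp add: sum.delta)
      finally show ?thesis by simp
    qed
    have "g ` ball 0 \<eta> = U' \<inter> \<Psi> -` ball 0 \<eta>"
    proof (intro equalityI subsetI)
      fix z assume "z \<in> g ` ball 0 \<eta>"
      then show "z \<in> U' \<inter> \<Psi> -` ball 0 \<eta>" using gU by auto
    next
      fix z assume z: "z \<in> U' \<inter> \<Psi> -` ball 0 \<eta>"
      then have "g (\<Psi> z) = z" using ift(6) unfolding homeomorphism_def by auto
      then show "z \<in> g ` ball 0 \<eta>" using z by (metis IntD2 image_eqI vimageE)
    qed
    moreover have "open (U' \<inter> \<Psi> -` ball 0 \<eta>)"
      using continuous_open_preimage[OF _ ift(1) open_ball] ift(6) unfolding homeomorphism_def by blast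
    ultimately have "open (g ` ball 0 \<eta>)" by simp
    moreover have "g 0 = z0" using ift(3,6) \<Psi>0 unfolding homeomorphism_def by metis
    ultimately show thesis
      using that[of \<eta> g g'] \<eta> gU ift(2,7) coord by (metis subsetD)
  qed
qed

text \<open>Along the part of the boundary where only \<open>\<rho> i\<close> vanishes the direction of the complex
  tangent line has derivative zero, and in the coordinates of the chart this part is convex.\<close>

lemma complex_tangent_locally_constant:
  fixes \<rho> :: "nat \<Rightarrow> complex^'n \<Rightarrow> real"
  assumes \<Omega>: "open \<Omega>" "convex \<Omega>" and U: "open U" "closure \<Omega> \<subseteq> U" "\<Omega> = {z \<in> U. \<forall>i<k. \<rho> i z < 0}"
    and d1: "\<And>i. i < k \<Longrightarrow> \<forall>x\<in>U. (\<rho> i has_derivative blinfun_apply (\<rho>' i x)) (at x)"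
    and d2: "\<And>i. i < k \<Longrightarrow> \<forall>x\<in>U. (\<rho>' i has_derivative blinfun_apply (\<rho>'' i x)) (at x)"
    and cont: "\<And>i. i < k \<Longrightarrow> continuous_on U (\<rho>'' i)"
    and flat: "\<And>i p w. i < k \<Longrightarrow> p \<in> U \<Longrightarrow> \<rho> i p = 0 \<Longrightarrow> cpart (\<rho>' i p) w = 0 \<Longrightarrow> levi_form (\<rho>'' i p) w = 0"
    and z0: "z0 \<in> frontier \<Omega>" and I: "I = {i. i < k \<and> \<rho> i z0 = 0}"
    and dual: "\<And>i j. i \<in> I \<Longrightarrow> j \<in> I \<Longrightarrow> \<rho>' j z0 (v i) = (if i = j then 1 else 0)"
  shows "\<exists>r>0. \<forall>z\<in>frontier \<Omega> \<inter> ball z0 r. \<forall>i<k. \<rho> i z = 0 \<longrightarrow>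
    \<rho> i z0 = 0 \<and> (\<forall>w. cpart (\<rho>' i z) w = 0 \<longleftrightarrow> cpart (\<rho>' i z0) w = 0)"
proof -
  have zU: "z0 \<in> U" "z0 \<in> closure \<Omega>" using z0 U(2) by (auto simp: frontier_def)
  have fI: "finite I" unfolding I by simp
  have Ik: "i < k" if "i \<in> I" for i using that I by simp
  have \<rho>_cont: "continuous_on U (\<rho> i)" if "i < k" for i
    using d1[OF that] by (meson continuous_at_imp_continuous_on has_derivative_continuous)
  have \<rho>'_cont: "continuous_on U (\<rho>' i)" if "i < k" for i
    using d2[OF that] by (meson continuous_at_imp_continuous_on has_derivative_continuous)
  have closure_le: "\<rho> i z \<le> 0" if "z \<in> closure \<Omega>" "i < k" for i z
    by (rule continuous_le_on_closure[OF continuous_on_subset[OF \<rho>_cont[OF that(2)] U(2)] that(1)])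
       (use U(3) that(2) in \<open>auto intro: less_imp_le\<close>)
  \<comment> \<open>Here inactive functions stay negative, and
    \<open>\<rho>' i z (v i) > 1/2\<close> keeps the denominators of \<open>m\<close> below away
    from zero.\<close>
  define N where "N = U \<inter> (\<Inter>j\<in>{..<k} - I. U \<inter> \<rho> j -` {..<0}) \<inter> (\<Inter>i\<in>I. U \<inter> (\<lambda>z. \<rho>' i z (v i)) -` {1/2<..})"
  have N: "open N" "N \<subseteq> U" "z0 \<in> N"
  proof -
    have "open (U \<inter> \<rho> j -` {..<0})" if "j < k" for j
      by (rule continuous_open_preimage[OF \<rho>_cont[OF that] U(1)]) simp
    moreover have "open (U \<inter> (\<lambda>z. \<rho>' i z (v i)) -` {1/2<..})" if "i \<in> I" for i
      by (rule continuous_open_preimage[OF _ U(1)]) (use \<rho>'_cont[OF Ik[OF that]] in \<open>auto intro!: continuous_intros\<close>)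
    ultimately show "open N" unfolding N_def using U(1) fI by (intro open_Int open_INT) auto
    show "N \<subseteq> U" by (auto simp: N_def)
    have "\<rho> j z0 < 0" if "j < k" "j \<notin> I" for j using closure_le[OF zU(2) that(1)] that I by fastforce
    then show "z0 \<in> N" using zU dual by (auto simp: N_def)
  qed
  have NI: "\<rho> j z < 0" if "z \<in> N" "j < k" "j \<notin> I" for j z using that unfolding N_def by blast
  have Nv: "\<rho>' i z (v i) > 1/2" if "z \<in> N" "i \<in> I" for i z using that unfolding N_def by blast
  have p1: "(\<rho> i has_derivative \<rho>' i x) (at x)" if "i \<in> I" "x \<in> N" for i x using d1[OF Ik[OF that(1)]] that(2) N(2) by blast
  have p2: "continuous_on N (\<rho>' i)" if "i \<in> I" for i by (rule continuous_on_subset[OF \<rho>'_cont[OF Ik[OF that]] N(2)])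
  have p3: "\<rho> i z0 = 0" if "i \<in> I" for i using that I by simp
  obtain \<eta> g g' where \<eta>: "\<eta> > 0" and g0: "g 0 = z0" and og: "open (g ` ball 0 \<eta>)"
    and gN: "\<And>y. y \<in> ball 0 \<eta> \<Longrightarrow> g y \<in> N" and gd: "\<And>y. y \<in> ball 0 \<eta> \<Longrightarrow> (g has_derivative g' y) (at y)"
    and \<rho>g: "\<And>i y. i \<in> I \<Longrightarrow> y \<in> ball 0 \<eta> \<Longrightarrow> \<rho> i (g y) = \<rho>' i z0 y"
    by (rule straightening_chart[OF N(1,3) fI p1 p2 p3 dual]; (assumption | (rule that; blast)))
  have g_in: "g y \<in> \<Omega>" if "y \<in> ball 0 \<eta>" "\<And>j. j \<in> I \<Longrightarrow> \<rho>' j z0 y < 0" for y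
    using gN[OF that(1)] NI N(2) \<rho>g[OF _ that(1)] that(2) unfolding U(3) by force
  have gcont: "isCont g y" if "y \<in> ball 0 \<eta>" for y using gd[OF that] has_derivative_continuous by blast
  \<comment> \<open>Every active form equals -1 on \<open>nn\<close>, so it points into
    \<open>\<Omega>\<close> in the chart.\<close>
  define nn where "nn = - (\<Sum>j\<in>I. v j)"
  have shift: "\<rho>' i z0 (\<Sum>j\<in>J. v j) = (if i \<in> J then 1 else 0)" if "i \<in> I" "J \<subseteq> I" for i J
  proof -
    have "\<rho>' i z0 (\<Sum>j\<in>J. v j) = (\<Sum>j\<in>J. if i = j then 1 else 0)"
      unfolding blinfun.sum_right by (rule sum.cong) (use dual that in auto)
    then show ?thesis using finite_subset[OF that(2) fI] by (simp add: sum.delta)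
  qed
  have along: "((\<lambda>s. y + s *\<^sub>R u) \<longlongrightarrow> y) (at_right 0)" for y u :: "complex^'n"
    by (auto intro!: tendsto_eq_intros)
  have in_ball: "eventually (\<lambda>s. y + s *\<^sub>R u \<in> ball 0 \<eta>) (at_right 0)" if "y \<in> ball 0 \<eta>" for y u :: "complex^'n"
    using topological_tendstoD[OF along open_ball that] .
  have g_closure: "g y \<in> closure \<Omega>" if y: "y \<in> ball 0 \<eta>" "\<And>j. j \<in> I \<Longrightarrow> \<rho>' j z0 y \<le> 0" for y
  proof -
    have lim: "((\<lambda>s. g (y + s *\<^sub>R nn)) \<longlongrightarrow> g y) (at_right 0)"
      by (rule isCont_tendsto_compose[OF gcont[OF y(1)] along])
    have "eventually (\<lambda>s. g (y + s *\<^sub>R nn) \<in> closure \<Omega>) (at_right 0)"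
      using in_ball[OF y(1), of nn] eventually_at_right_less[of 0]
    proof eventually_elim
      case (elim s)
      have "\<rho>' j z0 (y + s *\<^sub>R nn) < 0" if "j \<in> I" for j
        using y(2)[OF that] shift[OF that, of I] that elim(2)
        by (simp add: nn_def blinfun.add_right blinfun.diff_right blinfun.scaleR_right blinfun.minus_right)
      then show ?case using g_in[OF elim(1)] closure_subset by blast
    qed
    then show ?thesis by (rule Lim_in_closed_set[OF closed_closure _ trivial_limit_at_right_real lim])
  qed
  \<comment> \<open>The complex differential normalised to be 1 on \<open>v i\<close>. Its vanishing
    in \<open>w\<close> describes the kernel, and unlike the differential itself it can be constant
    along the boundary piece.\<close>
  define m where "m i w y = cpart (\<rho>' i (g y)) w / cpart (\<rho>' i (g y)) (v i)" for i w y
  have den: "cpart (\<rho>' i (g y)) (v i) \<noteq> 0" if "i \<in> I" "y \<in> ball 0 \<eta>" for i y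
    using Nv[OF gN[OF that(2)] that(1)] Re_cpart[of "\<rho>' i (g y)" "v i"] by (auto simp del: Re_cpart)
  have m_cont: "isCont (m i w) y" if "i \<in> I" "y \<in> ball 0 \<eta>" for i w y
  proof -
    have "isCont (\<rho>' i) (g y)"
      using \<rho>'_cont[OF Ik[OF that(1)]] gN[OF that(2)] N(2) U(1) continuous_on_eq_continuous_at by blast
    then have "isCont (\<lambda>y. \<rho>' i (g y)) y" using gcont[OF that(2)] isCont_o2 by blast
    then have "isCont (\<lambda>y. cpart (\<rho>' i (g y)) w) y" for w unfolding cpart_def by (intro continuous_intros)
    then show ?thesis unfolding m_def using den[OF that] by (intro continuous_intros)
  qed
  have m_const: "m i w y1 = m i w y2"
    if i: "i \<in> I" and y1: "y1 \<in> ball 0 \<eta>" "\<rho>' i z0 y1 = 0" "\<And>j. j \<in> I - {i} \<Longrightarrow> \<rho>' j z0 y1 < 0"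
      and y2: "y2 \<in> ball 0 \<eta>" "\<rho>' i z0 y2 = 0" "\<And>j. j \<in> I - {i} \<Longrightarrow> \<rho>' j z0 y2 < 0" for i w y1 y2
  proof -
    note ik = Ik[OF i]
    define c where "c t = y1 + t *\<^sub>R (y2 - y1)" for t :: real
    have c: "c t \<in> ball 0 \<eta>" "\<rho>' i z0 (c t) = 0" "\<And>j. j \<in> I - {i} \<Longrightarrow> \<rho>' j z0 (c t) < 0" if t: "t \<in> {0..1}" for t
    proof -
      have eq: "c t = (1 - t) *\<^sub>R y1 + t *\<^sub>R y2" by (simp add: c_def algebra_simps)
      show "c t \<in> ball 0 \<eta>" unfolding eq using convexD_alt[OF convex_ball y1(1) y2(1)] t by simp
      show "\<rho>' i z0 (c t) = 0" unfolding eq using y1 y2 by (simp add: blinfun.add_right blinfun.scaleR_right)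
      show "\<rho>' j z0 (c t) < 0" if "j \<in> I - {i}" for j
      proof -
        have "\<rho>' j z0 (c t) = (1 - t) * \<rho>' j z0 y1 + t * \<rho>' j z0 y2"
          unfolding eq by (simp add: blinfun.add_right blinfun.scaleR_right)
        also have "\<dots> < 0" using y1(3)[OF that] y2(3)[OF that] t
          by (cases "t = 0") (auto intro!: add_nonpos_neg mult_nonneg_nonpos mult_pos_neg)
        finally show ?thesis .
      qed
    qed
    have der0: "((\<lambda>t. m i w (c t)) has_derivative (\<lambda>h. 0)) (at t within {0..1})" if t: "t \<in> {0..1}" for t
    proof -
      note ct = c[OF t]
      define z where "z = g (c t)"
      define B where "B = \<rho>'' i z"
      define h where "h = g' (c t) (y2 - y1)"
      have zN: "z \<in> N" "z \<in> U" using gN[OF ct(1)] N(2) by (auto simp: z_def)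
      have \<rho>z: "\<rho> i z = 0" "\<And>j. j \<in> I - {i} \<Longrightarrow> \<rho> j z < 0" using \<rho>g ct i by (auto simp: z_def)
      have lin_g': "linear (g' (c t))" using gd[OF ct(1)] has_derivative_linear by blast
      have h0: "\<rho>' i z h = 0"
      proof -
        have "((\<lambda>y. \<rho> i (g y)) has_derivative (\<lambda>k. \<rho>' i z (g' (c t) k))) (at (c t))"
          using has_derivative_compose[OF gd[OF ct(1)], of "\<rho> i"] d1[OF ik] zN by (simp add: z_def)
        moreover have "((\<lambda>y. \<rho> i (g y)) has_derivative \<rho>' i z0) (at (c t))"
          by (rule has_derivative_transform_within_open[OF bounded_linear_imp_has_derivative[OF blinfun.bounded_linear_right] open_ball ct(1)])
             (use \<rho>g[OF i] in auto)
        ultimately have "(\<lambda>k. \<rho>' i z (g' (c t) k)) = \<rho>' i z0" by (rule has_derivative_unique)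
        then have "\<rho>' i z h = \<rho>' i z0 (y2 - y1)" unfolding h_def by metis
        then show ?thesis using y1 y2 by (simp add: blinfun.diff_right)
      qed
      \<comment> \<open>A neighbourhood of \<open>z\<close> in which \<open>\<Omega>\<close> is cut
        out by \<open>\<rho> i\<close> alone, so that convexity constrains the Hessian of
        \<open>\<rho> i\<close>.\<close>
      define Nz where "Nz = N \<inter> (\<Inter>j\<in>I - {i}. U \<inter> \<rho> j -` {..<0})"
      have Nz: "open Nz" "z \<in> Nz" "Nz \<subseteq> U"
      proof -
        have "open (U \<inter> \<rho> j -` {..<0})" if "j \<in> I" for j
          by (rule continuous_open_preimage[OF \<rho>_cont[OF Ik[OF that]] U(1)]) simp
        then show "open Nz" unfolding Nz_def using fI N(1) by (intro open_Int open_INT) auto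
        show "z \<in> Nz" "Nz \<subseteq> U" using zN \<rho>z N(2) by (auto simp: Nz_def)
      qed
      have \<Omega>Nz: "\<Omega> \<inter> Nz = {x \<in> Nz. \<rho> i x < 0}"
      proof (intro equalityI subsetI)
        fix x assume x: "x \<in> {x \<in> Nz. \<rho> i x < 0}"
        have "\<rho> j x < 0" if "j < k" for j
        proof (cases "j \<in> I - {i}")
          case True
          then show ?thesis using x unfolding Nz_def by blast
        next
          case False
          then show ?thesis using x NI[of x j] that unfolding Nz_def by blast
        qed
        then show "x \<in> \<Omega> \<inter> Nz" using x Nz(3) U(3) by auto
      qed (use U(3) ik in auto)
      have zcl: "z \<in> closure \<Omega>" unfolding z_def
      proof (rule g_closure[OF ct(1)])
        show "\<rho>' j z0 (c t) \<le> 0" if "j \<in> I" for j using ct(2) ct(3)[of j] that by (cases "j = i") auto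
      qed
      have neg: "\<rho> i x < 0" if "x \<in> \<Omega>" for x using that U(3) ik by auto
      have n1: "\<rho>' i z ((1 / \<rho>' i z (v i)) *\<^sub>R v i) = 1" using Nv[OF zN(1) i] by (simp add: blinfun.scaleR_right)
      have psd: "B x x \<ge> 0" if "\<rho>' i z x = 0" for x
        unfolding B_def
        by (rule convex_hessian_nonneg[where \<rho> = "\<rho> i" and \<rho>' = "\<rho>' i", OF \<Omega> Nz(1,2) \<Omega>Nz zcl \<rho>z(1) neg _ _ _ n1 that])
           (use d1[OF ik] d2[OF ik] cont[OF ik] Nz(3) in \<open>auto intro: continuous_on_subset\<close>)
      have sym: "B x y = B y x" for x y
        unfolding B_def by (rule C2_symmetric[OF U(1) zN(2) d1[OF ik] d2[OF ik] cont[OF ik]])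
      have kerB: "B h x = 0" if "cpart (\<rho>' i z) x = 0" for x
        by (rule flat_hessian_kernel[where L = "\<rho>' i z", OF sym psd _ _ that h0])
           (use flat[OF ik zN(2) \<rho>z(1) that] in \<open>auto simp: B_def intro: bounded_linear.linear blinfun.bounded_linear_right\<close>)
      note A = clinear_form_cpart_blinfun[of "\<rho>' i z"]
      note Bh = clinear_form_cpart_blinfun[of "B h"]
      have kerB': "cpart (B h) x = 0" if x: "cpart (\<rho>' i z) x = 0" for x
        using kerB[OF x] kerB[of "\<i> *s x"] x by (simp add: cpart_def[of "B h"] clinear_form_scale[OF A])
      define a where "a t = cpart (\<rho>' i (g (c t))) w" for t
      define b where "b t = cpart (\<rho>' i (g (c t))) (v i)" for t
      \<comment> \<open>\<open>cpart (B h)\<close> vanishes on the complex tangent space, which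
        contains \<open>b t *s w - a t *s v i\<close>. The resulting identity is the vanishing of
        the numerator in the quotient rule for \<open>a / b\<close>.\<close>
      have "cpart (B h) (b t *s w - a t *s v i) = 0"
        by (rule kerB') (simp add: clinear_form_diff[OF A] clinear_form_scale[OF A], simp add: a_def b_def z_def)
      then have cross: "b t * cpart (B h) w = a t * cpart (B h) (v i)"
        by (simp add: clinear_form_diff[OF Bh] clinear_form_scale[OF Bh])
      have dc: "(c has_derivative (\<lambda>s. s *\<^sub>R (y2 - y1))) (at t within {0..1})" unfolding c_def
        by (auto intro!: derivative_eq_intros)
      have "((\<lambda>t. g (c t)) has_derivative (\<lambda>s. g' (c t) (s *\<^sub>R (y2 - y1)))) (at t within {0..1})"
        by (rule has_derivative_compose[where f = c, OF dc gd[OF ct(1)]])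
      then have "((\<lambda>t. g (c t)) has_derivative (\<lambda>s. s *\<^sub>R h)) (at t within {0..1})"
        by (simp add: linear_scale[OF lin_g'] h_def)
      moreover have "(\<rho>' i has_derivative \<rho>'' i z) (at (g (c t)))" using d2[OF ik] zN(2) by (simp add: z_def)
      ultimately have "((\<lambda>t. \<rho>' i (g (c t))) has_derivative (\<lambda>s. \<rho>'' i z (s *\<^sub>R h))) (at t within {0..1})"
        by (rule has_derivative_compose[where f = "\<lambda>t. g (c t)"])
      then have d\<rho>': "((\<lambda>t. \<rho>' i (g (c t))) has_derivative (\<lambda>s. s *\<^sub>R B h)) (at t within {0..1})"
        by (simp add: B_def blinfun.scaleR_right)
      have dcp: "((\<lambda>t. cpart (\<rho>' i (g (c t))) x) has_derivative (\<lambda>s. of_real s * cpart (B h) x)) (at t within {0..1})" for x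
      proof -
        have dv: "((\<lambda>t. \<rho>' i (g (c t)) x) has_derivative (\<lambda>s. s * B h x)) (at t within {0..1})" for x
          using bounded_linear.has_derivative[OF blinfun.bounded_linear_left d\<rho>', of x] by (simp add: blinfun.scaleR_left)
        have "((\<lambda>t. cpart (\<rho>' i (g (c t))) x) has_derivative
            (\<lambda>s. of_real (s * B h x) - \<i> * of_real (s * B h (\<i> *s x)))) (at t within {0..1})"
          unfolding cpart_def
          by (intro has_derivative_diff has_derivative_of_real has_derivative_mult_right dv)
        moreover have "(\<lambda>s. of_real (s * B h x) - \<i> * of_real (s * B h (\<i> *s x))) = (\<lambda>s. of_real s * cpart (B h) x)"
          by (simp add: fun_eq_iff cpart_def algebra_simps)
        ultimately show ?thesis by simp
      qed
      have bt: "b t \<noteq> 0" using den[OF i ct(1)] by (simp add: b_def)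
      have "((\<lambda>t. a t / b t) has_derivative (\<lambda>s. (of_real s * cpart (B h) w * b t - a t * (of_real s * cpart (B h) (v i))) / (b t * b t))) (at t within {0..1})"
        unfolding a_def b_def
        by (rule has_derivative_divide'[where f = "\<lambda>t. cpart (\<rho>' i (g (c t))) w" and g = "\<lambda>t. cpart (\<rho>' i (g (c t))) (v i)",
              OF dcp dcp bt[unfolded b_def]])
      moreover have "(\<lambda>s. (of_real s * cpart (B h) w * b t - a t * (of_real s * cpart (B h) (v i))) / (b t * b t)) = (\<lambda>_. 0)"
      proof
        fix s :: real
        have "of_real s * cpart (B h) w * b t - a t * (of_real s * cpart (B h) (v i))
          = of_real s * (b t * cpart (B h) w - a t * cpart (B h) (v i))" by (simp add: algebra_simps)
        then show "(of_real s * cpart (B h) w * b t - a t * (of_real s * cpart (B h) (v i))) / (b t * b t) = 0" using cross by simp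
      qed
      moreover have "(\<lambda>t. m i w (c t)) = (\<lambda>t. a t / b t)" by (simp add: fun_eq_iff m_def a_def b_def)
      ultimately show ?thesis by (simp only:)
    qed
    have "m i w (c 0) = m i w (c 1)"
      by (rule has_derivative_zero_unique[where s = "{0..1::real}", OF _ der0]) auto
    then show ?thesis by (simp add: c_def)
  qed
  have m_eq: "m i w y = m i w 0"
    if i: "i \<in> I" and y: "y \<in> ball 0 \<eta>" "\<rho>' i z0 y = 0" "\<And>j. j \<in> I - {i} \<Longrightarrow> \<rho>' j z0 y \<le> 0" for i w y
  proof -
    \<comment> \<open>\<open>m_const\<close> excludes points where further active functions vanish,
      such as the corner \<open>0\<close>. Moving both \<open>y\<close> and \<open>0\<close> along
      \<open>u\<close> keeps \<open>\<rho>' i z0 = 0\<close> and makes the others negative;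
      continuity of \<open>m\<close> handles \<open>s\<close> tending to 0.\<close>
    define u where "u = - (\<Sum>j\<in>I - {i}. v j)"
    have u: "\<rho>' i z0 u = 0" "\<And>j. j \<in> I - {i} \<Longrightarrow> \<rho>' j z0 u = -1"
      using shift[of _ "I - {i}"] i by (auto simp: u_def blinfun.minus_right)
    have zero: "0 \<in> ball (0 :: complex^'n) \<eta>" using \<eta> by simp
    have lim: "((\<lambda>s. m i w (x + s *\<^sub>R u)) \<longlongrightarrow> m i w x) (at_right 0)" if "x \<in> ball 0 \<eta>" for x
      by (rule isCont_tendsto_compose[OF m_cont[OF i that] along])
    have "eventually (\<lambda>s. m i w (y + s *\<^sub>R u) = m i w (0 + s *\<^sub>R u)) (at_right 0)"
      using in_ball[OF y(1), of u] in_ball[OF zero, of u] eventually_at_right_less[of 0]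
    proof eventually_elim
      case (elim s)
      show ?case
      proof (rule m_const[OF i elim(1) _ _ elim(2)])
        show "\<rho>' i z0 (y + s *\<^sub>R u) = 0" "\<rho>' i z0 (0 + s *\<^sub>R u) = 0"
          using y(2) u(1) by (simp_all add: blinfun.add_right blinfun.scaleR_right)
        show "\<rho>' j z0 (y + s *\<^sub>R u) < 0" "\<rho>' j z0 (0 + s *\<^sub>R u) < 0" if "j \<in> I - {i}" for j
          using y(3)[OF that] u(2)[OF that] elim(3) by (simp_all add: blinfun.add_right blinfun.scaleR_right)
      qed
    qed
    then have "((\<lambda>s. m i w (0 + s *\<^sub>R u)) \<longlongrightarrow> m i w y) (at_right 0)"
      by (rule Lim_transform_eventually[OF lim[OF y(1)]])
    then show ?thesis using lim[OF zero] tendsto_unique[OF trivial_limit_at_right_real] by blast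
  qed
  have "z0 \<in> g ` ball 0 \<eta>" using g0 \<eta> by (metis centre_in_ball image_eqI)
  then obtain r where r: "r > 0" "ball z0 r \<subseteq> g ` ball 0 \<eta>" using og openE by blast
  show ?thesis
  proof (intro exI[of _ r] conjI r(1) ballI allI impI)
    fix z i assume z: "z \<in> frontier \<Omega> \<inter> ball z0 r" and i: "i < k" "\<rho> i z = 0"
    obtain y where y: "y \<in> ball 0 \<eta>" "z = g y" using r(2) z by blast
    have iI: "i \<in> I" using NI[OF gN[OF y(1)] i(1)] i(2) y(2) by force
    then show "\<rho> i z0 = 0" by (simp add: I)
    have "z \<in> closure \<Omega>" using z by (auto simp: frontier_def)
    then have "\<rho>' j z0 y \<le> 0" if "j \<in> I" for j using closure_le[of z j] Ik[OF that] \<rho>g[OF that y(1)] y(2) by simp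
    then have "m i w y = m i w 0" for w using m_eq[OF iI y(1)] \<rho>g[OF iI y(1)] i(2) y(2) by simp
    moreover have "0 \<in> ball (0 :: complex^'n) \<eta>" using \<eta> by simp
    ultimately show "cpart (\<rho>' i z) w = 0 \<longleftrightarrow> cpart (\<rho>' i z0) w = 0" for w
      using den[OF iI y(1)] den[OF iI, of 0] unfolding m_def g0 y(2)[symmetric] by (metis divide_eq_0_iff)
  qed
qed

text \<open>The wedge is taken over a list of the active indices; \<open>idx\<close> translates
  between an index and its position in that list.\<close>

lemma generic_dual_vectors:
  fixes \<rho> :: "nat \<Rightarrow> complex^'n \<Rightarrow> real"
  assumes gen: "generic_presentation U k \<rho>" and z: "z \<in> U" and I: "I = {i. i < k \<and> \<rho> i z = 0}"
    and d: "\<And>i. i < k \<Longrightarrow> (\<rho> i has_derivative L i) (at z)"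
  obtains v where "\<And>i j. i \<in> I \<Longrightarrow> j \<in> I \<Longrightarrow> L j (v i) = (if i = j then 1 else 0)"
proof -
  obtain js where js: "set js = I" "distinct js" using finite_distinct_list[of I] I by auto
  define \<omega>s where "\<omega>s = map L js"
  have fd: "frechet_derivative (\<rho> i) (at z) = L i" if "i \<in> I" for i
    using frechet_derivative_at[OF d] that I by simp
  have eq: "map (\<lambda>i. frechet_derivative (\<rho> i) (at z)) js = \<omega>s" using fd js(1) by (simp add: \<omega>s_def)
  have "wedge (map (\<lambda>i. frechet_derivative (\<rho> i) (at z)) js) \<noteq> (\<lambda>v. 0)"
    by (rule gen[unfolded generic_presentation_def, rule_format]) (use js I z in auto)
  then have nz: "wedge \<omega>s \<noteq> (\<lambda>v. 0)" by (simp only: eq not_False_eq_True)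
  have "linear \<omega>" if "\<omega> \<in> set \<omega>s" for \<omega>
    using that js(1) I has_derivative_linear[OF d] by (auto simp: \<omega>s_def)
  then obtain x where x: "\<And>a b. a < length \<omega>s \<Longrightarrow> b < length \<omega>s \<Longrightarrow> (\<omega>s ! b) (x a) = (if a = b then 1 else 0)"
    using wedge_nonzero_dual[OF _ nz] by blast
  define idx where "idx i = (SOME a. a < length js \<and> js ! a = i)" for i
  have idx: "idx i < length js" "js ! idx i = i" if "i \<in> I" for i
    using someI_ex[of "\<lambda>a. a < length js \<and> js ! a = i"] that js(1) by (auto simp: idx_def in_set_conv_nth)
  have "L j (x (idx i)) = (if i = j then 1 else 0)" if "i \<in> I" "j \<in> I" for i j
  proof -
    have "idx i = idx j \<longleftrightarrow> i = j" using idx[OF that(1)] idx[OF that(2)] by metis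
    then show ?thesis using x[of "idx i" "idx j"] idx[OF that(1)] idx[OF that(2)] by (simp add: \<omega>s_def)
  qed
  then show ?thesis by (rule that)
qed

text \<open>\<open>Act z\<close> collects the defining functions vanishing at \<open>z\<close>, and
  the forms are their complex differentials. Genericity makes each differential nonzero, hence the
  support strict.\<close>

lemma generic_levi_flat_support:
  fixes \<Omega> :: "(complex^'n) set"
  assumes dom: "is_domain \<Omega>" and conv: "convex \<Omega>" and gen: "generic_pw_levi_flat \<Omega>"
  obtains Act a where "flat_support \<Omega> Act a"
proof -
  obtain U k \<rho> where pres: "pw_C2_presentation \<Omega> U k \<rho>" and generic: "generic_presentation U k \<rho>"
    and flat: "\<And>i p. i < k \<Longrightarrow> p \<in> U \<Longrightarrow> \<rho> i p = 0 \<Longrightarrow> levi_flat_at (\<rho> i) p"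
    using gen unfolding generic_pw_levi_flat_def by blast
  have U: "open U" "closure \<Omega> \<subseteq> U" "\<Omega> = {z \<in> U. \<forall>i<k. \<rho> i z < 0}" and C2: "\<And>i. i < k \<Longrightarrow> C2_on (\<rho> i) U"
    using pres unfolding pw_C2_presentation_def by auto
  have "\<forall>i. \<exists>f' f''. i < k \<longrightarrow> (\<forall>x\<in>U. (\<rho> i has_derivative blinfun_apply (f' x)) (at x)) \<and>
     (\<forall>x\<in>U. (f' has_derivative blinfun_apply (f'' x)) (at x)) \<and> continuous_on U f''"
    using C2 unfolding C2_on_def by blast
  then obtain \<rho>' \<rho>'' where d: "\<And>i. i < k \<Longrightarrow> (\<forall>x\<in>U. (\<rho> i has_derivative blinfun_apply (\<rho>' i x)) (at x))"
     "\<And>i. i < k \<Longrightarrow> (\<forall>x\<in>U. (\<rho>' i has_derivative blinfun_apply (\<rho>'' i x)) (at x))" "\<And>i. i < k \<Longrightarrow> continuous_on U (\<rho>'' i)"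
    by metis
  have op: "open \<Omega>" and ne: "\<Omega> \<noteq> {}" using dom by (auto simp: is_domain_def)
  have levi: "levi_form (\<rho>'' i p) w = 0" if "i < k" "p \<in> U" "\<rho> i p = 0" "cpart (\<rho>' i p) w = 0" for i p w
    using levi_flat_at_iff[OF U(1) that(2) d[OF that(1)]] flat[OF that(1-3)] that(4) by blast
  define Act where "Act z = {i. i < k \<and> \<rho> i z = 0}" for z
  have frU: "z \<in> U" "z \<in> closure \<Omega>" if "z \<in> frontier \<Omega>" for z using that U(2) by (auto simp: frontier_def)
  have dual: "\<exists>v. \<forall>i\<in>Act z. \<forall>j\<in>Act z. \<rho>' j z (v i) = (if i = j then 1 else 0)" if z: "z \<in> frontier \<Omega>" for z
  proof -
    have dz: "(\<rho> i has_derivative \<rho>' i z) (at z)" if "i < k" for i using d(1)[OF that] frU(1)[OF z] by blast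
    obtain v where "\<And>i j. i \<in> Act z \<Longrightarrow> j \<in> Act z \<Longrightarrow> \<rho>' j z (v i) = (if i = j then 1 else 0)"
      by (rule generic_dual_vectors[OF generic frU(1)[OF z] Act_def dz]; (assumption | (rule that; blast)))
    then show ?thesis by blast
  qed
  have "flat_support \<Omega> Act (\<lambda>i z. cpart (\<rho>' i z))"
  proof (rule flat_support.intro)
    show "open \<Omega>" by fact
    show "\<Omega> \<noteq> {}" by fact
    show "finite (Act z)" for z by (simp add: Act_def)
    show "Act z \<noteq> {}" if z: "z \<in> frontier \<Omega>" for z
    proof -
      have "z \<notin> \<Omega>" using z op by (auto simp: frontier_def interior_open)
      then obtain i where i: "i < k" "\<not> \<rho> i z < 0" using U(3) frU(1)[OF z] by blast
      have "continuous_on U (\<rho> i)"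
        using d(1)[OF i(1)] by (meson continuous_at_imp_continuous_on has_derivative_continuous)
      then have "\<rho> i z \<le> 0"
        by (rule continuous_le_on_closure[OF continuous_on_subset[OF _ U(2)] frU(2)[OF z]])
           (use U(3) i(1) in \<open>auto intro: less_imp_le\<close>)
      then show ?thesis using i by (auto simp: Act_def)
    qed
    show "clinear_form (cpart (\<rho>' i z))" if "z \<in> frontier \<Omega>" "i \<in> Act z" for z i by (rule clinear_form_cpart_blinfun)
    show "Re (cpart (\<rho>' i z) (y - z)) < 0" if z: "z \<in> frontier \<Omega>" and i: "i \<in> Act z" and y: "y \<in> \<Omega>" for z i y
    proof -
      obtain v where v: "\<rho>' i z (v i) = 1" using dual[OF z] i by metis
      have ik: "i < k" "\<rho> i z = 0" using i by (auto simp: Act_def)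
      have dz: "(\<rho> i has_derivative \<rho>' i z) (at z)" using d(1)[OF ik(1)] frU(1)[OF z] by blast
      have neg: "\<rho> i x < 0" if "x \<in> \<Omega>" for x using that U(3) ik(1) by blast
      have "\<rho>' i z (y - z) < 0"
        by (rule convex_support_derivative(2)[where \<rho> = "\<rho> i", OF op conv frU(2)[OF z] ik(2) dz neg y v])
      then show ?thesis by simp
    qed
    show "\<exists>r>0. \<forall>y\<in>frontier \<Omega> \<inter> ball z r. Act y \<subseteq> Act z \<and>
        (\<forall>i\<in>Act y. \<forall>w. cpart (\<rho>' i y) w = 0 \<longleftrightarrow> cpart (\<rho>' i z) w = 0)" if z: "z \<in> frontier \<Omega>" for z
    proof -
      obtain v where v: "\<And>i j. i \<in> Act z \<Longrightarrow> j \<in> Act z \<Longrightarrow> \<rho>' j z (v i) = (if i = j then 1 else 0)"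
        using dual[OF z] by blast
      have "\<exists>r>0. \<forall>y\<in>frontier \<Omega> \<inter> ball z r. \<forall>i<k. \<rho> i y = 0 \<longrightarrow>
         \<rho> i z = 0 \<and> (\<forall>w. cpart (\<rho>' i y) w = 0 \<longleftrightarrow> cpart (\<rho>' i z) w = 0)"
        by (rule complex_tangent_locally_constant[OF op conv U d levi z Act_def v])
      then show ?thesis by (auto simp: Act_def)
    qed
  qed
  then show ?thesis by (rule that)
qed

section \<open>Conclusion in dimension two\<close>

lemma clinear_form_nontrivial_kernel:
  fixes A :: "complex^2 \<Rightarrow> complex"
  assumes A: "clinear_form A"
  shows "\<exists>e. A e = 0 \<and> e \<noteq> 0"
proof (cases "A (axis 1 1) = 0")
  case True
  then show ?thesis by (intro exI[of _ "axis 1 1"]) simp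
next
  case False
  define e where "e = A (axis 2 1) *s axis 1 1 - A (axis 1 1) *s (axis 2 1 :: complex^2)"
  have "A e = 0" unfolding e_def clinear_form_diff[OF A] clinear_form_scale[OF A] by simp
  moreover have "e $ 2 \<noteq> 0" using False by (simp add: e_def axis_def)
  ultimately show ?thesis by (intro exI[of _ e]) auto
qed

theorem theorem1p6:
  fixes \<Omega> \<Omega>' :: "(complex^2) set"
  assumes "is_domain \<Omega>" and "bounded \<Omega>" and "convex \<Omega>"
    and "generic_pw_levi_flat \<Omega>"
    and "is_domain \<Omega>'" and "bounded \<Omega>'"
    and "biholomorphic \<Omega> \<Omega>'"
  shows "\<forall>p. C2_smooth_boundary_point \<Omega>' p \<longrightarrow> boundary_levi_flat_at \<Omega>' p"
proof (intro allI impI)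
  fix p assume p: "C2_smooth_boundary_point \<Omega>' p"
  obtain Act a where fs: "flat_support \<Omega> Act a" using generic_levi_flat_support assms(1,3,4) by blast
  interpret flat_support \<Omega> Act a by (rule fs)
  obtain f g where bih: "holomorphic_map f \<Omega> \<and> holomorphic_map g \<Omega>' \<and> f ` \<Omega> = \<Omega>' \<and> g ` \<Omega>' = \<Omega> \<and>
      (\<forall>z\<in>\<Omega>. g (f z) = z) \<and> (\<forall>w\<in>\<Omega>'. f (g w) = w)"
    using assms(7)[unfolded biholomorphic_def] by (elim exE)
  then have f: "holomorphic_map f \<Omega>" and g: "holomorphic_map g \<Omega>'" and fg: "f ` \<Omega> = \<Omega>'" "g ` \<Omega>' = \<Omega>"
    "\<And>z. z \<in> \<Omega> \<Longrightarrow> g (f z) = z" "\<And>w. w \<in> \<Omega>' \<Longrightarrow> f (g w) = w"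
    by simp_all
  have p_fr: "p \<in> closure \<Omega>'" "p \<notin> \<Omega>'"
    using p assms(5) by (auto simp: C2_smooth_boundary_point_def is_domain_def frontier_def interior_open)
  show "boundary_levi_flat_at \<Omega>' p"
    unfolding boundary_levi_flat_at_def
  proof (intro allI impI)
    fix V \<rho> assume "C2_local_defining \<Omega>' p V \<rho>"
    then have V: "open V" "p \<in> V" and C2: "C2_on \<rho> V" and \<Omega>'V: "\<Omega>' \<inter> V = {z \<in> V. \<rho> z < 0}" and p0: "\<rho> p = 0"
      and grad: "\<exists>D. GDERIV \<rho> p :> D \<and> D \<noteq> 0"
      unfolding C2_local_defining_def by auto
    obtain \<rho>' \<rho>'' where d: "\<forall>x\<in>V. (\<rho> has_derivative blinfun_apply (\<rho>' x)) (at x)"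
      "\<forall>x\<in>V. (\<rho>' has_derivative blinfun_apply (\<rho>'' x)) (at x)" "continuous_on V \<rho>''"
      using C2 unfolding C2_on_def by blast
    obtain D where D: "(\<rho> has_derivative (\<lambda>h. h \<bullet> D)) (at p)" "D \<noteq> 0" using grad unfolding gderiv_def by blast
    have "blinfun_apply (\<rho>' p) = (\<lambda>h. h \<bullet> D)" using d(1) V(2) D(1) has_derivative_unique by blast
    then have DD: "\<rho>' p D \<noteq> 0" using D(2) by simp
    have "levi_form (\<rho>'' p) w = 0" if w: "cpart (\<rho>' p) w = 0" for w
    proof (rule ccontr)
      assume "levi_form (\<rho>'' p) w \<noteq> 0"
      then consider "levi_form (\<rho>'' p) w > 0" | "levi_form (\<rho>'' p) w < 0" by linarith
      then show False
      proof cases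
        case 1
        obtain s c \<Lambda> where s: "s > 0" "c > 0" "ball p s \<subseteq> V" and \<Lambda>: "\<And>q. \<Lambda> q 0 = 0" "\<And>q. holo_on (\<Lambda> q) UNIV"
          "\<And>q q'. q \<in> ball p s \<Longrightarrow> q' \<in> ball p s \<Longrightarrow> \<rho> q \<le> 0 \<Longrightarrow> \<rho> q' \<le> 0 \<Longrightarrow>
             Re (\<Lambda> q (q' - q)) \<le> - 2 * \<rho> q - c * (norm (q' - q))\<^sup>2"
          using strictly_pseudoconvex_support[OF V d p0 DD w 1] by metis
        have \<rho>_cont: "continuous_on (ball p s) \<rho>"
          using d(1) s(3) by (meson continuous_at_imp_continuous_on has_derivative_continuous subsetD)
        have mem: "q \<in> \<Omega>' \<longleftrightarrow> \<rho> q < 0" if "q \<in> ball p s" for q using \<Omega>'V s(3) that by blast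
        have ker: "\<exists>e\<in>K. e \<noteq> 0" if "z \<in> frontier \<Omega>" "K \<in> dirs z" for z K
          using that clinear_form_nontrivial_kernel lin by (fastforce simp: dirs_def kern_def)
        show False
          by (rule no_strictly_pseudoconvex_image[OF assms(2) ker f g fg(1-3) assms(6) p_fr(1) s(1) \<rho>_cont mem p0 s(2) \<Lambda>])
      next
        case 2
        \<comment> \<open>Rescaled so that \<open>\<rho>' p n = 1\<close>: then \<open>- n\<close>
          points into \<open>\<Omega>'\<close>, and the disc centres are
          \<open>p - t n\<close>.\<close>
        define n where "n = (1 / \<rho>' p D) *\<^sub>R D"
        have n: "\<rho>' p n = 1" using DD by (simp add: n_def blinfun.scaleR_right)
        obtain b \<sigma> where "\<sigma> > 0" and discs: "\<And>t \<xi>. 0 \<le> t \<Longrightarrow> t \<le> \<sigma> \<Longrightarrow> cmod \<xi> \<le> \<sigma> \<Longrightarrow> t > 0 \<or> \<xi> \<noteq> 0 \<Longrightarrow>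
            p - t *\<^sub>R n + \<xi> *s w + \<xi>\<^sup>2 *s b \<in> V \<and> \<rho> (p - t *\<^sub>R n + \<xi> *s w + \<xi>\<^sup>2 *s b) < 0"
          using pseudoconcave_discs[OF V d p0 n w 2] by metis
        show False
          by (rule no_pseudoconcave_image[OF assms(2) f g fg(1,2,4) p_fr(2) \<open>\<sigma> > 0\<close>, of n w b])
             (use discs \<Omega>'V in blast)+
      qed
    qed
    then show "levi_flat_at \<rho> p" using levi_flat_at_iff[OF V d] by blast
  qed
qed

end
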